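(* Let $\Delta$ be a finite labelled simplicial graph (defining graph). The Artin group $G(\Delta)$ is weakly hyperbolic relative to the family of its finite type standard parabolic subgroups if and only if its Deligne complex $\mathbb{D}$ is a Gromov hyperbolic space.
   Context: **Artin and Coxeter groups.** A defining graph is a finite simplicial graph $\Delta$ with vertex set $V(\Delta)$ and edge set $E(\Delta)$, in which each edge $\{s,t\}$ carries a label $m_{st}\in\{2,3,4,\dots\}$. The Artin group $G=G(\Delta)$ has generating set $V(\Delta)$ and, for each edge $\{s,t\}\in E(\Delta)$, one relation $ststs\cdots = tstst\cdots$ (both words alternating, of length $m_{st}$); there is no relation between $s$ and $t$ if they do not span an edge. The Coxeter group $W(\Delta)$ is obtained by adding the relations $s^2=1$ for all $s\in V(\Delta)$. For $T\subseteq V(\Delta)$, $\Delta_T$ is the full labelled subgraph spanned by $T$, and $G_T$ is the subgroup of $G(\Delta)$ generated by $T$ (canonically isomorphic to $G(\Delta_T)$; $G_\emptyset=1$, $W(\Delta_\emptyset)=1$). The subgroups $G_T$ are the standard parabolic subgroups; $G_T$ is of finite type if $W(\Delta_T)$ is finite. Put $\mathcal V_f=\{T\subseteq V(\Delta) : W(\Delta_T)\text{ is finite}\}$ (so $\emptyset\in\mathcal V_f$). The family of finite type standard parabolic subgroups is $\{G_T : T\in\mathcal V_f\}$. **Deligne complex.** $\mathbb D$ is the simplicial complex whose vertices are the cosets $gG_T$ ($g\in G$, $T\in\mathcal V_f$) and whose simplices are the finite chains of such cosets, totally ordered by inclusion. $G$ acts by left multiplication, with fundamental domain the finite subcomplex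 $K$ spanned by the vertices $G_T$, $T\in\mathcal V_f$. A piecewise Euclidean (or piecewise hyperbolic) metric on $K$ (each simplex is given the metric of a nondegenerate Euclidean, resp. hyperbolic, simplex, compatibly on common faces) induces a $G$-equivariant length metric on $\mathbb D$. All such metrics are $G$-equivariantly quasi-isometric to the $1$-skeleton of $\mathbb D$ with unit length edges; "the Deligne complex is Gromov hyperbolic" means with respect to any such equivariant piecewise Euclidean or piecewise hyperbolic metric. **Weak relative hyperbolicity.** Let $G$ be a group with a finite generating set $S$, and $\mathcal H$ a finite family of subgroups. The coned-off Cayley graph $\Gamma_{S,\mathcal H}$ is obtained from the Cayley graph $\Gamma_S$ (edges of length $1$) by adding a vertex $V_{gH}$ for each left coset $gH$, $g\in G$, $H\in\mathcal H$, and joining $V_{gH}$ by an edge of length $\tfrac12$ to each vertex of $\Gamma_S$ labelled by an element of $gH$. $G$ is weakly hyperbolic relative to $\mathcal H$ if $\Gamma_{S,\mathcal H}$ is a Gromov hyperbolic space (this is independent of the choice of the finite generating set $S$). *)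

theory Defs
  imports "HOL-Analysis.Analysis" "HOL-Algebra.Generated_Groups"
begin

section \<open>Groups given by generators and relations\<close>

text \<open>A word over \<^term>\<open>X\<close> is a list of letters \<^term>\<open>(s, e)\<close>, read as the generator
  \<^term>\<open>s\<close> if \<^term>\<open>e\<close> is \<^term>\<open>True\<close> and as its inverse otherwise.\<close>

type_synonym 'v word = "('v \<times> bool) list"

definition words :: "'v set \<Rightarrow> 'v word set" where
  "words X = lists (X \<times> UNIV)"

inductive pres_eq :: "'v set \<Rightarrow> ('v word \<times> 'v word) set \<Rightarrow> 'v word \<Rightarrow> 'v word \<Rightarrow> bool"
  for X R where
  refl: "u \<in> words X \<Longrightarrow> pres_eq X R u u"
| sym: "pres_eq X R u v \<Longrightarrow> pres_eq X R v u"
| trans: "pres_eq X R u v \<Longrightarrow> pres_eq X R v w \<Longrightarrow> pres_eq X R u w"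
| append: "pres_eq X R u u' \<Longrightarrow> pres_eq X R v v' \<Longrightarrow> pres_eq X R (u @ v) (u' @ v')"
| cancel: "s \<in> X \<Longrightarrow> pres_eq X R [(s, e), (s, \<not> e)] []"
| relation: "(u, v) \<in> R \<Longrightarrow> u \<in> words X \<Longrightarrow> v \<in> words X \<Longrightarrow> pres_eq X R u v"

definition presented_group :: "'v set \<Rightarrow> ('v word \<times> 'v word) set \<Rightarrow> 'v word set monoid" where
  "presented_group X R =
    \<lparr> carrier = words X // {(u, v). pres_eq X R u v},
      mult = (\<lambda>A B. {w. \<exists>u\<in>A. \<exists>v\<in>B. pres_eq X R (u @ v) w}),
      one = {w. pres_eq X R [] w} \<rparr>"

section \<open>Artin groups and Coxeter groups\<close>

record 'v labelled_graph =
  verts :: "'v set"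
  edges :: "'v set set"
  label :: "'v set \<Rightarrow> nat"

text \<open>Finiteness of the graph is supplied by the sort \<open>finite\<close> of the type of vertices;
  the vertex set may be any subset of that type, including the empty set.\<close>

definition defining_graph :: "'v::finite labelled_graph \<Rightarrow> bool" where
  "defining_graph \<Delta> \<longleftrightarrow>
    (\<forall>e\<in>edges \<Delta>. e \<subseteq> verts \<Delta> \<and> card e = 2 \<and> 2 \<le> label \<Delta> e)"

definition full_subgraph :: "'v labelled_graph \<Rightarrow> 'v set \<Rightarrow> 'v labelled_graph" where
  "full_subgraph \<Delta> T = \<Delta>\<lparr> verts := T, edges := {e \<in> edges \<Delta>. e \<subseteq> T} \<rparr>"

fun alternating :: "'v \<Rightarrow> 'v \<Rightarrow> nat \<Rightarrow> 'v word" where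
  "alternating s t 0 = []"
| "alternating s t (Suc n) = (s, True) # alternating t s n"

definition artin_relations :: "'v labelled_graph \<Rightarrow> ('v word \<times> 'v word) set" where
  "artin_relations \<Delta> =
    {(alternating s t (label \<Delta> {s, t}), alternating t s (label \<Delta> {s, t})) | s t. {s, t} \<in> edges \<Delta>}"

definition artin_group :: "'v labelled_graph \<Rightarrow> 'v word set monoid" where
  "artin_group \<Delta> = presented_group (verts \<Delta>) (artin_relations \<Delta>)"

definition coxeter_group :: "'v labelled_graph \<Rightarrow> 'v word set monoid" where
  "coxeter_group \<Delta> = presented_group (verts \<Delta>)
    (artin_relations \<Delta> \<union> {([(s, True), (s, True)], []) | s. s \<in> verts \<Delta>})"

definition artin_gen :: "'v labelled_graph \<Rightarrow> 'v \<Rightarrow> 'v word set" where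
  "artin_gen \<Delta> s = {w. pres_eq (verts \<Delta>) (artin_relations \<Delta>) [(s, True)] w}"

definition std_parabolic :: "'v labelled_graph \<Rightarrow> 'v set \<Rightarrow> 'v word set set" where
  "std_parabolic \<Delta> T = generate (artin_group \<Delta>) (artin_gen \<Delta> ` T)"

definition finite_type_subsets :: "'v labelled_graph \<Rightarrow> 'v set set" where
  "finite_type_subsets \<Delta> =
    {T. T \<subseteq> verts \<Delta> \<and> finite (carrier (coxeter_group (full_subgraph \<Delta> T)))}"

definition finite_type_parabolics :: "'v labelled_graph \<Rightarrow> 'v word set set set" where
  "finite_type_parabolics \<Delta> = std_parabolic \<Delta> ` finite_type_subsets \<Delta>"

section \<open>Gromov hyperbolic spaces\<close>

definition gromov_product :: "('p \<Rightarrow> 'p \<Rightarrow> real) \<Rightarrow> 'p \<Rightarrow> 'p \<Rightarrow> 'p \<Rightarrow> real" where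
  "gromov_product d w x y = (d w x + d w y - d x y) / 2"

definition gromov_hyperbolic :: "'p set \<Rightarrow> ('p \<Rightarrow> 'p \<Rightarrow> real) \<Rightarrow> bool" where
  "gromov_hyperbolic M d \<longleftrightarrow> Metric_space M d \<and>
    (\<exists>\<delta>. \<forall>w\<in>M. \<forall>x\<in>M. \<forall>y\<in>M. \<forall>z\<in>M.
      min (gromov_product d w x y) (gromov_product d w y z) - \<delta> \<le> gromov_product d w x z)"

section \<open>Geometric realizations and length metrics\<close>

text \<open>Points of a geometric simplex, and of the realization of a simplicial complex (given as
  its set of nonempty simplices), are written in barycentric coordinates.\<close>

definition geom_simplex :: "'x set \<Rightarrow> ('x \<Rightarrow> real) set" where
  "geom_simplex \<sigma> = {x. (\<forall>v. 0 \<le> x v) \<and> (\<forall>v. v \<notin> \<sigma> \<longrightarrow> x v = 0) \<and> sum x \<sigma> = 1}"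

definition realization :: "'x set set \<Rightarrow> ('x \<Rightarrow> real) set" where
  "realization K = (\<Union>\<sigma>\<in>K. geom_simplex \<sigma>)"

text \<open>The affine extension of a map \<^term>\<open>f\<close> of vertices to points of the realization.\<close>

definition push :: "('x \<Rightarrow> 'y) \<Rightarrow> ('x \<Rightarrow> real) \<Rightarrow> ('y \<Rightarrow> real)" where
  "push f x = (\<lambda>w. \<Sum>v | x v \<noteq> 0 \<and> f v = w. x v)"

text \<open>\<^term>\<open>step x y r\<close> means that \<^term>\<open>x\<close> and \<^term>\<open>y\<close> lie in a common metric simplex and
  have distance \<^term>\<open>r\<close> there. The length metric is the infimum of the lengths of
  the strings \<open>x = x\<^sub>0, \<dots>, x\<^sub>n = y\<close> whose consecutive points are related by \<^term>\<open>step\<close>.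
  It is used for connected complexes only; the value \<open>0\<close> off \<^term>\<open>M\<close> is there because
  \<^locale>\<open>Metric_space\<close> requires nonnegativity and symmetry on the whole type.\<close>

inductive string_length :: "('p \<Rightarrow> 'p \<Rightarrow> real \<Rightarrow> bool) \<Rightarrow> 'p \<Rightarrow> 'p \<Rightarrow> real \<Rightarrow> bool"
  for step where
  nil: "string_length step x x 0"
| cons: "step x y r \<Longrightarrow> string_length step y z l \<Longrightarrow> string_length step x z (r + l)"

definition length_dist :: "'p set \<Rightarrow> ('p \<Rightarrow> 'p \<Rightarrow> real \<Rightarrow> bool) \<Rightarrow> 'p \<Rightarrow> 'p \<Rightarrow> real" where
  "length_dist M step x y =
    (if x \<in> M \<and> y \<in> M then Inf {l. string_length step x y l} else 0)"

section \<open>Weak relative hyperbolicity\<close>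

datatype 'g coned_vertex = Elt 'g | Cone "'g set"

definition cayley_edges :: "('g, 'm) monoid_scheme \<Rightarrow> 'g set \<Rightarrow> 'g coned_vertex set set" where
  "cayley_edges G S = {{Elt g, Elt (g \<otimes>\<^bsub>G\<^esub> s)} | g s. g \<in> carrier G \<and> s \<in> S}"

definition cone_edges :: "('g, 'm) monoid_scheme \<Rightarrow> 'g set set \<Rightarrow> 'g coned_vertex set set" where
  "cone_edges G \<H> =
    {{Elt h, Cone (g <#\<^bsub>G\<^esub> H)} | g h H. g \<in> carrier G \<and> H \<in> \<H> \<and> h \<in> g <#\<^bsub>G\<^esub> H}"

definition coned_off_vertices :: "('g, 'm) monoid_scheme \<Rightarrow> 'g set set \<Rightarrow> 'g coned_vertex set" where
  "coned_off_vertices G \<H> =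
    Elt ` carrier G \<union> {Cone (g <#\<^bsub>G\<^esub> H) | g H. g \<in> carrier G \<and> H \<in> \<H>}"

definition coned_off_points ::
  "('g, 'm) monoid_scheme \<Rightarrow> 'g set \<Rightarrow> 'g set set \<Rightarrow> ('g coned_vertex \<Rightarrow> real) set" where
  "coned_off_points G S \<H> =
    realization ((\<lambda>v. {v}) ` coned_off_vertices G \<H> \<union> cayley_edges G S \<union> cone_edges G \<H>)"

text \<open>The distance of two points of an edge \<^term>\<open>e\<close> of length \<open>1\<close>: on \<^term>\<open>{u, v}\<close> with
  \<^term>\<open>u \<noteq> v\<close> it equals \<^term>\<open>\<bar>x u - y u\<bar>\<close> and \<^term>\<open>\<bar>x v - y v\<bar>\<close>.\<close>

definition unit_edge_dist :: "'x set \<Rightarrow> ('x \<Rightarrow> real) \<Rightarrow> ('x \<Rightarrow> real) \<Rightarrow> real" where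
  "unit_edge_dist e x y = (\<Sum>v\<in>e. \<bar>x v - y v\<bar>) / 2"

definition coned_off_step ::
  "('g, 'm) monoid_scheme \<Rightarrow> 'g set \<Rightarrow> 'g set set \<Rightarrow>
    ('g coned_vertex \<Rightarrow> real) \<Rightarrow> ('g coned_vertex \<Rightarrow> real) \<Rightarrow> real \<Rightarrow> bool" where
  "coned_off_step G S \<H> x y r \<longleftrightarrow>
    (\<exists>e\<in>cayley_edges G S. x \<in> geom_simplex e \<and> y \<in> geom_simplex e \<and> r = unit_edge_dist e x y) \<or>
    (\<exists>e\<in>cone_edges G \<H>. x \<in> geom_simplex e \<and> y \<in> geom_simplex e \<and> r = unit_edge_dist e x y / 2)"

definition weakly_hyperbolic_rel ::
  "('g, 'm) monoid_scheme \<Rightarrow> 'g set \<Rightarrow> 'g set set \<Rightarrow> bool" where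
  "weakly_hyperbolic_rel G S \<H> \<longleftrightarrow>
    gromov_hyperbolic (coned_off_points G S \<H>)
      (length_dist (coned_off_points G S \<H>) (coned_off_step G S \<H>))"

section \<open>The Deligne complex\<close>

definition deligne_vertices :: "'v labelled_graph \<Rightarrow> 'v word set set set" where
  "deligne_vertices \<Delta> =
    {g <#\<^bsub>artin_group \<Delta>\<^esub> std_parabolic \<Delta> T | g T.
      g \<in> carrier (artin_group \<Delta>) \<and> T \<in> finite_type_subsets \<Delta>}"

definition deligne_complex :: "'v labelled_graph \<Rightarrow> 'v word set set set set" where
  "deligne_complex \<Delta> = {\<sigma>. finite \<sigma> \<and> \<sigma> \<noteq> {} \<and> subset.chain (deligne_vertices \<Delta>) \<sigma>}"

definition fundamental_domain :: "'v labelled_graph \<Rightarrow> 'v word set set set set" where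
  "fundamental_domain \<Delta> = {\<sigma> \<in> deligne_complex \<Delta>. \<sigma> \<subseteq> finite_type_parabolics \<Delta>}"

text \<open>A metric on \<^term>\<open>K\<close> is a family \<^term>\<open>\<rho>\<close> of metrics on its geometric simplices.\<close>

definition compatible_on_faces ::
  "'x set set \<Rightarrow> ('x set \<Rightarrow> ('x \<Rightarrow> real) \<Rightarrow> ('x \<Rightarrow> real) \<Rightarrow> real) \<Rightarrow> bool" where
  "compatible_on_faces K \<rho> \<longleftrightarrow>
    (\<forall>\<sigma>\<in>K. \<forall>\<tau>\<in>K. \<tau> \<subseteq> \<sigma> \<longrightarrow>
      (\<forall>x\<in>geom_simplex \<tau>. \<forall>y\<in>geom_simplex \<tau>. \<rho> \<tau> x y = \<rho> \<sigma> x y))"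

definition simplex_point :: "('x \<Rightarrow> 'e::real_vector) \<Rightarrow> 'x set \<Rightarrow> ('x \<Rightarrow> real) \<Rightarrow> 'e" where
  "simplex_point p \<sigma> x = (\<Sum>v\<in>\<sigma>. x v *\<^sub>R p v)"

definition euclidean_simplex ::
  "('x \<Rightarrow> 'e::euclidean_space) \<Rightarrow> 'x set \<Rightarrow> (('x \<Rightarrow> real) \<Rightarrow> ('x \<Rightarrow> real) \<Rightarrow> real) \<Rightarrow> bool" where
  "euclidean_simplex p \<sigma> d \<longleftrightarrow> inj_on p \<sigma> \<and> \<not> affine_dependent (p ` \<sigma>) \<and>
    (\<forall>x\<in>geom_simplex \<sigma>. \<forall>y\<in>geom_simplex \<sigma>. d x y = dist (simplex_point p \<sigma> x) (simplex_point p \<sigma> y))"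

text \<open>Hyperbolic space is the upper sheet of the hyperboloid in Minkowski space
  \<^typ>\<open>real \<times> 'e\<close>. The point of a hyperbolic simplex with barycentric coordinates \<^term>\<open>x\<close> is
  the radial projection to the hyperboloid of the affine combination of the vertices.\<close>

definition lorentz :: "real \<times> 'e::euclidean_space \<Rightarrow> real \<times> 'e \<Rightarrow> real" where
  "lorentz a b = fst a * fst b - snd a \<bullet> snd b"

definition hyperboloid :: "(real \<times> 'e::euclidean_space) set" where
  "hyperboloid = {a. 0 < fst a \<and> lorentz a a = 1}"

definition radial_proj :: "real \<times> 'e::euclidean_space \<Rightarrow> real \<times> 'e" where
  "radial_proj a = (1 / sqrt (lorentz a a)) *\<^sub>R a"

definition hyp_dist :: "real \<times> 'e::euclidean_space \<Rightarrow> real \<times> 'e \<Rightarrow> real" where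
  "hyp_dist a b = arcosh (lorentz a b)"

definition hyperbolic_simplex ::
  "('x \<Rightarrow> real \<times> 'e::euclidean_space) \<Rightarrow> 'x set \<Rightarrow>
    (('x \<Rightarrow> real) \<Rightarrow> ('x \<Rightarrow> real) \<Rightarrow> real) \<Rightarrow> bool" where
  "hyperbolic_simplex p \<sigma> d \<longleftrightarrow>
    p ` \<sigma> \<subseteq> hyperboloid \<and> inj_on p \<sigma> \<and> independent (p ` \<sigma>) \<and>
    (\<forall>x\<in>geom_simplex \<sigma>. \<forall>y\<in>geom_simplex \<sigma>.
      d x y = hyp_dist (radial_proj (simplex_point p \<sigma> x)) (radial_proj (simplex_point p \<sigma> y)))"

text \<open>The simplices of the fundamental domain have dimension at most the number of vertices of
  \<^term>\<open>\<Delta>\<close>, so the Euclidean space \<^typ>\<open>real ^ 'v\<close>, resp. the hyperbolic space in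
  \<^typ>\<open>real \<times> (real ^ 'v)\<close>, is large enough to contain every simplex of the relevant dimensions.\<close>

type_synonym 'v deligne_vertex = "'v word set set"

definition piecewise_euclidean ::
  "'v::finite labelled_graph \<Rightarrow>
    ('v deligne_vertex set \<Rightarrow> ('v deligne_vertex \<Rightarrow> real) \<Rightarrow> ('v deligne_vertex \<Rightarrow> real) \<Rightarrow> real) \<Rightarrow> bool"
  where
  "piecewise_euclidean \<Delta> \<rho> \<longleftrightarrow> compatible_on_faces (fundamental_domain \<Delta>) \<rho> \<and>
    (\<forall>\<sigma>\<in>fundamental_domain \<Delta>. \<exists>p :: 'v deligne_vertex \<Rightarrow> real ^ 'v. euclidean_simplex p \<sigma> (\<rho> \<sigma>))"

definition piecewise_hyperbolic ::
  "'v::finite labelled_graph \<Rightarrow>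
    ('v deligne_vertex set \<Rightarrow> ('v deligne_vertex \<Rightarrow> real) \<Rightarrow> ('v deligne_vertex \<Rightarrow> real) \<Rightarrow> real) \<Rightarrow> bool"
  where
  "piecewise_hyperbolic \<Delta> \<rho> \<longleftrightarrow> compatible_on_faces (fundamental_domain \<Delta>) \<rho> \<and>
    (\<forall>\<sigma>\<in>fundamental_domain \<Delta>. \<exists>p :: 'v deligne_vertex \<Rightarrow> real \<times> (real ^ 'v). hyperbolic_simplex p \<sigma> (\<rho> \<sigma>))"

text \<open>The equivariant metric induced on the Deligne complex: every translate \<open>g\<sigma>\<close> of a simplex
  \<open>\<sigma>\<close> of the fundamental domain carries the metric of \<open>\<sigma>\<close>.\<close>

definition deligne_step ::
  "'v labelled_graph \<Rightarrow>
    ('v deligne_vertex set \<Rightarrow> ('v deligne_vertex \<Rightarrow> real) \<Rightarrow> ('v deligne_vertex \<Rightarrow> real) \<Rightarrow> real) \<Rightarrow>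
    ('v deligne_vertex \<Rightarrow> real) \<Rightarrow> ('v deligne_vertex \<Rightarrow> real) \<Rightarrow> real \<Rightarrow> bool" where
  "deligne_step \<Delta> \<rho> x y r \<longleftrightarrow>
    (\<exists>g\<in>carrier (artin_group \<Delta>). \<exists>\<sigma>\<in>fundamental_domain \<Delta>.
      \<exists>x'\<in>geom_simplex \<sigma>. \<exists>y'\<in>geom_simplex \<sigma>.
        x = push (\<lambda>C. g <#\<^bsub>artin_group \<Delta>\<^esub> C) x' \<and>
        y = push (\<lambda>C. g <#\<^bsub>artin_group \<Delta>\<^esub> C) y' \<and> r = \<rho> \<sigma> x' y')"

definition deligne_dist ::
  "'v labelled_graph \<Rightarrow>
    ('v deligne_vertex set \<Rightarrow> ('v deligne_vertex \<Rightarrow> real) \<Rightarrow> ('v deligne_vertex \<Rightarrow> real) \<Rightarrow> real) \<Rightarrow>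
    ('v deligne_vertex \<Rightarrow> real) \<Rightarrow> ('v deligne_vertex \<Rightarrow> real) \<Rightarrow> real" where
  "deligne_dist \<Delta> \<rho> = length_dist (realization (deligne_complex \<Delta>)) (deligne_step \<Delta> \<rho>)"

end

theory Submission
  imports Defs
begin

text \<open>The coned-off Cayley graph and the Deligne complex are quasi-isometric, and Gromov hyperbolicity
  is a quasi-isometry invariant of spaces in which any two points are joined by a geodesic up to a
  bounded error.

  The comparison of the two spaces takes place on vertices. The vertices of the Deligne complex are
  exactly the cosets that are coned off, so \<open>C \<mapsto> Cone C\<close> maps one vertex set into the other. In the
  other direction \<open>Cone C\<close> goes to \<open>C\<close> and a group element \<open>g\<close> to the coset \<open>{g}\<close> of the trivial
  parabolic subgroup. Both maps move the vertices of a common simplex a bounded distance apart: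
  nested cosets share an element \<open>h\<close>, and \<open>Elt h\<close> is adjacent to both cone points; conversely
  the elements \<open>h\<close> and \<open>h s\<close> are joined in the Deligne complex by a chain of edges \<open>{k} \<subset> k G\<^sub>T \<supset> {k t}\<close>,
  one pair for each letter \<open>t\<close> of a fixed word for \<open>s\<close>, where \<open>T\<close> is the singleton of \<open>t\<close>, which is of finite type.

  To turn such a bound on simplices into a bound for the length metrics, only one property of the
  metric on a simplex is used: it is bounded, and it is bounded below by a multiple of the \<open>l\<^sup>1\<close>
  distance of barycentric coordinates. If a real function on the vertices oscillates by at most \<open>L\<close> on every simplex, its
  affine extension is then Lipschitz along every string, hence for the length metric
  (\<open>affine_extension_lipschitz\<close>). Applied to the indicator function of a vertex, this shows that the
  length metric separates points. Applied to the distance of the images from a fixed image, it shows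
  that a vertex map is Lipschitz (\<open>vertex_map_lipschitz\<close>). The lower bound holds for nondegenerate Euclidean and hyperbolic
  simplices because the coordinates with respect to linearly independent vectors depend linearly,
  hence boundedly, on the point; finitely many simplices in the fundamental domain give uniform constants.

  The invariance of hyperbolicity (\<open>gromov_hyperbolic_if_quasi_isometric_embedding\<close>) is proved for
  discrete paths and the four-point condition. Iterating the four-point condition dyadically along
  a path with \<open>N\<close> steps loses only \<open>\<delta> log N\<close>, so a geodesic cannot be far from a
  quasi-geodesic with the same ends, whose detour around a gap of size \<open>D\<close> has length linear in
  \<open>D\<close>. This stability of quasi-geodesics makes triangles in the embedded space slim, and slim triangles give
  the four-point condition there.\<close>

section \<open>Quasi-geodesics in hyperbolic spaces\<close>

text \<open>Length metrics need not attain their infimum, and strings are discrete; hence geodesics are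
  replaced by sequences that are isometric embeddings of an interval of integers up to an additive
  error \<open>c\<close>. Requiring \<open>0 < n\<close>, even when the ends coincide, lets arguments about consecutive
  points start from a first and a different last index.\<close>

definition rough_geodesic ::
  "('p \<Rightarrow> 'p \<Rightarrow> real) \<Rightarrow> real \<Rightarrow> 'p \<Rightarrow> 'p \<Rightarrow> (nat \<Rightarrow> 'p) \<Rightarrow> nat \<Rightarrow> bool" where
  "rough_geodesic d c x y \<gamma> n \<longleftrightarrow> 0 < n \<and> \<gamma> 0 = x \<and> \<gamma> n = y \<and>
    (\<forall>i j. i \<le> j \<longrightarrow> j \<le> n \<longrightarrow> \<bar>d (\<gamma> i) (\<gamma> j) - (real j - real i)\<bar> \<le> c)"

definition rough_geodesic_space :: "'p set \<Rightarrow> ('p \<Rightarrow> 'p \<Rightarrow> real) \<Rightarrow> bool" where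
  "rough_geodesic_space M d \<longleftrightarrow>
    (\<exists>c. \<forall>x\<in>M. \<forall>y\<in>M. \<exists>\<gamma> n. \<gamma> ` {..n} \<subseteq> M \<and> rough_geodesic d c x y \<gamma> n)"

lemma rough_geodesic_space_constant:
  assumes "rough_geodesic_space M d"
  shows "\<exists>c\<ge>0. \<forall>x\<in>M. \<forall>y\<in>M. \<exists>\<gamma> n. \<gamma> ` {..n} \<subseteq> M \<and> rough_geodesic d c x y \<gamma> n"
proof -
  obtain c where c: "\<And>x y. \<lbrakk>x \<in> M; y \<in> M\<rbrakk> \<Longrightarrow> \<exists>\<gamma> n. \<gamma> ` {..n} \<subseteq> M \<and> rough_geodesic d c x y \<gamma> n"
    using assms unfolding rough_geodesic_space_def by blast
  have "rough_geodesic d (max 0 c) x y \<gamma> n" if "rough_geodesic d c x y \<gamma> n" for x y \<gamma> n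
    using that unfolding rough_geodesic_def by (auto simp: le_max_iff_disj)
  then show ?thesis using c by (intro exI[of _ "max 0 c"]) (meson max.cobounded1)
qed

definition discrete_quasi_geodesic ::
  "('p \<Rightarrow> 'p \<Rightarrow> real) \<Rightarrow> real \<Rightarrow> real \<Rightarrow> (nat \<Rightarrow> 'p) \<Rightarrow> nat \<Rightarrow> bool" where
  "discrete_quasi_geodesic d A J p n \<longleftrightarrow>
    (\<forall>i<n. d (p i) (p (Suc i)) \<le> J) \<and>
    (\<forall>i j. i \<le> j \<longrightarrow> j \<le> n \<longrightarrow> real j - real i \<le> A * d (p i) (p j) + A)"

text \<open>In the stability argument \<open>x\<close> is the largest distance of a geodesic from a quasi-geodesic and \<open>k\<close>
  the logarithm of the length of a detour. The detour has length linear in \<open>x\<close>, while \<open>x\<close> is at most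
  linear in \<open>k\<close>; so \<open>k\<close> is bounded, and with it \<open>x\<close>.\<close>

lemma exponential_beats_linear:
  fixes E \<delta> K :: real
  assumes "0 \<le> E" "0 \<le> \<delta>" "0 \<le> K"
  shows "\<exists>B. \<forall>k x. x \<le> E + \<delta> * real k \<longrightarrow> 2 ^ k \<le> K * (x + 1) \<longrightarrow> x \<le> B"
proof -
  have "(\<lambda>k. K * (E + 1) * (1/2) ^ k + K * \<delta> * (real k * (1/2) ^ k)) \<longlonglongrightarrow> K * (E + 1) * 0 + K * \<delta> * 0"
    by (intro tendsto_intros powser_times_n_limit_0) (auto intro: LIMSEQ_realpow_zero)
  then have "\<forall>\<^sub>F k in sequentially. K * (E + 1) * (1/2) ^ k + K * \<delta> * (real k * (1/2) ^ k) < 1"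
    by (rule order_tendstoD) simp
  then obtain k0 where k0: "\<And>k. k \<ge> k0 \<Longrightarrow> K * (E + 1) * (1/2) ^ k + K * \<delta> * (real k * (1/2) ^ k) < 1"
    unfolding eventually_sequentially by blast
  have "x \<le> E + \<delta> * real k0" if x: "x \<le> E + \<delta> * real k" and k: "2 ^ k \<le> K * (x + 1)" for k x
  proof (rule ccontr)
    assume neg: "\<not> ?thesis"
    have "k \<ge> k0"
    proof (rule ccontr)
      assume "\<not> k0 \<le> k"
      then have "\<delta> * real k \<le> \<delta> * real k0" using assms by (intro mult_left_mono) auto
      with x neg show False by linarith
    qed
    have "2 ^ k \<le> K * (E + \<delta> * real k + 1)"
      using k x assms by (smt (verit) mult_left_mono)
    then have "2 ^ k * (1/2) ^ k \<le> K * (E + \<delta> * real k + 1) * (1/2) ^ k"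
      by (intro mult_right_mono) auto
    moreover have "(2::real) ^ k * (1/2) ^ k = 1"
      by (simp flip: power_mult_distrib)
    ultimately show False using k0[OF \<open>k \<ge> k0\<close>] by (simp add: algebra_simps)
  qed
  then show ?thesis by blast
qed

lemma (in Metric_space) gromov_product_change_base:
  assumes "w \<in> M" "w' \<in> M" "x \<in> M" "y \<in> M"
  shows "gromov_product d w x y \<le> gromov_product d w' x y + d w w'"
  using triangle[of w w' x] triangle[of w w' y] assms unfolding gromov_product_def by argo

lemma (in Metric_space) gromov_product_nonneg:
  assumes "w \<in> M" "x \<in> M" "y \<in> M"
  shows "0 \<le> gromov_product d w x y"
  using triangle[of x w y] commute[of x w] assms unfolding gromov_product_def by simp

lemma (in Metric_space) gromov_product_on_rough_geodesic:
  assumes "rough_geodesic d c x y \<gamma> n" "i \<le> j" "j \<le> k" "k \<le> n"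
  shows "gromov_product d (\<gamma> j) (\<gamma> i) (\<gamma> k) \<le> 3 * c / 2"
proof -
  have *: "\<bar>d (\<gamma> i) (\<gamma> j) - (real j - real i)\<bar> \<le> c" "\<bar>d (\<gamma> j) (\<gamma> k) - (real k - real j)\<bar> \<le> c"
     "\<bar>d (\<gamma> i) (\<gamma> k) - (real k - real i)\<bar> \<le> c"
    using assms unfolding rough_geodesic_def by (meson le_trans)+
  then show ?thesis using commute[of "\<gamma> i" "\<gamma> j"] unfolding gromov_product_def by argo
qed

lemma (in Metric_space) dist_le_jumps:
  assumes "\<And>i. i \<le> n \<Longrightarrow> p i \<in> M" "\<And>i. i < n \<Longrightarrow> d (p i) (p (Suc i)) \<le> J"
    and "i \<le> j" "j \<le> n"
  shows "d (p i) (p j) \<le> J * (real j - real i)"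
  using assms(3,4)
proof (induction j rule: dec_induct)
  case base
  then show ?case using assms(1) by simp
next
  case (step k)
  have "d (p i) (p (Suc k)) \<le> d (p i) (p k) + d (p k) (p (Suc k))"
    using step by (intro triangle assms(1)) auto
  then show ?case using step assms(2)[of k] by (simp add: algebra_simps)
qed

text \<open>The Gromov products of a four-point space are ultrametric up to \<open>\<delta>\<close>, as those of a tree are up to \<open>0\<close>.\<close>

locale four_point_space = Metric_space +
  fixes \<delta> :: real
  assumes \<delta>_nonneg: "0 \<le> \<delta>"
    and four_point: "\<lbrakk>w \<in> M; x \<in> M; y \<in> M; z \<in> M\<rbrakk> \<Longrightarrow>
      min (gromov_product d w x y) (gromov_product d w y z) - \<delta> \<le> gromov_product d w x z"
begin

text \<open>Splitting the chain in the middle costs one application of the four-point condition, so a chain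
  of \<open>2\<^sup>k\<close> links costs \<open>k\<close> of them. This logarithmic loss is what makes quasi-geodesics stable.\<close>

lemma chain_gromov_product:
  assumes "\<And>i. i \<le> N \<Longrightarrow> q i \<in> M" "w \<in> M" "0 < N" "N \<le> 2 ^ k"
    and "\<And>i. i < N \<Longrightarrow> m \<le> gromov_product d w (q i) (q (Suc i))"
  shows "m - \<delta> * real k \<le> gromov_product d w (q 0) (q N)"
  using assms
proof (induction k arbitrary: q N)
  case 0
  then have "N = 1" by simp
  then show ?case using 0 by simp
next
  case (Suc k)
  show ?case
  proof (cases "N \<le> 2 ^ k")
    case True
    have "m - \<delta> * real k \<le> gromov_product d w (q 0) (q N)"
      by (rule Suc.IH) (use Suc.prems True in auto)
    then show ?thesis using \<delta>_nonneg by (simp add: algebra_simps)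
  next
    case False
    define h :: nat where "h = 2 ^ k"
    have h: "0 < h" "h < N" "N \<le> 2 * h" using False Suc.prems by (auto simp: h_def)
    have 1: "m - \<delta> * real k \<le> gromov_product d w (q 0) (q h)"
      by (rule Suc.IH) (use Suc.prems h in \<open>auto simp: h_def\<close>)
    have "m - \<delta> * real k \<le> gromov_product d w ((\<lambda>i. q (h + i)) 0) ((\<lambda>i. q (h + i)) (N - h))"
      by (rule Suc.IH) (use Suc.prems h in \<open>auto simp: h_def\<close>)
    then have 2: "m - \<delta> * real k \<le> gromov_product d w (q h) (q N)" using h by simp
    show ?thesis using four_point[of w "q 0" "q h" "q N"] 1 2 Suc.prems h
      by (simp add: algebra_simps)
  qed
qed

text \<open>A point \<open>P\<close> with small product \<open>(x|y)\<^sub>P\<close> lies almost on a geodesic from \<open>x\<close> to \<open>y\<close>, and in a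
  tree such a point is determined by its distance from \<open>x\<close>: the products of \<open>P\<close> and \<open>Q\<close> with
  \<open>y\<close> at base point \<open>x\<close> are almost \<open>d x P\<close> and \<open>d x Q\<close>, so \<open>(P|Q)\<^sub>x\<close> is almost as large.\<close>

lemma close_if_between:
  assumes M: "x \<in> M" "y \<in> M" "P \<in> M" "Q \<in> M"
    and P: "gromov_product d P x y \<le> a" and Q: "gromov_product d Q x y \<le> b"
    and e: "\<bar>d x P - d x Q\<bar> \<le> e"
  shows "d P Q \<le> 2 * a + 2 * b + e + 2 * \<delta>"
  using four_point[of x P y Q] P Q e gromov_product_nonneg[of P x y] gromov_product_nonneg[of Q x y]
    commute[of x P] commute[of x Q] commute[of y P] commute[of y Q] commute[of P Q] M
  unfolding gromov_product_def min_def by (auto split: if_splits simp: field_simps)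

text \<open>The distance from the starting point changes by at most \<open>J\<close> in each step, so some point of the path
  has almost the same distance from it as \<open>P\<close>; two points that are both almost between the
  ends and equally far from one of them are close.\<close>

lemma path_reaches_between_point:
  assumes p: "\<And>i. i \<le> n \<Longrightarrow> p i \<in> M" "\<And>i. i < n \<Longrightarrow> d (p i) (p (Suc i)) \<le> J"
    and C: "\<And>i. i \<le> n \<Longrightarrow> gromov_product d (p i) (p 0) (p n) \<le> C"
    and P: "P \<in> M" "gromov_product d P (p 0) (p n) \<le> C'" and "0 \<le> J"
  shows "\<exists>i\<le>n. d P (p i) \<le> 2 * C' + 2 * C + (J + 2 * C') + 2 * \<delta>"
proof -
  define I where "I = {i. i \<le> n \<and> d (p 0) (p i) \<le> d (p 0) P}"
  have I: "finite I" "0 \<in> I" using p(1)[of 0] by (auto simp: I_def)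
  \<comment> \<open>the last time at which the path is no further from its start than \<open>P\<close>\<close>
  define i where "i = Max I"
  have i: "i \<in> I" unfolding i_def using I by (intro Max_in) auto
  have nn: "0 \<le> C'" using gromov_product_nonneg[of P "p 0" "p n"] P p(1) by force
  have "\<bar>d (p 0) P - d (p 0) (p i)\<bar> \<le> J + 2 * C'"
  proof (cases "i = n")
    case True
    have "d (p 0) (p n) \<le> d (p 0) P" using i True by (auto simp: I_def)
    moreover have "(d P (p 0) + d P (p n) - d (p 0) (p n)) / 2 \<le> C'"
      using P(2) by (simp add: gromov_product_def)
    ultimately show ?thesis using commute[of P "p 0"] nonneg[of P "p n"] \<open>0 \<le> J\<close> nn
      unfolding True abs_le_iff by argo
  next
    case False
    then have "Suc i \<le> n" using i by (auto simp: I_def)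
    moreover have "Suc i \<notin> I" using Max_ge[OF I(1), of "Suc i"] by (auto simp: i_def)
    ultimately have "d (p 0) P < d (p 0) (p (Suc i))" by (auto simp: I_def)
    also have "\<dots> \<le> d (p 0) (p i) + d (p i) (p (Suc i))"
      using \<open>Suc i \<le> n\<close> by (intro triangle p(1)) auto
    finally show ?thesis using p(2)[of i] \<open>Suc i \<le> n\<close> i nn by (auto simp: I_def)
  qed
  then have "d P (p i) \<le> 2 * C' + 2 * C + (J + 2 * C') + 2 * \<delta>"
    using i by (intro close_if_between[of "p 0" "p n"]) (auto simp: I_def intro: p C P)
  then show ?thesis using i by (auto simp: I_def)
qed

text \<open>Let \<open>w\<close> be the point of the geodesic furthest from the path, at distance \<open>D\<close>. Leave the geodesic
  at distance about \<open>2D\<close> on both sides of \<open>w\<close> and connect to the path: this is a chain that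
  avoids the ball of radius about \<open>D\<close> around \<open>w\<close> and has a number of links linear in \<open>D\<close>, because the path is a
  quasi-geodesic. Its ends lie on the geodesic on both sides of \<open>w\<close>, so their product at \<open>w\<close>
  is bounded; the dyadic estimate for chains then bounds \<open>D\<close> by a multiple of \<open>log D\<close>.\<close>

lemma rough_geodesic_near_quasi_geodesic:
  assumes "0 \<le> A" "0 \<le> J" "0 \<le> c"
  shows "\<exists>D. \<forall>p n g m. p ` {..n} \<subseteq> M \<longrightarrow> discrete_quasi_geodesic d A J p n \<longrightarrow>
    g ` {..m} \<subseteq> M \<longrightarrow> rough_geodesic d c (p 0) (p n) g m \<longrightarrow> (\<forall>i\<le>m. \<exists>j\<le>n. d (g i) (p j) \<le> D)"
proof -
  obtain B where B: "\<And>k x. x \<le> (c + J + 3 * c / 2) + \<delta> * real k \<Longrightarrow>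
      2 ^ k \<le> (2 * (A * (10 + c) + A + 2)) * (x + 1) \<Longrightarrow> x \<le> B"
    using exponential_beats_linear[of "c + J + 3 * c / 2" \<delta> "2 * (A * (10 + c) + A + 2)"] assms \<delta>_nonneg
    by auto
  have "\<exists>j\<le>n. d (g i) (p j) \<le> B"
    if pM: "p ` {..n} \<subseteq> M" and qg: "discrete_quasi_geodesic d A J p n"
      and gM: "g ` {..m} \<subseteq> M" and g: "rough_geodesic d c (p 0) (p n) g m" and "i \<le> m"
    for p n g m i
  proof -
    have pM': "p i \<in> M" if "i \<le> n" for i using pM that by blast
    have gM': "g i \<in> M" if "i \<le> m" for i using gM that by blast
    have g0: "g 0 = p 0" "g m = p n" using g by (auto simp: rough_geodesic_def)
    have gd: "\<bar>d (g i) (g j) - (real j - real i)\<bar> \<le> c" if "i \<le> j" "j \<le> m" for i j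
      using g that by (auto simp: rough_geodesic_def)
    have jump: "d (p i) (p (Suc i)) \<le> J" if "i < n" for i
      using qg that by (auto simp: discrete_quasi_geodesic_def)
    have low: "real j - real i \<le> A * d (p i) (p j) + A" if "i \<le> j" "j \<le> n" for i j
      using qg that by (auto simp: discrete_quasi_geodesic_def)
    define r where "r i = Min ((\<lambda>j. d (g i) (p j)) ` {..n})" for i
    have r_le: "r i \<le> d (g i) (p j)" if "j \<le> n" for i j
      unfolding r_def using that by (intro Min_le) auto
    have r_ex: "\<exists>j\<le>n. d (g i) (p j) = r i" for i
    proof -
      have "r i \<in> (\<lambda>j. d (g i) (p j)) ` {..n}" unfolding r_def by (intro Min_in) auto
      then show ?thesis by auto
    qed
    define D where "D = Max (r ` {..m})"
    have r_D: "r i \<le> D" if "i \<le> m" for i unfolding D_def using that by (intro Max_ge) auto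
    have "D \<in> r ` {..m}" unfolding D_def by (intro Max_in) auto
    then obtain i0 where i0: "i0 \<le> m" "r i0 = D" by auto
    define w where "w = g i0"
    have wM: "w \<in> M" using i0 gM' by (simp add: w_def)
    have wD: "D \<le> d w (p j)" if "j \<le> n" for j using r_le[OF that, of i0] i0 by (simp add: w_def)
    have D0: "0 \<le> D" using r_ex[of i0] i0 by (metis nonneg)
    \<comment> \<open>at distance \<open>2D\<close> from \<open>w\<close>, a single link of length at most \<open>D\<close> to the path still has product at least
      \<open>D\<close> with respect to \<open>w\<close>, up to the error of the geodesic, so it need not be subdivided\<close>
    define h where "h = 2 * nat \<lceil>D\<rceil>"
    have h: "2 * D \<le> real h" "real h \<le> 2 * D + 2" unfolding h_def using D0 by linarith+
    define a where "a = i0 - h"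
    define b where "b = min m (i0 + h)"
    have ab: "a \<le> i0" "i0 \<le> b" "b \<le> m" "b - a \<le> 2 * h"
      using i0 by (auto simp: a_def b_def)
    \<comment> \<open>where the geodesic ends before distance \<open>2D\<close> is reached, its end is itself a point of the path\<close>
    have "\<exists>s\<le>n. d (g a) (p s) \<le> D \<and> D - c \<le> gromov_product d w (g a) (p s)"
    proof (cases "a = 0")
      case True
      then show ?thesis using wD[of 0] D0 \<open>0 \<le> c\<close> pM'[of 0] g0
        by (intro exI[of _ 0]) (auto simp: gromov_product_def field_simps)
    next
      case False
      then have "real i0 - real a = real h" by (auto simp: a_def)
      then have "real h - c \<le> d (g a) (g i0)" using gd[of a i0] ab i0 by auto
      moreover obtain s where s: "s \<le> n" "d (g a) (p s) \<le> D" using r_ex[of a] r_D[of a] ab i0 by auto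
      ultimately show ?thesis using h wD[OF s(1)] \<open>0 \<le> c\<close> commute[of w "g a"]
        by (intro exI[of _ s]) (auto simp: w_def gromov_product_def field_simps)
    qed
    then obtain s where s: "s \<le> n" "d (g a) (p s) \<le> D" "D - c \<le> gromov_product d w (g a) (p s)"
      by auto
    have "\<exists>t\<le>n. d (p t) (g b) \<le> D \<and> D - c \<le> gromov_product d w (p t) (g b)"
    proof (cases "b = m")
      case True
      then show ?thesis using wD[of n] D0 \<open>0 \<le> c\<close> pM'[of n] g0
        by (intro exI[of _ n]) (auto simp: gromov_product_def field_simps)
    next
      case False
      then have "real b - real i0 = real h" by (auto simp: b_def)
      then have "real h - c \<le> d (g i0) (g b)" using gd[of i0 b] ab i0 by auto
      moreover obtain t where t: "t \<le> n" "d (g b) (p t) \<le> D" using r_ex[of b] r_D[of b] ab i0 by auto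
      ultimately show ?thesis using h wD[OF t(1)] \<open>0 \<le> c\<close> commute[of "g b" "p t"]
        by (intro exI[of _ t]) (auto simp: w_def gromov_product_def field_simps)
    qed
    then obtain t where t: "t \<le> n" "d (p t) (g b) \<le> D" "D - c \<le> gromov_product d w (p t) (g b)"
      by auto
    \<comment> \<open>nothing forces \<open>s \<le> t\<close>, so the path between them may have to be traversed backwards\<close>
    define L where "L = (if s \<le> t then t - s else s - t)"
    define p' where "p' i = (if s \<le> t then p (s + i) else p (s - i))" for i
    have p'0: "p' 0 = p s" "p' L = p t" by (auto simp: p'_def L_def)
    have p'w: "D \<le> d w (p' i)" "p' i \<in> M" if "i \<le> L" for i
      using that s t by (auto simp: p'_def L_def intro!: wD pM')
    have p'j: "d (p' i) (p' (Suc i)) \<le> J" if "i < L" for i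
    proof (cases "s \<le> t")
      case True
      then show ?thesis using that t jump[of "s + i"] by (simp add: p'_def L_def)
    next
      case False
      then have "Suc (s - Suc i) = s - i" "s - Suc i < n" using that s by (auto simp: L_def)
      then show ?thesis using False jump[of "s - Suc i"] commute[of "p (s - i)"]
        by (simp add: p'_def)
    qed
    define N where "N = L + 2"
    define q where "q i = (if i = 0 then g a else if i \<le> L + 1 then p' (i - 1) else g b)" for i
    obtain k0 where k0: "2 ^ k0 \<le> N" "N < 2 ^ (k0 + 1)"
      using ex_power_ivl1[of 2 N] by (auto simp: N_def)
    define k where "k = k0 + 1"
    have k: "2 ^ k \<le> 2 * N" "N \<le> 2 ^ k" using k0 by (auto simp: k_def)
    have gab: "g a \<in> M" "g b \<in> M" using ab by (auto intro!: gM')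
    have "(D - (c + J)) - \<delta> * real k \<le> gromov_product d w (q 0) (q N)"
    proof (rule chain_gromov_product)
      show "q i \<in> M" if "i \<le> N" for i using that gab p'w by (auto simp: q_def)
      show "D - (c + J) \<le> gromov_product d w (q i) (q (Suc i))" if iN: "i < N" for i
      proof -
        consider "i = 0" | "0 < i" "i \<le> L" | "i = L + 1" using iN by (force simp: N_def)
        then show ?thesis
        proof cases
          case 1
          then show ?thesis using s p'0 \<open>0 \<le> J\<close> by (simp add: q_def)
        next
          case 2
          then have "d (p' (i - 1)) (p' i) \<le> J" "D \<le> d w (p' (i - 1))" "D \<le> d w (p' i)"
            using p'j[of "i - 1"] p'w by auto
          then show ?thesis using 2 \<open>0 \<le> J\<close> \<open>0 \<le> c\<close>
            by (simp add: q_def gromov_product_def field_simps)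
        next
          case 3
          then show ?thesis using t p'0 \<open>0 \<le> J\<close> by (simp add: q_def)
        qed
      qed
    qed (use wM k in \<open>auto simp: N_def\<close>)
    also have "\<dots> = gromov_product d (g i0) (g a) (g b)" by (simp add: q_def N_def w_def)
    also have "\<dots> \<le> 3 * c / 2" by (rule gromov_product_on_rough_geodesic[OF g]) (use ab in auto)
    finally have D1: "D \<le> (c + J + 3 * c / 2) + \<delta> * real k" by simp
    have "d (p s) (p t) \<le> d (p s) (g a) + d (g a) (p t)" "d (g a) (p t) \<le> d (g a) (g b) + d (g b) (p t)"
      using s t gab pM' by (auto intro!: triangle)
    moreover have "d (g a) (g b) \<le> (real b - real a) + c" using gd[of a b] ab by auto
    moreover have "real b - real a \<le> 2 * real h" using ab by linarith
    ultimately have st: "d (p s) (p t) \<le> 6 * D + 4 + c"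
      using s(2) t(2) h commute[of "p s" "g a"] commute[of "p t" "g b"] by linarith
    have "real L \<le> A * d (p s) (p t) + A"
      using low[of s t] low[of t s] s t commute[of "p s" "p t"] by (auto simp: L_def)
    also have "\<dots> \<le> A * (6 * D + 4 + c) + A"
      using st \<open>0 \<le> A\<close> by (simp add: mult_left_mono)
    also have "\<dots> \<le> A * ((10 + c) * (D + 1)) + A"
    proof -
      have "6 * D + 4 + c \<le> (10 + c) * (D + 1)" using D0 \<open>0 \<le> c\<close> by (simp add: algebra_simps)
      then show ?thesis using \<open>0 \<le> A\<close> by (simp add: mult_left_mono)
    qed
    finally have "real (2 * N) \<le> 2 * (A * ((10 + c) * (D + 1)) + A + 2)" by (simp add: N_def)
    also have "\<dots> \<le> (2 * (A * (10 + c) + A + 2)) * (D + 1)"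
      using D0 \<open>0 \<le> A\<close> by (simp add: algebra_simps)
    finally have "2 ^ k \<le> (2 * (A * (10 + c) + A + 2)) * (D + 1)"
      using k(1) by (metis (mono_tags, opaque_lifting) of_nat_le_iff of_nat_numeral of_nat_power order_trans)
    from B[OF D1 this] have "D \<le> B" .
    then show ?thesis using r_ex[of i] r_D[OF \<open>i \<le> m\<close>] by auto
  qed
  then show ?thesis by blast
qed

text \<open>Assign to every point of the geodesic a nearby index of the path, \<open>0\<close> and \<open>n\<close> to the two ends. Any
  index \<open>i\<close> is then straddled by the indices of two consecutive points of the geodesic. These
  indices belong to close points, so they differ by a bounded amount, and \<open>p i\<close> is close to the geodesic.\<close>

lemma quasi_geodesic_near_rough_geodesic:
  assumes "0 \<le> A" "0 \<le> J" "0 \<le> c"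
  shows "\<exists>C. \<forall>p n g m. p ` {..n} \<subseteq> M \<longrightarrow> discrete_quasi_geodesic d A J p n \<longrightarrow>
    g ` {..m} \<subseteq> M \<longrightarrow> rough_geodesic d c (p 0) (p n) g m \<longrightarrow>
    (\<forall>i\<le>n. gromov_product d (p i) (p 0) (p n) \<le> C)"
proof -
  obtain D where D: "\<And>p n g m. p ` {..n} \<subseteq> M \<Longrightarrow> discrete_quasi_geodesic d A J p n \<Longrightarrow>
    g ` {..m} \<subseteq> M \<Longrightarrow> rough_geodesic d c (p 0) (p n) g m \<Longrightarrow> (\<forall>i\<le>m. \<exists>j\<le>n. d (g i) (p j) \<le> D)"
    using rough_geodesic_near_quasi_geodesic[OF assms] by metis
  define T where "T = A * (2 * D + 1 + c) + A"
  define C where "C = max 0 (J * T + D + 3 * c / 2)"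
  have "gromov_product d (p i) (p 0) (p n) \<le> C"
    if pM: "p ` {..n} \<subseteq> M" and qg: "discrete_quasi_geodesic d A J p n"
      and gM: "g ` {..m} \<subseteq> M" and g: "rough_geodesic d c (p 0) (p n) g m" and "i \<le> n"
    for p n g m i
  proof -
    have pM': "p i \<in> M" if "i \<le> n" for i using pM that by blast
    have gM': "g i \<in> M" if "i \<le> m" for i using gM that by blast
    have g0: "g 0 = p 0" "g m = p n" "0 < m" using g by (auto simp: rough_geodesic_def)
    have low: "real j - real i \<le> A * d (p i) (p j) + A" if "i \<le> j" "j \<le> n" for i j
      using qg that by (auto simp: discrete_quasi_geodesic_def)
    have jumps: "d (p i) (p j) \<le> J * (real j - real i)" if "i \<le> j" "j \<le> n" for i j
      by (rule dist_le_jumps[of n]) (use qg that pM' in \<open>auto simp: discrete_quasi_geodesic_def\<close>)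
    from D[OF pM qg gM g] obtain s0 where s0: "\<And>j. j \<le> m \<Longrightarrow> s0 j \<le> n \<and> d (g j) (p (s0 j)) \<le> D"
      by metis
    have D0: "0 \<le> D" using s0[of 0] nonneg by (meson le0 order_trans)
    define s where "s j = (if j = 0 then 0 else if j = m then n else s0 j)" for j
    have s: "s j \<le> n \<and> d (g j) (p (s j)) \<le> D" if "j \<le> m" for j
      using s0[OF that] D0 g0 pM' by (auto simp: s_def)
    define I where "I = {j. j \<le> m \<and> s j \<le> i}"
    have I: "finite I" "0 \<in> I" by (auto simp: I_def s_def)
    define j where "j = Max I"
    have j: "j \<in> I" unfolding j_def using I by (intro Max_in) auto
    show ?thesis
    proof (cases "j = m")
      case True
      then have "i = n" using j \<open>i \<le> n\<close> g0 by (auto simp: I_def s_def)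
      then show ?thesis using pM' commute[of "p n" "p 0"] by (simp add: gromov_product_def C_def)
    next
      case False
      then have jm: "Suc j \<le> m" "s j \<le> i" using j by (auto simp: I_def)
      moreover have "Suc j \<notin> I" using Max_ge[OF I(1), of "Suc j"] by (auto simp: j_def)
      ultimately have si: "i < s (Suc j)" by (auto simp: I_def)
      have M4: "g j \<in> M" "g (Suc j) \<in> M" "p (s j) \<in> M" "p (s (Suc j)) \<in> M" "p i \<in> M"
        "p 0 \<in> M" "p n \<in> M"
        using jm s \<open>i \<le> n\<close> by (auto intro!: gM' pM')
      have "\<bar>d (g j) (g (Suc j)) - (real (Suc j) - real j)\<bar> \<le> c"
        using g jm unfolding rough_geodesic_def by (meson le_SucI order_refl)
      then have gj: "d (g j) (g (Suc j)) \<le> 1 + c" by simp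
      have "d (p (s j)) (p (s (Suc j))) \<le> 2 * D + 1 + c"
        using triangle[of "p (s j)" "g j" "p (s (Suc j))"] triangle[of "g j" "g (Suc j)" "p (s (Suc j))"]
          s[of j] s[of "Suc j"] jm M4 gj commute[of "g j" "p (s j)"] by auto
      then have "real (s (Suc j)) - real (s j) \<le> T"
        using low[of "s j" "s (Suc j)"] jm si s[of "Suc j"] \<open>0 \<le> A\<close> unfolding T_def
        by (smt (verit) le_trans less_imp_le_nat mult_left_mono)
      then have "real i - real (s j) \<le> T" using si by linarith
      then have "J * (real i - real (s j)) \<le> J * T" using \<open>0 \<le> J\<close> by (rule mult_left_mono)
      then have "d (p i) (g j) \<le> J * T + D"
        using jumps[OF jm(2) \<open>i \<le> n\<close>] triangle[of "p i" "p (s j)" "g j"] M4 s[of j] jm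
          commute[of "g j" "p (s j)"] commute[of "p i" "p (s j)"] by auto
      moreover have "gromov_product d (g j) (p 0) (p n) \<le> 3 * c / 2"
        using gromov_product_on_rough_geodesic[OF g, of 0 j m] jm g0 by simp
      ultimately show ?thesis
        using gromov_product_change_base[of "p i" "g j" "p 0" "p n"] M4 by (simp add: C_def)
    qed
  qed
  then show ?thesis by blast
qed

end

section \<open>Hyperbolicity under quasi-isometric embeddings\<close>

text \<open>In a slim triangle the product \<open>(x|z)\<^sub>w\<close> is the distance of \<open>w\<close> from the side \<open>[x,z]\<close>
  up to a constant. The four-point condition then says that the point of \<open>[x,z]\<close> closest to \<open>w\<close> is close to
  one of the sides \<open>[x,y]\<close> and \<open>[y,z]\<close>, which is slimness again.\<close>

lemma (in Metric_space) gromov_hyperbolic_if_slim: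
  assumes path: "\<And>x y i. \<lbrakk>x \<in> M; y \<in> M; i \<le> N x y\<rbrakk> \<Longrightarrow> G x y i \<in> M"
    and geo: "\<And>x y. \<lbrakk>x \<in> M; y \<in> M\<rbrakk> \<Longrightarrow> rough_geodesic d c x y (G x y) (N x y)"
    and slim: "\<And>x y z i. \<lbrakk>x \<in> M; y \<in> M; z \<in> M; i \<le> N x z\<rbrakk> \<Longrightarrow>
      (\<exists>j\<le>N x y. d (G x z i) (G x y j) \<le> E) \<or> (\<exists>j\<le>N y z. d (G x z i) (G y z j) \<le> E)"
  shows "gromov_hyperbolic M d"
proof -
  define E' where "E' = \<bar>E\<bar> + 1 + \<bar>c\<bar>"
  have between: "gromov_product d (G x y j) x y \<le> 3 * c / 2" if "x \<in> M" "y \<in> M" "j \<le> N x y" for x y j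
    using gromov_product_on_rough_geodesic[OF geo[OF that(1,2)], of 0 j "N x y"] geo[OF that(1,2)] that
    by (simp add: rough_geodesic_def)
  \<comment> \<open>walking along \<open>[x,z]\<close> one leaves the neighbourhood of \<open>[x,w]\<close> and enters that of \<open>[w,z]\<close>; at the
    transition both products \<open>(x|w)\<^sub>p\<close> and \<open>(w|z)\<^sub>p\<close> are bounded, and their sum
    compares \<open>d w p\<close> with \<open>(x|z)\<^sub>w\<close>\<close>
  have near: "\<exists>i\<le>N x z. d w (G x z i) \<le> gromov_product d w x z + 2 * E' + 3 * c"
    if M: "w \<in> M" "x \<in> M" "z \<in> M" for w x z
  proof -
    have ends: "G x z 0 = x" "G x z (N x z) = z" "G x w 0 = x" "G w z (N w z) = z"
      using geo[of x z] geo[of x w] geo[of w z] M by (auto simp: rough_geodesic_def)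
    define I where "I = {i. i \<le> N x z \<and> (\<exists>j\<le>N x w. d (G x z i) (G x w j) \<le> E')}"
    have "d (G x z 0) (G x w 0) \<le> E'" using M by (simp add: ends E'_def)
    then have I: "finite I" "0 \<in> I" by (auto simp: I_def)
    define i where "i = Max I"
    have i: "i \<in> I" unfolding i_def using I by (intro Max_in) auto
    then obtain j where j: "i \<le> N x z" "j \<le> N x w" "d (G x z i) (G x w j) \<le> E'" by (auto simp: I_def)
    have "\<exists>k\<le>N w z. d (G x z i) (G w z k) \<le> E'"
    proof (cases "i = N x z")
      case True
      then show ?thesis using ends M by (intro exI[of _ "N w z"]) (auto simp: E'_def)
    next
      case False
      then have Si: "Suc i \<le> N x z" using j by auto
      moreover have "Suc i \<notin> I" using Max_ge[OF I(1), of "Suc i"] by (auto simp: i_def)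
      ultimately have "\<not> (\<exists>j\<le>N x w. d (G x z (Suc i)) (G x w j) \<le> E)"
        unfolding I_def E'_def by (smt (verit, best) mem_Collect_eq)
      then obtain k where k: "k \<le> N w z" "d (G x z (Suc i)) (G w z k) \<le> E"
        using slim[of x w z "Suc i"] M Si by auto
      have "\<bar>d (G x z i) (G x z (Suc i)) - (real (Suc i) - real i)\<bar> \<le> c"
        using geo[of x z] M Si unfolding rough_geodesic_def by (meson le_SucI order_refl)
      then have "d (G x z i) (G w z k) \<le> E'"
        using k triangle[of "G x z i" "G x z (Suc i)" "G w z k"] path M Si by (simp add: E'_def)
      then show ?thesis using k by auto
    qed
    then obtain k where k: "k \<le> N w z" "d (G x z i) (G w z k) \<le> E'" by auto
    define p where "p = G x z i"
    have pM: "p \<in> M" "G x w j \<in> M" "G w z k \<in> M" using j k M path by (auto simp: p_def)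
    have *: "gromov_product d p x w \<le> 3 * c / 2 + E'" "gromov_product d p w z \<le> 3 * c / 2 + E'"
      using gromov_product_change_base[of p "G x w j" x w] gromov_product_change_base[of p "G w z k" w z]
        between[of x w j] between[of w z k] j k M pM by (auto simp: p_def)
    have "d w p \<le> gromov_product d w x z + 2 * E' + 3 * c"
      using * triangle[of x p z] M pM commute[of p x] commute[of p w] commute[of x w]
      unfolding gromov_product_def by argo
    then show ?thesis using j by (auto simp: p_def)
  qed
  have "min (gromov_product d w x y) (gromov_product d w y z) - (E + 9 * c / 2 + 2 * E')
      \<le> gromov_product d w x z"
    if M: "w \<in> M" "x \<in> M" "y \<in> M" "z \<in> M" for w x y z
  proof -
    obtain i where i: "i \<le> N x z" "d w (G x z i) \<le> gromov_product d w x z + 2 * E' + 3 * c"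
      using near M by blast
    have thin: "gromov_product d w u v \<le> gromov_product d w x z + (E + 9 * c / 2 + 2 * E')"
      if uv: "u \<in> M" "v \<in> M" and j: "j \<le> N u v" "d (G x z i) (G u v j) \<le> E" for u v j
      using gromov_product_change_base[of w "G u v j" u v] between[OF uv j(1)] i j M uv path
        triangle[of w "G x z i" "G u v j"] by force
    then show ?thesis using slim[of x y z i] M i(1) thin[of x y] thin[of y z] by fastforce
  qed
  then show ?thesis unfolding gromov_hyperbolic_def using Metric_space_axioms by blast
qed

text \<open>Rough geodesics of \<open>Y\<close> become quasi-geodesics of \<open>X\<close>. By stability their points are almost
  between the ends, and conversely every point almost between the ends is close to them. For a point
  \<open>p\<close> on the side \<open>[x,z]\<close> of a triangle in \<open>Y\<close>, the four-point condition in \<open>X\<close> puts \<open>f p\<close> almost between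
  \<open>f x\<close> and \<open>f y\<close>, or between \<open>f y\<close> and \<open>f z\<close>. So \<open>f p\<close> is close to the image of another side, and as \<open>f\<close> is an
  embedding, \<open>p\<close> is close to that side in \<open>Y\<close>.\<close>

theorem gromov_hyperbolic_if_quasi_isometric_embedding:
  assumes hyp: "gromov_hyperbolic X dX" and geoX: "rough_geodesic_space X dX"
    and Y: "Metric_space Y dY" and geoY: "rough_geodesic_space Y dY"
    and f: "\<And>y. y \<in> Y \<Longrightarrow> f y \<in> X" and A: "0 \<le> A" and B: "0 \<le> B"
    and up: "\<And>x y. \<lbrakk>x \<in> Y; y \<in> Y\<rbrakk> \<Longrightarrow> dX (f x) (f y) \<le> A * dY x y + B"
    and low: "\<And>x y. \<lbrakk>x \<in> Y; y \<in> Y\<rbrakk> \<Longrightarrow> dY x y \<le> A * dX (f x) (f y) + B"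
  shows "gromov_hyperbolic Y dY"
proof -
  obtain \<delta>0 where \<delta>0: "\<And>w x y z. \<lbrakk>w \<in> X; x \<in> X; y \<in> X; z \<in> X\<rbrakk> \<Longrightarrow>
      min (gromov_product dX w x y) (gromov_product dX w y z) - \<delta>0 \<le> gromov_product dX w x z"
    and MX: "Metric_space X dX"
    using hyp unfolding gromov_hyperbolic_def by blast
  define \<delta> where "\<delta> = max 0 \<delta>0"
  interpret X: Metric_space X dX by (rule MX)
  interpret X: four_point_space X dX \<delta>
  proof
    show "min (gromov_product dX w x y) (gromov_product dX w y z) - \<delta> \<le> gromov_product dX w x z"
      if "w \<in> X" "x \<in> X" "y \<in> X" "z \<in> X" for w x y z
      using \<delta>0[OF that] by (simp add: \<delta>_def)
  qed (simp add: \<delta>_def)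
  interpret Y: Metric_space Y dY by (rule Y)
  obtain cX where cX: "0 \<le> cX"
      "\<And>x y. \<lbrakk>x \<in> X; y \<in> X\<rbrakk> \<Longrightarrow> \<exists>\<gamma> n. \<gamma> ` {..n} \<subseteq> X \<and> rough_geodesic dX cX x y \<gamma> n"
    using rough_geodesic_space_constant[OF geoX] by blast
  obtain c where c: "0 \<le> c"
      "\<And>x y. \<lbrakk>x \<in> Y; y \<in> Y\<rbrakk> \<Longrightarrow> \<exists>\<gamma> n. \<gamma> ` {..n} \<subseteq> Y \<and> rough_geodesic dY c x y \<gamma> n"
    using rough_geodesic_space_constant[OF geoY] by blast
  from c(2) obtain G N where GN: "\<And>x y. \<lbrakk>x \<in> Y; y \<in> Y\<rbrakk> \<Longrightarrow> G x y ` {..N x y} \<subseteq> Y \<and> rough_geodesic dY c x y (G x y) (N x y)"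
    by metis
  define J where "J = A * (1 + c) + B"
  define A' where "A' = A + B + c"
  have J: "0 \<le> J" "0 \<le> A'" using A B c(1) by (auto simp: J_def A'_def)
  have ends: "G x y 0 = x" "G x y (N x y) = y" if "x \<in> Y" "y \<in> Y" for x y
    using GN[OF that] by (auto simp: rough_geodesic_def)
  have GY: "G x y i \<in> Y" if "x \<in> Y" "y \<in> Y" "i \<le> N x y" for x y i
    using GN[OF that(1,2)] that(3) by blast
  have jump: "dX (f (G x y i)) (f (G x y (Suc i))) \<le> J" if "x \<in> Y" "y \<in> Y" "i < N x y" for x y i
  proof -
    have "\<bar>dY (G x y i) (G x y (Suc i)) - (real (Suc i) - real i)\<bar> \<le> c"
      using GN[OF that(1,2)] that(3) unfolding rough_geodesic_def by (meson Suc_leI le_SucI order_refl)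
    then have "dY (G x y i) (G x y (Suc i)) \<le> 1 + c" by simp
    then have "A * dY (G x y i) (G x y (Suc i)) \<le> A * (1 + c)" using A by (rule mult_left_mono)
    then show ?thesis using up[of "G x y i" "G x y (Suc i)"] GY that unfolding J_def by auto
  qed
  have qg: "discrete_quasi_geodesic dX A' J (\<lambda>i. f (G x y i)) (N x y)" if xy: "x \<in> Y" "y \<in> Y" for x y
    unfolding discrete_quasi_geodesic_def
  proof (intro conjI allI impI)
    fix i j assume ij: "i \<le> j" "j \<le> N x y"
    have "\<bar>dY (G x y i) (G x y j) - (real j - real i)\<bar> \<le> c"
      using GN[OF xy] ij unfolding rough_geodesic_def by blast
    then have "real j - real i \<le> A * dX (f (G x y i)) (f (G x y j)) + B + c"
      using low[of "G x y i" "G x y j"] GY xy ij by auto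
    moreover have "0 \<le> (B + c) * dX (f (G x y i)) (f (G x y j))" using B c(1) by simp
    ultimately show "real j - real i \<le> A' * dX (f (G x y i)) (f (G x y j)) + A'"
      using A by (simp add: A'_def algebra_simps)
  qed (rule jump[OF xy])
  obtain C where C: "\<And>p n g m i. p ` {..n} \<subseteq> X \<Longrightarrow> discrete_quasi_geodesic dX A' J p n \<Longrightarrow>
    g ` {..m} \<subseteq> X \<Longrightarrow> rough_geodesic dX cX (p 0) (p n) g m \<Longrightarrow> i \<le> n \<Longrightarrow>
    gromov_product dX (p i) (p 0) (p n) \<le> C"
    using X.quasi_geodesic_near_rough_geodesic[OF J(2) J(1) cX(1)] by metis
  have CY: "gromov_product dX (f (G x y i)) (f x) (f y) \<le> C" if xy: "x \<in> Y" "y \<in> Y" and "i \<le> N x y" for x y i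
  proof -
    have "(\<lambda>i. f (G x y i)) ` {..N x y} \<subseteq> X" using GY xy f by auto
    moreover obtain g m where "g ` {..m} \<subseteq> X" "rough_geodesic dX cX (f x) (f y) g m"
      using cX(2) f xy by blast
    ultimately show ?thesis using C[OF _ qg[OF xy], of g m i] ends[OF xy] \<open>i \<le> N x y\<close> by auto
  qed
  define E where "E = 2 * (C + \<delta>) + 2 * C + (J + 2 * (C + \<delta>)) + 2 * \<delta>"
  have reach: "\<exists>j\<le>N x y. dY p (G x y j) \<le> A * E + B"
    if xy: "x \<in> Y" "y \<in> Y" and p: "p \<in> Y" "gromov_product dX (f p) (f x) (f y) \<le> C + \<delta>" for x y p
  proof -
    have "\<exists>j\<le>N x y. dX (f p) (f (G x y j)) \<le> E"
      unfolding E_def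
      using X.path_reaches_between_point[of "N x y" "\<lambda>i. f (G x y i)" J C "f p" "C + \<delta>"]
        jump[OF xy] CY[OF xy] ends[OF xy] p J f GY[OF xy] by auto
    then obtain j where j: "j \<le> N x y" "dX (f p) (f (G x y j)) \<le> E" by auto
    then have "A * dX (f p) (f (G x y j)) \<le> A * E" using A by (simp add: mult_left_mono)
    then show ?thesis using low[of p "G x y j"] p GY[OF xy j(1)] j by force
  qed
  show ?thesis
  proof (rule Y.gromov_hyperbolic_if_slim[where N = N and G = G and c = c and E = "A * E + B"])
    show "G x y i \<in> Y" if "x \<in> Y" "y \<in> Y" "i \<le> N x y" for x y i using GY that .
    show "rough_geodesic dY c x y (G x y) (N x y)" if "x \<in> Y" "y \<in> Y" for x y using GN that by auto
    show "(\<exists>j\<le>N x y. dY (G x z i) (G x y j) \<le> A * E + B) \<or> (\<exists>j\<le>N y z. dY (G x z i) (G y z j) \<le> A * E + B)"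
      if M: "x \<in> Y" "y \<in> Y" "z \<in> Y" and i: "i \<le> N x z" for x y z i
    proof -
      have p: "G x z i \<in> Y" using GY M i by auto
      have "min (gromov_product dX (f (G x z i)) (f x) (f y)) (gromov_product dX (f (G x z i)) (f y) (f z)) \<le> C + \<delta>"
        using X.four_point[of "f (G x z i)" "f x" "f y" "f z"] CY[of x z i] M f p i by fastforce
      then show ?thesis using reach[of x y "G x z i"] reach[of y z "G x z i"] M p unfolding min_le_iff_disj by blast
    qed
  qed
qed

section \<open>Length metrics of simplicial complexes\<close>

definition vertex_point :: "'x \<Rightarrow> ('x \<Rightarrow> real)" where
  "vertex_point v = (\<lambda>w. if w = v then 1 else 0)"

text \<open>The sum runs over the support of \<open>x\<close>, not over a chosen simplex, so that points in different
  simplices are treated by the same formula.\<close>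

definition affine_extension :: "('x \<Rightarrow> real) \<Rightarrow> ('x \<Rightarrow> real) \<Rightarrow> real" where
  "affine_extension F x = (\<Sum>v | x v \<noteq> 0. x v * F v)"

lemma vertex_point_in_simplex: "finite \<sigma> \<Longrightarrow> v \<in> \<sigma> \<Longrightarrow> vertex_point v \<in> geom_simplex \<sigma>"
  by (auto simp: geom_simplex_def vertex_point_def)

lemma affine_extension_on_simplex:
  assumes "finite \<sigma>" "x \<in> geom_simplex \<sigma>"
  shows "affine_extension F x = (\<Sum>v\<in>\<sigma>. x v * F v)"
  unfolding affine_extension_def using assms
  by (intro sum.mono_neutral_left) (auto simp: geom_simplex_def)

lemma affine_extension_vertex_point [simp]: "affine_extension F (vertex_point v) = F v"
  using affine_extension_on_simplex[of "{v}" "vertex_point v" F]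
  by (simp add: vertex_point_in_simplex) (simp add: vertex_point_def)

lemma string_length_append:
  "string_length step x y l \<Longrightarrow> string_length step y z l' \<Longrightarrow> string_length step x z (l + l')"
  by (induction rule: string_length.induct) (auto simp: add.assoc intro: string_length.intros)

lemma string_length_step: "step x y r \<Longrightarrow> string_length step x y r"
  using string_length.cons[OF _ string_length.nil, of step x y r] by simp

lemma string_length_sym:
  assumes sym: "\<And>x y r. step x y r \<Longrightarrow> step y x r" and "string_length step x y l"
  shows "string_length step y x l"
  using assms(2)
proof (induction rule: string_length.induct)
  case (cons x y r z l)
  have "step y x r" using cons.hyps(1) by (rule sym)
  then have "string_length step y x r" by (rule string_length_step[of step])
  from string_length_append[OF cons.IH this] have "string_length step z x (l + r)" .
  then show ?case by (simp add: add.commute)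
qed (rule string_length.nil)

text \<open>The two spaces to be compared, with their different edge lengths and simplex metrics, enter the
  argument only through these properties. The lower bound by the \<open>l\<^sup>1\<close> distance of barycentric
  coordinates is the quantitative form of nondegenerate simplices of finitely many shapes. Points of a
  simplex are joined by a string instead of a single step because the \<open>0\<close>-simplices of the coned-off graph
  carry no step of their own.\<close>

locale simplicial_length_space =
  fixes K :: "'x set set" and step :: "('x \<Rightarrow> real) \<Rightarrow> ('x \<Rightarrow> real) \<Rightarrow> real \<Rightarrow> bool"
    and c D :: real
  assumes finite_simplex: "\<sigma> \<in> K \<Longrightarrow> finite \<sigma>"
    and c_pos: "0 < c"
    and D_nonneg: "0 \<le> D"
    and step_in_simplex: "step x y r \<Longrightarrow> \<exists>\<sigma>\<in>K. x \<in> geom_simplex \<sigma> \<and> y \<in> geom_simplex \<sigma> \<and>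
      c * (\<Sum>v\<in>\<sigma>. \<bar>x v - y v\<bar>) \<le> r \<and> r \<le> D"
    and step_sym: "step x y r \<Longrightarrow> step y x r"
    and simplex_string: "\<lbrakk>\<sigma> \<in> K; x \<in> geom_simplex \<sigma>; y \<in> geom_simplex \<sigma>\<rbrakk> \<Longrightarrow>
      \<exists>l\<le>D. string_length step x y l"
    and vertices_connected: "\<lbrakk>u \<in> \<Union>K; v \<in> \<Union>K\<rbrakk> \<Longrightarrow>
      \<exists>l. string_length step (vertex_point u) (vertex_point v) l"
begin

abbreviation points :: "('x \<Rightarrow> real) set" where
  "points \<equiv> realization K"

abbreviation distance :: "('x \<Rightarrow> real) \<Rightarrow> ('x \<Rightarrow> real) \<Rightarrow> real" where
  "distance \<equiv> length_dist points step"

lemma step_nonneg: "step x y r \<Longrightarrow> 0 \<le> r"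
proof -
  assume "step x y r"
  from step_in_simplex[OF this] obtain \<sigma> where "c * (\<Sum>v\<in>\<sigma>. \<bar>x v - y v\<bar>) \<le> r" by blast
  moreover have "0 \<le> c * (\<Sum>v\<in>\<sigma>. \<bar>x v - y v\<bar>)"
    using c_pos by (intro mult_nonneg_nonneg sum_nonneg) auto
  ultimately show ?thesis by linarith
qed

lemma string_nonneg: "string_length step x y l \<Longrightarrow> 0 \<le> l"
  by (induction rule: string_length.induct) (auto dest: step_nonneg)

lemma string_sym: "string_length step x y l \<Longrightarrow> string_length step y x l"
  using string_length_sym[of step] step_sym by blast

lemma step_in_points: "step x y r \<Longrightarrow> x \<in> points \<and> y \<in> points"
  unfolding realization_def by (drule step_in_simplex) blast

lemma vertex_point_in_points: "v \<in> \<Union>K \<Longrightarrow> vertex_point v \<in> points"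
proof -
  assume "v \<in> \<Union>K"
  then obtain \<sigma> where "\<sigma> \<in> K" "v \<in> \<sigma>" by blast
  then have "vertex_point v \<in> geom_simplex \<sigma>" by (intro vertex_point_in_simplex finite_simplex)
  then show ?thesis using \<open>\<sigma> \<in> K\<close> by (auto simp: realization_def)
qed

lemma string_to_vertex:
  assumes "x \<in> points"
  shows "\<exists>v\<in>\<Union>K. \<exists>l\<le>D. string_length step x (vertex_point v) l"
proof -
  obtain \<sigma> where \<sigma>: "\<sigma> \<in> K" "x \<in> geom_simplex \<sigma>" using assms by (auto simp: realization_def)
  then have "\<sigma> \<noteq> {}" by (auto simp: geom_simplex_def)
  then obtain v where "v \<in> \<sigma>" by blast
  then have "vertex_point v \<in> geom_simplex \<sigma>" using vertex_point_in_simplex finite_simplex \<sigma>(1) by metis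
  from simplex_string[OF \<sigma> this] show ?thesis using \<open>v \<in> \<sigma>\<close> \<sigma>(1) by blast
qed

lemma connected:
  assumes "x \<in> points" "y \<in> points"
  shows "\<exists>l. string_length step x y l"
proof -
  obtain u l where u: "u \<in> \<Union>K" "string_length step x (vertex_point u) l"
    using string_to_vertex[OF assms(1)] by blast
  obtain v l' where v: "v \<in> \<Union>K" "string_length step y (vertex_point v) l'"
    using string_to_vertex[OF assms(2)] by blast
  from vertices_connected[OF u(1) v(1)] show ?thesis
    using string_length_append[OF string_length_append[OF u(2)] string_sym[OF v(2)]] by blast
qed

lemma distance_le: "\<lbrakk>x \<in> points; y \<in> points; string_length step x y l\<rbrakk> \<Longrightarrow> distance x y \<le> l"
  unfolding length_dist_def by (auto intro!: cInf_lower bdd_belowI[of _ 0] dest: string_nonneg)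

lemma distance_ge:
  "\<lbrakk>x \<in> points; y \<in> points; \<And>l. string_length step x y l \<Longrightarrow> b \<le> l\<rbrakk> \<Longrightarrow> b \<le> distance x y"
  unfolding length_dist_def using connected[of x y] by (auto intro!: cInf_greatest)

lemma distance_nonneg: "0 \<le> distance x y"
  using distance_ge[of x y 0] string_nonneg by (cases "x \<in> points \<and> y \<in> points") (auto simp: length_dist_def)

lemma string_near_distance:
  assumes "x \<in> points" "y \<in> points" "0 < \<epsilon>"
  shows "\<exists>l. string_length step x y l \<and> l < distance x y + \<epsilon>"
  using cInf_lessD[of "{l. string_length step x y l}" "distance x y + \<epsilon>"] connected[of x y] assms
  unfolding length_dist_def by auto

text \<open>On a simplex the coordinates sum to \<open>1\<close>, so the difference of two values of the extension is
  unchanged when \<open>F\<close> is replaced by \<open>F - F o'\<close> for a vertex \<open>o'\<close>; it is therefore at most \<open>L\<close>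
  times the \<open>l\<^sup>1\<close> distance, which is at most \<open>r / c\<close> for a step of length \<open>r\<close>. Sums of
  steps then give the bound along strings.\<close>

lemma affine_extension_lipschitz:
  assumes L: "0 \<le> L" "\<And>\<sigma> u v. \<lbrakk>\<sigma> \<in> K; u \<in> \<sigma>; v \<in> \<sigma>\<rbrakk> \<Longrightarrow> \<bar>F u - F v\<bar> \<le> L"
    and xy: "x \<in> points" "y \<in> points"
  shows "\<bar>affine_extension F x - affine_extension F y\<bar> \<le> L / c * distance x y"
proof -
  have step: "\<bar>affine_extension F x - affine_extension F y\<bar> \<le> L / c * r" if "step x y r" for x y r
  proof -
    from step_in_simplex[OF that] obtain \<sigma> where \<sigma>: "\<sigma> \<in> K" "x \<in> geom_simplex \<sigma>" "y \<in> geom_simplex \<sigma>"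
      "c * (\<Sum>v\<in>\<sigma>. \<bar>x v - y v\<bar>) \<le> r" by blast
    then have "\<sigma> \<noteq> {}" by (auto simp: geom_simplex_def)
    then obtain o' where o': "o' \<in> \<sigma>" by blast
    have "(\<Sum>v\<in>\<sigma>. (x v - y v) * F o') = 0"
      using \<sigma> by (simp add: geom_simplex_def sum_subtractf flip: sum_distrib_right)
    then have "affine_extension F x - affine_extension F y = (\<Sum>v\<in>\<sigma>. (x v - y v) * (F v - F o'))"
      using \<sigma> by (simp add: affine_extension_on_simplex[OF finite_simplex] algebra_simps sum_subtractf sum.distrib)
    also have "\<bar>\<dots>\<bar> \<le> (\<Sum>v\<in>\<sigma>. \<bar>x v - y v\<bar> * L)"
      by (rule order_trans[OF sum_abs], rule sum_mono)
        (use L(2)[OF \<sigma>(1) _ o'] in \<open>auto simp: abs_mult intro: mult_left_mono\<close>)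
    also have "\<dots> = L / c * (c * (\<Sum>v\<in>\<sigma>. \<bar>x v - y v\<bar>))"
      using c_pos by (simp add: sum_distrib_left sum_distrib_right mult.commute)
    also have "\<dots> \<le> L / c * r" using \<sigma>(4) L c_pos by (intro mult_left_mono) auto
    finally show ?thesis .
  qed
  have string: "\<bar>affine_extension F x - affine_extension F y\<bar> \<le> L / c * l" if "string_length step x y l" for x y l
    using that
  proof (induction rule: string_length.induct)
    case (cons x y r z l)
    then show ?case using step[of x y r] by (simp add: distrib_left)
  qed simp
  show ?thesis
  proof (cases "L = 0")
    case True
    then show ?thesis using connected[OF xy] string by force
  next
    case False
    then have pos: "0 < L / c" using L c_pos by auto
    have "\<bar>affine_extension F x - affine_extension F y\<bar> / (L / c) \<le> distance x y"
    proof (rule distance_ge[OF xy])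
      fix l assume "string_length step x y l"
      from string[OF this] show "\<bar>affine_extension F x - affine_extension F y\<bar> / (L / c) \<le> l"
        by (subst pos_divide_le_eq[OF pos]) (simp only: mult.commute)
    qed
    then show ?thesis by (subst (asm) pos_divide_le_eq[OF pos]) (simp only: mult.commute)
  qed
qed

lemma Metric_space_distance: "Metric_space points distance"
proof
  show "0 \<le> distance x y" for x y by (rule distance_nonneg)
  have le: "distance y x \<le> distance x y" if "x \<in> points" "y \<in> points" for x y
    using that by (intro distance_ge distance_le) (auto dest: string_sym)
  then show "distance x y = distance y x" for x y
    by (cases "x \<in> points \<and> y \<in> points") (auto simp: length_dist_def intro!: antisym)
  show "distance x y = 0 \<longleftrightarrow> x = y" if xy: "x \<in> points" "y \<in> points" for x y
  proof
    assume 0: "distance x y = 0"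
    \<comment> \<open>the coordinate \<open>v\<close> is the affine extension of the indicator function of \<open>v\<close>, hence Lipschitz\<close>
    have "x v = y v" for v
    proof -
      define F :: "'x \<Rightarrow> real" where "F = vertex_point v"
      have F: "affine_extension F z = z v" if z: "z \<in> points" for z
      proof -
        obtain \<sigma> where \<sigma>: "\<sigma> \<in> K" "z \<in> geom_simplex \<sigma>" using z by (auto simp: realization_def)
        have "affine_extension F z = (\<Sum>w\<in>\<sigma>. if w = v then z w else 0)"
          unfolding affine_extension_on_simplex[OF finite_simplex[OF \<sigma>(1)] \<sigma>(2)]
          by (rule sum.cong) (auto simp: F_def vertex_point_def)
        also have "\<dots> = z v" using \<sigma> finite_simplex by (auto simp: geom_simplex_def)
        finally show ?thesis .
      qed
      have "\<bar>affine_extension F x - affine_extension F y\<bar> \<le> 1 / c * distance x y"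
        by (rule affine_extension_lipschitz[OF _ _ xy]) (auto simp: F_def vertex_point_def)
      then show ?thesis using F xy 0 by simp
    qed
    then show "x = y" by blast
  next
    assume "x = y"
    then show "distance x y = 0" using distance_le[of x y 0] distance_nonneg[of x y] xy string_length.nil[of step x] by simp
  qed
  show "distance x z \<le> distance x y + distance y z" if M: "x \<in> points" "y \<in> points" "z \<in> points" for x y z
  proof (rule field_le_epsilon)
    fix e :: real assume "0 < e"
    then obtain l l' where "string_length step x y l" "l < distance x y + e / 2"
      "string_length step y z l'" "l' < distance y z + e / 2"
      using string_near_distance[of x y "e / 2"] string_near_distance[of y z "e / 2"] M by auto
    then show "distance x z \<le> distance x y + distance y z + e"
      using distance_le[OF M(1,3) string_length_append] by fastforce
  qed
qed

sublocale Metric_space points distance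
  by (rule Metric_space_distance)

text \<open>A point of the string is chosen for every arc length between \<open>0\<close> and \<open>l\<close>, namely the last point
  of the string that has been passed. Steps have length at most \<open>D\<close>, which accounts for the errors; two of
  them occur when both ends of a segment are rounded.\<close>

lemma string_parametrization:
  assumes "string_length step x z l" "z \<in> points"
  shows "\<exists>\<gamma>::real \<Rightarrow> _. \<forall>s t. 0 \<le> s \<longrightarrow> s \<le> t \<longrightarrow> t \<le> l \<longrightarrow>
    \<gamma> s \<in> points \<and> distance x (\<gamma> s) \<le> s + D \<and> distance (\<gamma> s) z \<le> l - s + D \<and>
    distance (\<gamma> s) (\<gamma> t) \<le> t - s + 2 * D"
  using assms
proof (induction rule: string_length.induct)
  case (nil x)
  then show ?case using D_nonneg by (intro exI[of _ "\<lambda>_. x"]) auto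
next
  case (cons x y r z l)
  then obtain \<gamma> where \<gamma>: "\<And>s t. \<lbrakk>0 \<le> s; s \<le> t; t \<le> l\<rbrakk> \<Longrightarrow>
    \<gamma> s \<in> points \<and> distance y (\<gamma> s) \<le> s + D \<and> distance (\<gamma> s) z \<le> l - s + D \<and>
    distance (\<gamma> s) (\<gamma> t) \<le> t - s + 2 * D" by blast
  have xy: "x \<in> points" "y \<in> points" using step_in_points[OF cons(1)] by auto
  have r: "0 \<le> r" "r \<le> D" using step_nonneg[OF cons(1)] step_in_simplex[OF cons(1)] by auto
  have l: "0 \<le> l" using string_nonneg[OF cons(2)] .
  have xyr: "distance x y \<le> r" by (rule distance_le[OF xy string_length_step[of step, OF cons(1)]])
  have xz: "distance x z \<le> r + l"
    by (rule distance_le[OF xy(1) cons.prems]) (use cons in \<open>auto intro: string_length.intros\<close>)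
  have x\<gamma>: "distance x (\<gamma> s) \<le> r + s + D" if "0 \<le> s" "s \<le> l" for s
    using \<gamma>[of s s] that triangle[of x y "\<gamma> s"] xy xyr by auto
  define \<gamma>' where "\<gamma>' t = (if t < r then x else \<gamma> (t - r))" for t
  have "\<gamma>' s \<in> points \<and> distance x (\<gamma>' s) \<le> s + D \<and> distance (\<gamma>' s) z \<le> (r + l) - s + D \<and>
    distance (\<gamma>' s) (\<gamma>' t) \<le> t - s + 2 * D" if st: "0 \<le> s" "s \<le> t" "t \<le> r + l" for s t
  proof (cases "s < r")
    case True
    then show ?thesis using st xz xy r D_nonneg x\<gamma>[of "t - r"] by (auto simp: \<gamma>'_def)
  next
    case False
    then show ?thesis using st \<gamma>[of "s - r" "t - r"] x\<gamma>[of "s - r"] by (auto simp: \<gamma>'_def)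
  qed
  then show ?case by blast
qed

text \<open>Along a string that is at most \<open>1\<close> longer than the distance of its ends, no segment can be much longer
  than the distance of its own ends, since otherwise a shortcut would beat the infimum. So the arc
  length parametrization, sampled at the integers, is a rough geodesic.\<close>

lemma rough_geodesic_space_distance: "rough_geodesic_space points distance"
  unfolding rough_geodesic_space_def
proof (rule exI[of _ "4 * D + 7"], intro ballI)
  fix x y assume xy: "x \<in> points" "y \<in> points"
  obtain l where l: "string_length step x y l" "l < distance x y + 1"
    using string_near_distance[OF xy, of 1] by auto
  obtain \<gamma>0 where \<gamma>0: "\<And>s t. \<lbrakk>0 \<le> s; s \<le> t; t \<le> l\<rbrakk> \<Longrightarrow>
    \<gamma>0 s \<in> points \<and> distance x (\<gamma>0 s) \<le> s + D \<and> distance (\<gamma>0 s) y \<le> l - s + D \<and>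
    distance (\<gamma>0 s) (\<gamma>0 t) \<le> t - s + 2 * D"
    using string_parametrization[OF l(1) xy(2)] by blast
  have l0: "0 \<le> l" using string_nonneg l by blast
  define n where "n = nat \<lceil>l\<rceil> + 1"
  have n: "l + 1 \<le> real n" "real n \<le> l + 2" using l0 unfolding n_def by linarith+
  \<comment> \<open>the parametrization meets \<open>x\<close> and \<open>y\<close> only up to \<open>D\<close>, so the ends are put in by hand\<close>
  define \<gamma> where "\<gamma> i = (if i = 0 then x else if i = n then y else \<gamma>0 (min (real i) l))" for i
  have \<gamma>M: "\<gamma> i \<in> points" for i using xy \<gamma>0[of "min (real i) l" "min (real i) l"] l0 by (auto simp: \<gamma>_def)
  have up: "distance (\<gamma> i) (\<gamma> j) \<le> real j - real i + 2 * D + 2" if ij: "i \<le> j" "j \<le> n" for i j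
  proof -
    have xyl: "distance x y \<le> l" using l xy by (intro distance_le)
    consider "i = j" | "i = 0" "j = n" "i \<noteq> j" | "i = 0" "j \<noteq> n" "j \<noteq> 0" | "i \<noteq> 0" "j = n" "i \<noteq> n" | "i \<noteq> 0" "j \<noteq> n" "i \<noteq> n" "j \<noteq> 0"
      using ij by (cases "i = 0"; cases "j = n") auto
    then show ?thesis
    proof cases
      case 1
      then show ?thesis using \<gamma>M D_nonneg by simp
    next
      case 2
      then show ?thesis using xyl n D_nonneg by (auto simp: \<gamma>_def)
    next
      case 3
      then show ?thesis using \<gamma>0[of "min (real j) l" "min (real j) l"] l0 D_nonneg by (auto simp: \<gamma>_def)
    next
      case 4
      then show ?thesis using \<gamma>0[of "min (real i) l" "min (real i) l"] l0 D_nonneg n ij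
        by (auto simp: \<gamma>_def min_def split: if_splits)
    next
      case 5
      then show ?thesis using \<gamma>0[of "min (real i) l" "min (real j) l"] l0 D_nonneg n ij
        by (auto simp: \<gamma>_def min_def split: if_splits)
    qed
  qed
  have "\<bar>distance (\<gamma> i) (\<gamma> j) - (real j - real i)\<bar> \<le> 4 * D + 7" if ij: "i \<le> j" "j \<le> n" for i j
  proof -
    have "\<gamma> 0 = x" "\<gamma> n = y" using n l0 by (auto simp: \<gamma>_def)
    then show ?thesis
      using up[OF ij] up[of 0 i] up[of j n] triangle[of x "\<gamma> i" y] triangle[of "\<gamma> i" "\<gamma> j" y]
        xy \<gamma>M[of i] \<gamma>M[of j] l n ij D_nonneg by auto
  qed
  then have "rough_geodesic distance (4 * D + 7) x y \<gamma> n"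
    using n l0 by (auto simp: rough_geodesic_def \<gamma>_def)
  then show "\<exists>\<gamma> n. \<gamma> ` {..n} \<subseteq> points \<and> rough_geodesic distance (4 * D + 7) x y \<gamma> n"
    using \<gamma>M by blast
qed

text \<open>The function \<open>w \<mapsto> e (\<phi> u) (\<phi> w)\<close> oscillates by at most \<open>L\<close> on each simplex by the triangle
  inequality, and it vanishes at \<open>u\<close>.\<close>

lemma vertex_map_lipschitz:
  assumes "Metric_space N e" and \<phi>: "\<And>v. v \<in> \<Union>K \<Longrightarrow> \<phi> v \<in> N" and "0 \<le> L"
    and lip: "\<And>\<sigma> u v. \<lbrakk>\<sigma> \<in> K; u \<in> \<sigma>; v \<in> \<sigma>\<rbrakk> \<Longrightarrow> e (\<phi> u) (\<phi> v) \<le> L"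
    and uv: "u \<in> \<Union>K" "v \<in> \<Union>K"
  shows "e (\<phi> u) (\<phi> v) \<le> L / c * distance (vertex_point u) (vertex_point v)"
proof -
  interpret N: Metric_space N e by fact
  have "\<bar>affine_extension (\<lambda>w. e (\<phi> u) (\<phi> w)) (vertex_point u) - affine_extension (\<lambda>w. e (\<phi> u) (\<phi> w)) (vertex_point v)\<bar>
    \<le> L / c * distance (vertex_point u) (vertex_point v)"
  proof (rule affine_extension_lipschitz[OF \<open>0 \<le> L\<close>])
    fix \<sigma> v w assume \<sigma>: "\<sigma> \<in> K" "v \<in> \<sigma>" "w \<in> \<sigma>"
    have N': "\<phi> u \<in> N" "\<phi> v \<in> N" "\<phi> w \<in> N" using \<phi> uv(1) \<sigma> by blast+
    show "\<bar>e (\<phi> u) (\<phi> v) - e (\<phi> u) (\<phi> w)\<bar> \<le> L"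
      using lip[OF \<sigma>] N.triangle[OF N'(1) N'(2) N'(3)] N.triangle[OF N'(1) N'(3) N'(2)]
        N.commute[of "\<phi> w" "\<phi> v"] by linarith
  qed (use uv vertex_point_in_points in auto)
  moreover have "e (\<phi> u) (\<phi> u) = 0" using \<phi> uv(1) by simp
  ultimately show ?thesis by simp
qed

end

text \<open>Each point of the first space is close to a vertex, so sending it to the image of such a vertex
  extends \<open>\<phi>\<close> to all points. This is a quasi-isometric embedding: \<open>\<phi>\<close> is Lipschitz on vertices, and
  because \<open>\<psi>\<close> is Lipschitz and \<open>\<psi> \<circ> \<phi>\<close> is close to the identity, distances cannot shrink by more
  than a linear factor.\<close>

lemma gromov_hyperbolic_if_vertex_map:
  assumes "simplicial_length_space K1 step1 c1 D1" and "simplicial_length_space K2 step2 c2 D2"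
  defines "d1 \<equiv> length_dist (realization K1) step1" and "d2 \<equiv> length_dist (realization K2) step2"
  assumes \<phi>: "\<And>v. v \<in> \<Union>K1 \<Longrightarrow> \<phi> v \<in> \<Union>K2" and \<psi>: "\<And>v. v \<in> \<Union>K2 \<Longrightarrow> \<psi> v \<in> \<Union>K1" and L: "0 \<le> L"
    and \<phi>_lip: "\<And>\<sigma> u v. \<lbrakk>\<sigma> \<in> K1; u \<in> \<sigma>; v \<in> \<sigma>\<rbrakk> \<Longrightarrow> d2 (vertex_point (\<phi> u)) (vertex_point (\<phi> v)) \<le> L"
    and \<psi>_lip: "\<And>\<sigma> u v. \<lbrakk>\<sigma> \<in> K2; u \<in> \<sigma>; v \<in> \<sigma>\<rbrakk> \<Longrightarrow> d1 (vertex_point (\<psi> u)) (vertex_point (\<psi> v)) \<le> L"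
    and \<psi>\<phi>: "\<And>v. v \<in> \<Union>K1 \<Longrightarrow> d1 (vertex_point (\<psi> (\<phi> v))) (vertex_point v) \<le> L"
    and hyp: "gromov_hyperbolic (realization K2) d2"
  shows "gromov_hyperbolic (realization K1) d1"
proof -
  interpret S1: simplicial_length_space K1 step1 c1 D1 by fact
  interpret S2: simplicial_length_space K2 step2 c2 D2 by fact
  have "\<exists>v. v \<in> \<Union>K1 \<and> d1 x (vertex_point v) \<le> D1" if "x \<in> realization K1" for x
    using S1.string_to_vertex[OF that] S1.distance_le[OF that S1.vertex_point_in_points]
    unfolding d1_def by (meson order_trans)
  then obtain near where near: "\<And>x. x \<in> realization K1 \<Longrightarrow> near x \<in> \<Union>K1 \<and> d1 x (vertex_point (near x)) \<le> D1"
    by metis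
  define A where "A = L / c1 + L / c2"
  define B where "B = A * (2 * D1) + 2 * D1 + 2 * L"
  have A: "0 \<le> A" "L / c1 \<le> A" "L / c2 \<le> A" using L S1.c_pos S2.c_pos by (auto simp: A_def)
  have B: "0 \<le> B" "A * (2 * D1) \<le> B" "2 * D1 + 2 * L \<le> B" using A L S1.D_nonneg by (auto simp: B_def)
  have up: "d2 (vertex_point (\<phi> u)) (vertex_point (\<phi> v)) \<le> A * d1 (vertex_point u) (vertex_point v)"
    if "u \<in> \<Union>K1" "v \<in> \<Union>K1" for u v
  proof -
    have "d2 (vertex_point (\<phi> u)) (vertex_point (\<phi> v)) \<le> L / c1 * d1 (vertex_point u) (vertex_point v)"
      unfolding d1_def by (rule S1.vertex_map_lipschitz[of "realization K2" d2 "\<lambda>v. vertex_point (\<phi> v)"])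
        (use that \<phi> L \<phi>_lip S2.vertex_point_in_points S2.Metric_space_distance in \<open>auto simp: d2_def\<close>)
    also have "\<dots> \<le> A * d1 (vertex_point u) (vertex_point v)"
      using A by (intro mult_right_mono) (auto simp: d1_def)
    finally show ?thesis .
  qed
  have down: "d1 (vertex_point (\<psi> u)) (vertex_point (\<psi> v)) \<le> A * d2 (vertex_point u) (vertex_point v)"
    if "u \<in> \<Union>K2" "v \<in> \<Union>K2" for u v
  proof -
    have "d1 (vertex_point (\<psi> u)) (vertex_point (\<psi> v)) \<le> L / c2 * d2 (vertex_point u) (vertex_point v)"
      unfolding d2_def by (rule S2.vertex_map_lipschitz[of "realization K1" d1 "\<lambda>v. vertex_point (\<psi> v)"])
        (use that \<psi> L \<psi>_lip S1.vertex_point_in_points S1.Metric_space_distance in \<open>auto simp: d1_def\<close>)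
    also have "\<dots> \<le> A * d2 (vertex_point u) (vertex_point v)"
      using A by (intro mult_right_mono) (auto simp: d2_def)
    finally show ?thesis .
  qed
  show ?thesis
  proof (rule gromov_hyperbolic_if_quasi_isometric_embedding[OF hyp, of _ _ "\<lambda>x. vertex_point (\<phi> (near x))" A B])
    show "rough_geodesic_space (realization K2) d2" "rough_geodesic_space (realization K1) d1"
      "Metric_space (realization K1) d1"
      using S1.rough_geodesic_space_distance S2.rough_geodesic_space_distance S1.Metric_space_distance
      by (auto simp: d1_def d2_def)
    show "vertex_point (\<phi> (near x)) \<in> realization K2" if "x \<in> realization K1" for x
      using near[OF that] \<phi> S2.vertex_point_in_points by auto
    fix x y assume xy: "x \<in> realization K1" "y \<in> realization K1"
    define u v where "u = near x" and "v = near y"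
    have uv: "u \<in> \<Union>K1" "v \<in> \<Union>K1" "d1 x (vertex_point u) \<le> D1" "d1 y (vertex_point v) \<le> D1"
      using near xy by (auto simp: u_def v_def)
    have tri: "d1 a b \<le> d1 a e + d1 e b" if "a \<in> realization K1" "b \<in> realization K1" "e \<in> realization K1" for a b e
      using S1.triangle that by (simp add: d1_def)
    have com: "d1 a b = d1 b a" for a b using S1.commute by (simp add: d1_def)
    have M: "vertex_point u \<in> realization K1" "vertex_point v \<in> realization K1"
      "vertex_point (\<psi> (\<phi> u)) \<in> realization K1" "vertex_point (\<psi> (\<phi> v)) \<in> realization K1"
      using uv \<phi> \<psi> S1.vertex_point_in_points by auto
    have "d1 (vertex_point u) (vertex_point v) \<le> d1 x y + 2 * D1"
      using tri[OF M(1) M(2) xy(1)] tri[OF xy(1) M(2) xy(2)] uv com[of "vertex_point u" x] by linarith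
    then have "A * d1 (vertex_point u) (vertex_point v) \<le> A * (d1 x y + 2 * D1)"
      using A by (intro mult_left_mono) auto
    then show "d2 (vertex_point (\<phi> (near x))) (vertex_point (\<phi> (near y))) \<le> A * d1 x y + B"
      using up[OF uv(1,2)] B unfolding u_def v_def by (simp add: algebra_simps)
    have "d1 x y \<le> 2 * D1 + d1 (vertex_point u) (vertex_point v)"
      using tri[OF xy(1) xy(2) M(1)] tri[OF M(1) xy(2) M(2)] uv com[of "vertex_point v" y] by linarith
    also have "\<dots> \<le> 2 * D1 + 2 * L + d1 (vertex_point (\<psi> (\<phi> u))) (vertex_point (\<psi> (\<phi> v)))"
      using tri[OF M(1) M(2) M(3)] tri[OF M(3) M(2) M(4)] \<psi>\<phi>[OF uv(1)] \<psi>\<phi>[OF uv(2)]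
        com[of "vertex_point u" "vertex_point (\<psi> (\<phi> u))"] by linarith
    also have "\<dots> \<le> B + A * d2 (vertex_point (\<phi> u)) (vertex_point (\<phi> v))"
      using down[of "\<phi> u" "\<phi> v"] \<phi> uv B by auto
    finally show "d1 x y \<le> A * d2 (vertex_point (\<phi> (near x))) (vertex_point (\<phi> (near y))) + B"
      by (simp add: u_def v_def)
  qed (use A B in auto)
qed

section \<open>Euclidean and hyperbolic simplices\<close>

text \<open>Each coefficient is the value of a linear functional dual to the independent family, and linear
  functionals on a finite-dimensional space are bounded.\<close>

lemma independent_coefficient_bound:
  fixes q :: "'x \<Rightarrow> 'e::euclidean_space"
  assumes "finite \<sigma>" "inj_on q \<sigma>" "independent (q ` \<sigma>)"
  shows "\<exists>k>0. \<forall>u. (\<Sum>v\<in>\<sigma>. \<bar>u v\<bar>) \<le> k * norm (\<Sum>v\<in>\<sigma>. u v *\<^sub>R q v)"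
proof -
  have "\<exists>k>0. \<forall>u. \<bar>u v\<bar> \<le> k * norm (\<Sum>v\<in>\<sigma>. u v *\<^sub>R q v)" if v: "v \<in> \<sigma>" for v
  proof -
    obtain g :: "'e \<Rightarrow> real" where g: "linear g" "\<forall>x\<in>q ` \<sigma>. g x = (if x = q v then 1 else 0)"
      using linear_independent_extend[OF assms(3), of "\<lambda>x. if x = q v then 1 else (0::real)"] by blast
    then have "bounded_linear g" by (simp add: linear_conv_bounded_linear)
    then obtain k where k: "0 < k" "\<And>x. norm (g x) \<le> norm x * k"
      using bounded_linear.pos_bounded by blast
    have "g (\<Sum>w\<in>\<sigma>. u w *\<^sub>R q w) = u v" for u
    proof -
      have "g (\<Sum>w\<in>\<sigma>. u w *\<^sub>R q w) = (\<Sum>w\<in>\<sigma>. u w * g (q w))"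
        using g(1) by (simp add: linear_sum linear_scale)
      also have "\<dots> = (\<Sum>w\<in>\<sigma>. if w = v then u w else 0)"
        using g(2) v assms(2) by (intro sum.cong) (auto dest: inj_onD)
      finally show ?thesis using v assms(1) by simp
    qed
    then have "\<bar>u v\<bar> \<le> k * norm (\<Sum>v\<in>\<sigma>. u v *\<^sub>R q v)" for u
      using k(2)[of "\<Sum>v\<in>\<sigma>. u v *\<^sub>R q v"] by (simp add: mult.commute)
    then show ?thesis using k(1) by blast
  qed
  then obtain k where k: "\<And>v. v \<in> \<sigma> \<Longrightarrow> 0 < k v"
      "\<And>v u. v \<in> \<sigma> \<Longrightarrow> \<bar>u v\<bar> \<le> k v * norm (\<Sum>v\<in>\<sigma>. u v *\<^sub>R q v)"
    by metis
  have "(\<Sum>v\<in>\<sigma>. \<bar>u v\<bar>) \<le> (1 + sum k \<sigma>) * norm (\<Sum>v\<in>\<sigma>. u v *\<^sub>R q v)" for u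
  proof -
    have "(\<Sum>v\<in>\<sigma>. \<bar>u v\<bar>) \<le> sum k \<sigma> * norm (\<Sum>v\<in>\<sigma>. u v *\<^sub>R q v)"
      unfolding sum_distrib_right using k(2) by (rule sum_mono)
    then show ?thesis by (simp add: distrib_right add_increasing)
  qed
  moreover have "0 < 1 + sum k \<sigma>" using k(1) by (simp add: add_pos_nonneg sum_nonneg less_imp_le)
  ultimately show ?thesis by blast
qed

text \<open>This is all that the length metric has to know about the metric of a simplex; the symmetry makes
  strings reversible.\<close>

definition comparable_to_l1 ::
  "'x set \<Rightarrow> (('x \<Rightarrow> real) \<Rightarrow> ('x \<Rightarrow> real) \<Rightarrow> real) \<Rightarrow> real \<Rightarrow> real \<Rightarrow> bool" where
  "comparable_to_l1 \<sigma> d c D \<longleftrightarrow> (\<forall>x\<in>geom_simplex \<sigma>. \<forall>y\<in>geom_simplex \<sigma>.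
    d x y = d y x \<and> c * (\<Sum>v\<in>\<sigma>. \<bar>x v - y v\<bar>) \<le> d x y \<and> d x y \<le> D)"

text \<open>Affine independence of the points \<open>p v\<close> is linear independence of the lifted points \<open>(1, p v)\<close>. The
  coefficients \<open>x v - y v\<close> sum to \<open>0\<close>, so their combination of the lifted points has first component \<open>0\<close>.\<close>

lemma euclidean_simplex_comparable:
  fixes p :: "'x \<Rightarrow> 'e::euclidean_space"
  assumes "finite \<sigma>" "euclidean_simplex p \<sigma> d"
  shows "\<exists>c>0. \<exists>D. comparable_to_l1 \<sigma> d c D"
proof -
  have inj: "inj_on p \<sigma>" and indep: "\<not> affine_dependent (p ` \<sigma>)"
    and d: "\<And>x y. x \<in> geom_simplex \<sigma> \<Longrightarrow> y \<in> geom_simplex \<sigma> \<Longrightarrow>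
      d x y = dist (simplex_point p \<sigma> x) (simplex_point p \<sigma> y)"
    using assms(2) by (auto simp: euclidean_simplex_def)
  define q where "q v = (1::real, p v)" for v
  have q: "inj_on q \<sigma>" using inj by (auto simp: inj_on_def q_def)
  have "independent (q ` \<sigma>)"
  proof
    assume "dependent (q ` \<sigma>)"
    then obtain u where u: "\<exists>v\<in>\<sigma>. u (q v) \<noteq> 0" "(\<Sum>v\<in>\<sigma>. u (q v) *\<^sub>R q v) = 0"
      using assms(1) q by (auto simp: dependent_finite sum.reindex)
    have "(\<Sum>v\<in>\<sigma>. u (q v)) = 0" "(\<Sum>v\<in>\<sigma>. u (q v) *\<^sub>R p v) = 0"
      using arg_cong[OF u(2), of fst] arg_cong[OF u(2), of snd]
      by (simp_all add: fst_sum snd_sum) (simp_all add: q_def)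
    then have "affine_dependent (p ` \<sigma>)"
      using u(1) inj assms(1) unfolding affine_dependent_explicit_finite[OF finite_imageI[OF assms(1)]]
      by (intro exI[of _ "\<lambda>x. u (1, x)"]) (auto simp: sum.reindex q_def)
    then show False using indep by simp
  qed
  then obtain k where k: "0 < k" "\<And>u. (\<Sum>v\<in>\<sigma>. \<bar>u v\<bar>) \<le> k * norm (\<Sum>v\<in>\<sigma>. u v *\<^sub>R q v)"
    using independent_coefficient_bound[OF assms(1) q] by blast
  define R where "R = (\<Sum>v\<in>\<sigma>. norm (p v))"
  have R: "norm (simplex_point p \<sigma> x) \<le> R" if x: "x \<in> geom_simplex \<sigma>" for x
  proof -
    have "x v \<le> 1" if "v \<in> \<sigma>" for v
      using member_le_sum[OF that, of x] x assms(1) by (auto simp: geom_simplex_def)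
    then show ?thesis
      unfolding simplex_point_def R_def using x
      by (intro order_trans[OF norm_sum] sum_mono) (auto simp: geom_simplex_def intro: mult_left_le_one_le)
  qed
  have "comparable_to_l1 \<sigma> d (1 / k) (2 * R)"
    unfolding comparable_to_l1_def
  proof (intro ballI conjI)
    fix x y assume xy: "x \<in> geom_simplex \<sigma>" "y \<in> geom_simplex \<sigma>"
    show "d x y = d y x" using d xy by (simp add: dist_commute)
    show "d x y \<le> 2 * R"
      using d[OF xy] R[OF xy(1)] R[OF xy(2)] norm_triangle_ineq4[of "simplex_point p \<sigma> x" "simplex_point p \<sigma> y"]
      by (simp add: dist_norm)
    have "(\<Sum>v\<in>\<sigma>. (x v - y v) *\<^sub>R q v) = (0, simplex_point p \<sigma> x - simplex_point p \<sigma> y)"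
      using xy by (intro prod_eqI)
        (simp_all add: fst_sum snd_sum q_def simplex_point_def geom_simplex_def sum_subtractf scaleR_left_diff_distrib)
    then show "1 / k * (\<Sum>v\<in>\<sigma>. \<bar>x v - y v\<bar>) \<le> d x y"
      using k(2)[of "\<lambda>v. x v - y v"] k(1) d[OF xy] by (simp add: dist_norm field_simps)
  qed
  then show ?thesis using k(1) by (meson zero_less_divide_1_iff)
qed

lemma hyperboloid_fst:
  assumes "a \<in> hyperboloid"
  shows "0 < fst a" "(fst a)\<^sup>2 = 1 + (norm (snd a))\<^sup>2" "norm (snd a) \<le> fst a"
proof -
  show F: "0 < fst a" "(fst a)\<^sup>2 = 1 + (norm (snd a))\<^sup>2"
    using assms by (auto simp: hyperboloid_def lorentz_def power2_eq_square dot_square_norm)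
  show "norm (snd a) \<le> fst a"
    by (rule power2_le_imp_le) (use F in auto)
qed

text \<open>The reversed Cauchy--Schwarz inequality of Minkowski space.\<close>

lemma lorentz_ge_1:
  fixes a b :: "real \<times> 'e::euclidean_space"
  assumes "a \<in> hyperboloid" "b \<in> hyperboloid"
  shows "1 \<le> lorentz a b"
proof -
  define s t where "s = norm (snd a)" and "t = norm (snd b)"
  have "(1 + s * t)\<^sup>2 \<le> (1 + s\<^sup>2) * (1 + t\<^sup>2)"
    using sum_squares_bound[of s t] by (simp add: power2_eq_square algebra_simps)
  also have "\<dots> = (fst a * fst b)\<^sup>2"
    using hyperboloid_fst(2)[OF assms(1)] hyperboloid_fst(2)[OF assms(2)]
    by (simp add: power_mult_distrib s_def t_def)
  finally have "1 + s * t \<le> fst a * fst b"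
    by (rule power2_le_imp_le) (use hyperboloid_fst(1)[OF assms(1)] hyperboloid_fst(1)[OF assms(2)] in simp)
  moreover have "snd a \<bullet> snd b \<le> s * t" unfolding s_def t_def by (rule norm_cauchy_schwarz)
  ultimately show ?thesis by (simp add: lorentz_def)
qed

text \<open>On the hyperboloid \<open>2 (lorentz a b - 1)\<close> is minus the Lorentz square of \<open>a - b\<close>, the difference
  of the squared spatial and temporal parts. Below height \<open>m\<close> the hyperboloid is a graph of
  slope at most \<open>\<kappa> < 1\<close>, so the spatial part dominates with a definite factor.\<close>

lemma norm_diff_le_lorentz:
  fixes a b :: "real \<times> 'e::euclidean_space"
  assumes "a \<in> hyperboloid" "b \<in> hyperboloid" "fst a \<le> m" "fst b \<le> m"
  shows "(norm (a - b))\<^sup>2 \<le> 4 * m\<^sup>2 * (lorentz a b - 1)"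
proof -
  note A = hyperboloid_fst[OF assms(1)] and B = hyperboloid_fst[OF assms(2)]
  define f s where "f = (fst a - fst b)\<^sup>2" and "s = (norm (snd a - snd b))\<^sup>2"
  have m: "1 \<le> m\<^sup>2" "0 < m"
    using A assms(3) power_mono[of "fst a" m 2] zero_le_power2[of "norm (snd a)"] by linarith+
  define \<kappa> where "\<kappa> = sqrt (1 - 1 / m\<^sup>2)"
  have \<kappa>: "\<kappa>\<^sup>2 = 1 - 1 / m\<^sup>2" "0 \<le> \<kappa>" using m by (auto simp: \<kappa>_def divide_le_eq)
  have slope: "norm (snd z) \<le> \<kappa> * fst z" if z: "z \<in> hyperboloid" "fst z \<le> m" for z :: "real \<times> 'e"
  proof (rule power2_le_imp_le)
    have "(fst z)\<^sup>2 \<le> m\<^sup>2" using z hyperboloid_fst[OF z(1)] by (intro power_mono) auto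
    then have "(fst z)\<^sup>2 / m\<^sup>2 \<le> 1" using m by (simp add: divide_le_eq)
    then show "(norm (snd z))\<^sup>2 \<le> (\<kappa> * fst z)\<^sup>2"
      using hyperboloid_fst(2)[OF z(1)] by (simp add: power_mult_distrib \<kappa> left_diff_distrib)
    show "0 \<le> \<kappa> * fst z" using \<kappa> hyperboloid_fst[OF z(1)] by simp
  qed
  have "(fst a - fst b) * (fst a + fst b) = (snd a - snd b) \<bullet> (snd a + snd b)"
    using A(2) B(2) by (simp add: power2_eq_square algebra_simps inner_diff_left inner_diff_right inner_add_left inner_add_right inner_commute dot_square_norm)
  then have "\<bar>fst a - fst b\<bar> * (fst a + fst b) \<le> norm (snd a - snd b) * norm (snd a + snd b)"
    using Cauchy_Schwarz_ineq2[of "snd a - snd b" "snd a + snd b"] A B by (simp add: abs_mult)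
  also have "\<dots> \<le> norm (snd a - snd b) * (\<kappa> * (fst a + fst b))"
    using norm_triangle_ineq[of "snd a" "snd b"] slope[OF assms(1,3)] slope[OF assms(2,4)]
    by (intro mult_left_mono) (auto simp: distrib_left)
  also have "\<dots> = (norm (snd a - snd b) * \<kappa>) * (fst a + fst b)" by simp
  finally have "\<bar>fst a - fst b\<bar> \<le> norm (snd a - snd b) * \<kappa>"
    by (rule mult_right_le_imp_le) (use A B in auto)
  then have "\<bar>fst a - fst b\<bar>\<^sup>2 \<le> (norm (snd a - snd b) * \<kappa>)\<^sup>2" by (rule power_mono) simp
  then have "f \<le> s * (1 - 1 / m\<^sup>2)" by (simp add: f_def s_def power_mult_distrib \<kappa>)
  then have "m\<^sup>2 * f \<le> m\<^sup>2 * (s * (1 - 1 / m\<^sup>2))" using m by (intro mult_left_mono) auto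
  also have "\<dots> = m\<^sup>2 * s - s" using m by (simp add: field_simps)
  finally have 1: "s \<le> m\<^sup>2 * (s - f)" by (simp add: algebra_simps)
  have "f \<le> s" using \<open>f \<le> s * (1 - 1 / m\<^sup>2)\<close> m by (smt (verit) mult_left_le divide_nonneg_nonneg s_def zero_le_power2)
  moreover have "s = (norm (snd a))\<^sup>2 + (norm (snd b))\<^sup>2 - 2 * (snd a \<bullet> snd b)"
    by (simp add: s_def power2_norm_eq_inner inner_diff_left inner_diff_right inner_commute)
  then have l: "2 * (lorentz a b - 1) = s - f"
    using A(2) B(2) by (simp add: f_def lorentz_def power2_diff)
  moreover have "(norm (a - b))\<^sup>2 = f + s"
    by (simp add: norm_prod_def f_def s_def)
  moreover have "4 * m\<^sup>2 * (lorentz a b - 1) = 2 * (m\<^sup>2 * (s - f))" unfolding l[symmetric] by simp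
  ultimately show ?thesis using 1 by linarith
qed

lemma arcosh_ge:
  fixes u :: real
  assumes "1 \<le> u" "u \<le> U"
  shows "sqrt (u - 1) / (2 * U) \<le> arcosh u"
proof -
  define z where "z = u - 1 + sqrt (u\<^sup>2 - 1)"
  have "1 * u \<le> u * u" using assms by (intro mult_right_mono) auto
  then have u2: "u - 1 \<le> u\<^sup>2 - 1" "0 \<le> u\<^sup>2 - 1" using assms unfolding power2_eq_square by linarith+
  have "sqrt (u - 1) \<le> sqrt (u\<^sup>2 - 1)" using u2(1) by (rule real_sqrt_le_mono)
  then have z: "sqrt (u - 1) \<le> z" using assms unfolding z_def by linarith
  have "sqrt (u\<^sup>2 - 1) \<le> u" using assms by (intro real_le_lsqrt) auto
  then have zU: "1 + z \<le> 2 * U" using assms by (simp add: z_def)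
  have z0: "0 \<le> z" using z assms by (meson order_trans real_sqrt_ge_zero diff_ge_0_iff_ge)
  have "sqrt (u - 1) / (2 * U) \<le> z / (1 + z)"
    using z zU z0 assms by (intro frac_le) auto
  also have "\<dots> = 1 - 1 / (1 + z)" using z0 by (simp add: field_simps)
  also have "\<dots> \<le> ln (1 + z)"
    using ln_le_minus_one[of "1 / (1 + z)"] z0 by (simp add: ln_div)
  also have "\<dots> = arcosh u" using assms by (simp add: arcosh_real_def z_def)
  finally show ?thesis .
qed

lemma lorentz_simplex_point:
  "lorentz (simplex_point p \<sigma> x) (simplex_point p \<sigma> y) = (\<Sum>v\<in>\<sigma>. \<Sum>w\<in>\<sigma>. x v * y w * lorentz (p v) (p w))"
proof -
  have "snd (simplex_point p \<sigma> x) \<bullet> snd (simplex_point p \<sigma> y) =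
      (\<Sum>v\<in>\<sigma>. x v * (snd (p v) \<bullet> snd (simplex_point p \<sigma> y)))"
    by (simp add: simplex_point_def[of p \<sigma> x] snd_sum inner_sum_left)
  also have "\<dots> = (\<Sum>v\<in>\<sigma>. \<Sum>w\<in>\<sigma>. x v * y w * (snd (p v) \<bullet> snd (p w)))"
    by (simp add: simplex_point_def snd_sum inner_sum_right sum_distrib_left mult.assoc)
  moreover have "fst (simplex_point p \<sigma> x) * fst (simplex_point p \<sigma> y) =
      (\<Sum>v\<in>\<sigma>. \<Sum>w\<in>\<sigma>. x v * y w * (fst (p v) * fst (p w)))"
    by (simp add: simplex_point_def fst_sum sum_product mult_ac)
  ultimately show ?thesis by (simp add: lorentz_def right_diff_distrib sum_subtractf)
qed

text \<open>Radial projection divides the point \<open>a x\<close> with barycentric coordinates \<open>x\<close> by its Lorentz norm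
  \<open>N x\<close>, which stays between \<open>1\<close> and a bound \<open>m\<close>. The hyperbolic distance dominates the Euclidean
  distance of the projected points, and the latter, by linear independence of the vertices, dominates the \<open>l\<^sup>1\<close>
  distance of the rescaled coordinates \<open>x v / N x\<close>. Summing rescaled coordinates gives \<open>1 / N x\<close>, so the
  scale can be recovered from them and the \<open>l\<^sup>1\<close> distance of the original coordinates is controlled as well.\<close>

lemma hyperbolic_simplex_comparable:
  fixes p :: "'x \<Rightarrow> real \<times> 'e::euclidean_space"
  assumes "finite \<sigma>" "hyperbolic_simplex p \<sigma> d"
  shows "\<exists>c>0. \<exists>D. comparable_to_l1 \<sigma> d c D"
proof -
  have inj: "inj_on p \<sigma>" and indep: "independent (p ` \<sigma>)" and p: "\<And>v. v \<in> \<sigma> \<Longrightarrow> p v \<in> hyperboloid"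
    and d: "\<And>x y. x \<in> geom_simplex \<sigma> \<Longrightarrow> y \<in> geom_simplex \<sigma> \<Longrightarrow>
      d x y = hyp_dist (radial_proj (simplex_point p \<sigma> x)) (radial_proj (simplex_point p \<sigma> y))"
    using assms(2) by (auto simp: hyperbolic_simplex_def)
  obtain k where k: "0 < k" "\<And>u. (\<Sum>v\<in>\<sigma>. \<bar>u v\<bar>) \<le> k * norm (\<Sum>v\<in>\<sigma>. u v *\<^sub>R p v)"
    using independent_coefficient_bound[OF assms(1) inj indep] by blast
  define a where "a x = simplex_point p \<sigma> x" for x
  define m where "m = 1 + (\<Sum>v\<in>\<sigma>. fst (p v))"
  have F: "0 < fst (p v)" if "v \<in> \<sigma>" for v using hyperboloid_fst(1)[OF p[OF that]] .
  have m1: "1 \<le> m" using F by (simp add: m_def sum_nonneg less_imp_le)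
  have x1: "x v \<le> 1" "0 \<le> x v" if "x \<in> geom_simplex \<sigma>" "v \<in> \<sigma>" for x v
    using member_le_sum[OF that(2), of x] that assms(1) by (auto simp: geom_simplex_def)
  have fst_a: "fst (a x) \<le> m" "0 \<le> fst (a x)" if x: "x \<in> geom_simplex \<sigma>" for x
  proof -
    have "fst (a x) = (\<Sum>v\<in>\<sigma>. x v * fst (p v))" by (simp add: a_def simplex_point_def fst_sum)
    moreover have "(\<Sum>v\<in>\<sigma>. x v * fst (p v)) \<le> (\<Sum>v\<in>\<sigma>. fst (p v))"
      using x1[OF x] F by (intro sum_mono) (simp add: mult_left_le_one_le less_imp_le)
    ultimately show "fst (a x) \<le> m" "0 \<le> fst (a x)"
      using x1[OF x] F by (auto simp: m_def less_imp_le intro!: sum_nonneg mult_nonneg_nonneg)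
  qed
  have la: "1 \<le> lorentz (a x) (a x)" if x: "x \<in> geom_simplex \<sigma>" for x
  proof -
    have "1 = (\<Sum>v\<in>\<sigma>. \<Sum>w\<in>\<sigma>. x v * x w)"
      using x by (simp add: geom_simplex_def flip: sum_product)
    also have "\<dots> \<le> (\<Sum>v\<in>\<sigma>. \<Sum>w\<in>\<sigma>. x v * x w * lorentz (p v) (p w))"
      using x1[OF x] lorentz_ge_1[OF p p]
      by (intro sum_mono) (metis mult.right_neutral mult_left_mono mult_nonneg_nonneg)
    finally show ?thesis unfolding a_def lorentz_simplex_point .
  qed
  define N where "N x = sqrt (lorentz (a x) (a x))" for x
  have N: "1 \<le> N x" "N x \<le> m" if x: "x \<in> geom_simplex \<sigma>" for x
  proof -
    show "1 \<le> N x" using la[OF x] by (simp add: N_def)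
    have "lorentz (a x) (a x) \<le> (fst (a x))\<^sup>2" by (simp add: lorentz_def power2_eq_square)
    also have "\<dots> \<le> m\<^sup>2" using fst_a[OF x] by (intro power_mono)
    finally show "N x \<le> m" using m1 by (simp add: N_def real_le_lsqrt)
  qed
  define b where "b x = radial_proj (a x)" for x
  have b_eq: "b x = (1 / N x) *\<^sub>R a x" for x by (simp add: b_def radial_proj_def N_def)
  have b: "b x \<in> hyperboloid" "fst (b x) \<le> m" if x: "x \<in> geom_simplex \<sigma>" for x
  proof -
    have "lorentz (b x) (b x) = lorentz (a x) (a x) / (N x * N x)"
      by (simp add: b_eq lorentz_def diff_divide_distrib)
    also have "\<dots> = 1" using la[OF x] by (simp add: N_def)
    finally have 1: "lorentz (b x) (b x) = 1" .
    have "fst (a x) \<noteq> 0"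
      using la[OF x] inner_ge_zero[of "snd (a x)"] unfolding lorentz_def by fastforce
    then have "0 < fst (b x)" using N[OF x] fst_a[OF x] by (simp add: b_eq)
    with 1 show "b x \<in> hyperboloid" by (simp add: hyperboloid_def)
    have "fst (a x) * 1 \<le> fst (a x) * N x" using N(1)[OF x] fst_a(2)[OF x] by (rule mult_left_mono)
    then have "fst (b x) \<le> fst (a x)" using N(1)[OF x] by (simp add: b_eq divide_le_eq)
    then show "fst (b x) \<le> m" using fst_a[OF x] by simp
  qed
  define U where "U = 2 * m\<^sup>2"
  have U: "1 \<le> U" using one_le_power[OF m1, of 2] unfolding U_def by linarith
  have bU: "1 \<le> lorentz (b x) (b y)" "lorentz (b x) (b y) \<le> U"
    if xy: "x \<in> geom_simplex \<sigma>" "y \<in> geom_simplex \<sigma>" for x y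
  proof -
    note X = hyperboloid_fst[OF b(1)[OF xy(1)]] b(2)[OF xy(1)]
    note Y = hyperboloid_fst[OF b(1)[OF xy(2)]] b(2)[OF xy(2)]
    show "1 \<le> lorentz (b x) (b y)" by (rule lorentz_ge_1[OF b(1)[OF xy(1)] b(1)[OF xy(2)]])
    have "\<bar>snd (b x) \<bullet> snd (b y)\<bar> \<le> norm (snd (b x)) * norm (snd (b y))" by (rule Cauchy_Schwarz_ineq2)
    also have "\<dots> \<le> m * m" using X Y by (intro mult_mono) auto
    finally have "\<bar>snd (b x) \<bullet> snd (b y)\<bar> \<le> m * m" .
    moreover have "fst (b x) * fst (b y) \<le> m * m" using X Y by (intro mult_mono) auto
    ultimately show "lorentz (b x) (b y) \<le> U" by (simp add: lorentz_def U_def power2_eq_square)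
  qed
  have d': "d x y = arcosh (lorentz (b x) (b y))" if "x \<in> geom_simplex \<sigma>" "y \<in> geom_simplex \<sigma>" for x y
    using d[OF that] by (simp add: hyp_dist_def b_def a_def)
  \<comment> \<open>the product of the constants of the estimates 1 to 4 below\<close>
  define c where "c = 1 / (2 * m * k * (2 * m) * (2 * U))"
  have c: "0 < c" using m1 k(1) U by (simp add: c_def)
  have "comparable_to_l1 \<sigma> d c (arcosh U)"
    unfolding comparable_to_l1_def
  proof (intro ballI conjI)
    fix x y assume xy: "x \<in> geom_simplex \<sigma>" "y \<in> geom_simplex \<sigma>"
    show "d x y = d y x" using d' xy by (simp add: lorentz_def inner_commute mult.commute)
    show "d x y \<le> arcosh U"
      using bU[OF xy] U arcosh_less_iff_real[of U "lorentz (b x) (b y)"] unfolding d'[OF xy] by linarith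
    define s where "s = (\<Sum>v\<in>\<sigma>. \<bar>x v / N x - y v / N y\<bar>)"
    have "\<bar>1 / N x - 1 / N y\<bar> = \<bar>\<Sum>v\<in>\<sigma>. x v / N x - y v / N y\<bar>"
      using xy by (simp add: sum_subtractf geom_simplex_def flip: sum_divide_distrib)
    also have "\<dots> \<le> s" unfolding s_def by (rule sum_abs)
    finally have s1: "\<bar>1 / N x - 1 / N y\<bar> \<le> s" .
    have "(\<Sum>v\<in>\<sigma>. \<bar>x v - y v\<bar> / N x) \<le> (\<Sum>v\<in>\<sigma>. \<bar>x v / N x - y v / N y\<bar> + \<bar>1 / N x - 1 / N y\<bar> * y v)"
    proof (rule sum_mono)
      fix v assume "v \<in> \<sigma>"
      have "\<bar>x v - y v\<bar> / N x = \<bar>(x v / N x - y v / N y) - (1 / N x - 1 / N y) * y v\<bar>"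
        using N[OF xy(1)] by (simp add: left_diff_distrib flip: diff_divide_distrib)
      also have "\<dots> \<le> \<bar>x v / N x - y v / N y\<bar> + \<bar>(1 / N x - 1 / N y) * y v\<bar>" by (rule abs_triangle_ineq4)
      finally show "\<bar>x v - y v\<bar> / N x \<le> \<bar>x v / N x - y v / N y\<bar> + \<bar>1 / N x - 1 / N y\<bar> * y v"
        using x1(2)[OF xy(2) \<open>v \<in> \<sigma>\<close>] by (simp add: abs_mult)
    qed
    also have "\<dots> = s + \<bar>1 / N x - 1 / N y\<bar>"
      using xy by (simp add: sum.distrib s_def geom_simplex_def flip: sum_distrib_left)
    finally have "(\<Sum>v\<in>\<sigma>. \<bar>x v - y v\<bar>) / N x \<le> 2 * s" using s1 by (simp add: sum_divide_distrib)
    then have "(\<Sum>v\<in>\<sigma>. \<bar>x v - y v\<bar>) \<le> 2 * s * N x" using N[OF xy(1)] by (simp add: divide_le_eq)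
    also have "\<dots> \<le> 2 * s * m" using N[OF xy(1)] s1 by (intro mult_left_mono) auto
    finally have 1: "(\<Sum>v\<in>\<sigma>. \<bar>x v - y v\<bar>) \<le> 2 * m * s" by (simp add: mult_ac)
    have "b x - b y = (\<Sum>v\<in>\<sigma>. (x v / N x - y v / N y) *\<^sub>R p v)"
      by (simp add: b_eq a_def simplex_point_def scaleR_sum_right sum_subtractf scaleR_left_diff_distrib)
    then have 2: "s \<le> k * norm (b x - b y)" using k(2)[of "\<lambda>v. x v / N x - y v / N y"] by (simp add: s_def)
    have "norm (b x - b y) \<le> sqrt (4 * m\<^sup>2 * (lorentz (b x) (b y) - 1))"
      using norm_diff_le_lorentz[OF b(1)[OF xy(1)] b(1)[OF xy(2)] b(2)[OF xy(1)] b(2)[OF xy(2)]]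
      by (rule real_le_rsqrt)
    also have "\<dots> = 2 * m * sqrt (lorentz (b x) (b y) - 1)"
      using m1 by (simp add: real_sqrt_mult)
    finally have 3: "norm (b x - b y) \<le> 2 * m * sqrt (lorentz (b x) (b y) - 1)" .
    have "sqrt (lorentz (b x) (b y) - 1) / (2 * U) \<le> d x y"
      using arcosh_ge[OF bU[OF xy]] d'[OF xy] by simp
    then have 4: "sqrt (lorentz (b x) (b y) - 1) \<le> 2 * U * d x y" using U by (simp add: divide_le_eq mult.commute)
    have "(\<Sum>v\<in>\<sigma>. \<bar>x v - y v\<bar>) \<le> 2 * m * (k * (2 * m * (2 * U * d x y)))"
      using 1 2 3 4 m1 k(1) by (smt (verit, best) mult_left_mono)
    then show "c * (\<Sum>v\<in>\<sigma>. \<bar>x v - y v\<bar>) \<le> d x y"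
      using m1 k(1) U by (simp add: c_def divide_le_eq mult_ac)
  qed
  then show ?thesis using c by blast
qed

lemma comparable_to_l1_mono:
  "\<lbrakk>comparable_to_l1 \<sigma> d c D; c' \<le> c; D \<le> D'\<rbrakk> \<Longrightarrow> comparable_to_l1 \<sigma> d c' D'"
  unfolding comparable_to_l1_def
  by (meson order_trans mult_right_mono sum_nonneg abs_ge_zero)

lemma uniformly_comparable_to_l1:
  assumes "finite F" "\<And>\<sigma>. \<sigma> \<in> F \<Longrightarrow> \<exists>c>0. \<exists>D. comparable_to_l1 \<sigma> (\<rho> \<sigma>) c D"
  shows "\<exists>c>0. \<exists>D\<ge>0. \<forall>\<sigma>\<in>F. comparable_to_l1 \<sigma> (\<rho> \<sigma>) c D"
proof -
  obtain c D where cD: "\<And>\<sigma>. \<sigma> \<in> F \<Longrightarrow> 0 < c \<sigma> \<and> comparable_to_l1 \<sigma> (\<rho> \<sigma>) (c \<sigma>) (D \<sigma>)"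
    using assms(2) by metis
  define c0 where "c0 = Min (insert 1 (c ` F))"
  define D0 where "D0 = Max (insert 0 (D ` F))"
  have "0 < c0" "0 \<le> D0" using assms(1) cD by (auto simp: c0_def D0_def)
  moreover have "comparable_to_l1 \<sigma> (\<rho> \<sigma>) c0 D0" if "\<sigma> \<in> F" for \<sigma>
    using cD[OF that] assms(1) that
    by (auto simp: c0_def D0_def intro!: comparable_to_l1_mono[of \<sigma> _ "c \<sigma>" "D \<sigma>"] Min_le Max_ge)
  ultimately show ?thesis by blast
qed

section \<open>Groups given by generators and relations\<close>

definition word_class :: "'v set \<Rightarrow> ('v word \<times> 'v word) set \<Rightarrow> 'v word \<Rightarrow> 'v word set" where
  "word_class X R u = {w. pres_eq X R u w}"

lemma words_Nil [simp]: "[] \<in> words X"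
  and words_append [simp]: "u @ v \<in> words X \<longleftrightarrow> u \<in> words X \<and> v \<in> words X"
  by (auto simp: words_def)

lemma word_class_eq_iff: "u \<in> words X \<Longrightarrow> word_class X R u = word_class X R v \<longleftrightarrow> pres_eq X R u v"
  unfolding word_class_def by (auto intro: pres_eq.intros)

lemma carrier_presented_group: "carrier (presented_group X R) = word_class X R ` words X"
  by (auto simp: presented_group_def quotient_def word_class_def)

lemma mult_presented_group:
  assumes "u \<in> words X" "v \<in> words X"
  shows "word_class X R u \<otimes>\<^bsub>presented_group X R\<^esub> word_class X R v = word_class X R (u @ v)"
proof -
  have "pres_eq X R (u @ v) w \<longleftrightarrow> (\<exists>u'. pres_eq X R u u' \<and> (\<exists>v'. pres_eq X R v v' \<and> pres_eq X R (u' @ v') w))" for w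
    using assms by (meson pres_eq.append pres_eq.refl pres_eq.sym pres_eq.trans)
  then show ?thesis by (simp add: presented_group_def word_class_def Bex_def)
qed

lemma one_presented_group: "\<one>\<^bsub>presented_group X R\<^esub> = word_class X R []"
  by (simp add: presented_group_def word_class_def)

fun inverse_word :: "'v word \<Rightarrow> 'v word" where
  "inverse_word [] = []"
| "inverse_word ((s, e) # u) = inverse_word u @ [(s, \<not> e)]"

lemma inverse_word_words: "u \<in> words X \<Longrightarrow> inverse_word u \<in> words X"
  by (induction u rule: inverse_word.induct) (auto simp: words_def)

text \<open>The letters next to the middle of \<open>inverse_word u @ u\<close> cancel one pair at a time.\<close>

lemma inverse_word_left: "u \<in> words X \<Longrightarrow> pres_eq X R (inverse_word u @ u) []"
proof (induction u rule: inverse_word.induct)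
  case 1
  then show ?case by (simp add: pres_eq.refl)
next
  case (2 s e u)
  then have s: "s \<in> X" and u: "u \<in> words X" by (auto simp: words_def)
  have "pres_eq X R ((inverse_word u @ [(s, \<not> e), (s, \<not> \<not> e)]) @ u) ((inverse_word u @ []) @ u)"
    by (intro pres_eq.append pres_eq.refl pres_eq.cancel inverse_word_words s u)
  then show ?case using pres_eq.trans[OF _ 2(1)[OF u]] by simp
qed

lemma group_presented_group: "group (presented_group X R)"
proof (rule groupI)
  fix a assume "a \<in> carrier (presented_group X R)"
  then obtain u where u: "u \<in> words X" "a = word_class X R u" by (auto simp: carrier_presented_group)
  show "\<one>\<^bsub>presented_group X R\<^esub> \<otimes>\<^bsub>presented_group X R\<^esub> a = a"
    using u mult_presented_group[of "[]" X u R] by (simp add: one_presented_group words_def)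
  show "\<exists>y\<in>carrier (presented_group X R). y \<otimes>\<^bsub>presented_group X R\<^esub> a = \<one>\<^bsub>presented_group X R\<^esub>"
    using u inverse_word_words[OF u(1)] inverse_word_left[OF u(1), of R]
    by (intro bexI[of _ "word_class X R (inverse_word u)"])
      (auto simp: carrier_presented_group mult_presented_group one_presented_group word_class_eq_iff words_def)
qed (auto simp: carrier_presented_group mult_presented_group one_presented_group)

lemma inv_word_class_letter:
  assumes "s \<in> X"
  shows "inv\<^bsub>presented_group X R\<^esub> word_class X R [(s, True)] = word_class X R [(s, False)]"
proof -
  interpret group "presented_group X R" by (rule group_presented_group)
  have s: "[(s, e)] \<in> words X" for e using assms by (simp add: words_def)
  have "word_class X R [(s, False)] \<otimes>\<^bsub>presented_group X R\<^esub> word_class X R [(s, True)] = \<one>\<^bsub>presented_group X R\<^esub>"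
    using pres_eq.cancel[OF assms, of R False] s assms
    by (simp add: mult_presented_group one_presented_group word_class_eq_iff words_def)
  then show ?thesis using s by (intro inv_equality) (auto simp: carrier_presented_group)
qed

lemma generate_presented_group:
  "generate (presented_group X R) ((\<lambda>s. word_class X R [(s, True)]) ` X) = carrier (presented_group X R)"
    (is "generate ?G ?S = _")
proof
  interpret group ?G by (rule group_presented_group)
  show "generate ?G ?S \<subseteq> carrier ?G"
    by (intro generate_incl) (auto simp: carrier_presented_group words_def)
  have "word_class X R u \<in> generate ?G ?S" if "u \<in> words X" for u
    using that
  proof (induction u)
    case Nil
    then show ?case by (metis generate.one one_presented_group)
  next
    case (Cons a u)
    obtain s e where a: "a = (s, e)" by (cases a)
    have s: "s \<in> X" "u \<in> words X" using Cons.prems by (auto simp: a words_def)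
    have "word_class X R [(s, e)] \<in> generate ?G ?S"
      using generate.incl[of "word_class X R [(s, True)]" ?S ?G] generate.inv[of "word_class X R [(s, True)]" ?S ?G]
        inv_word_class_letter[OF s(1), of R] s by (cases e) auto
    then have "word_class X R [(s, e)] \<otimes>\<^bsub>?G\<^esub> word_class X R u \<in> generate ?G ?S"
      using Cons.IH s by (intro generate.eng)
    then show ?case using s by (subst (asm) mult_presented_group) (auto simp: a words_def)
  qed
  then show "carrier ?G \<subseteq> generate ?G ?S" by (auto simp: carrier_presented_group)
qed

lemma artin_gen_eq: "artin_gen \<Delta> s = word_class (verts \<Delta>) (artin_relations \<Delta>) [(s, True)]"
  by (simp add: artin_gen_def word_class_def)

lemma group_artin_group: "group (artin_group \<Delta>)"
  unfolding artin_group_def by (rule group_presented_group)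

lemma artin_gen_carrier: "s \<in> verts \<Delta> \<Longrightarrow> artin_gen \<Delta> s \<in> carrier (artin_group \<Delta>)"
  by (auto simp: artin_gen_eq artin_group_def carrier_presented_group words_def)

lemma generate_artin_gen: "generate (artin_group \<Delta>) (artin_gen \<Delta> ` verts \<Delta>) = carrier (artin_group \<Delta>)"
  using generate_presented_group unfolding artin_group_def artin_gen_eq .

lemma subgroup_std_parabolic: "T \<subseteq> verts \<Delta> \<Longrightarrow> subgroup (std_parabolic \<Delta> T) (artin_group \<Delta>)"
  unfolding std_parabolic_def
  by (intro group.generate_is_subgroup group_artin_group) (auto intro: artin_gen_carrier)

lemma empty_finite_type: "{} \<in> finite_type_subsets \<Delta>"
  by (auto simp: finite_type_subsets_def coxeter_group_def full_subgraph_def carrier_presented_group words_def)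

lemma std_parabolic_empty: "std_parabolic \<Delta> {} = {\<one>\<^bsub>artin_group \<Delta>\<^esub>}"
  using group.generate_empty[OF group_artin_group[of \<Delta>]] by (simp add: std_parabolic_def)

text \<open>The Coxeter group of a single vertex has at most the two elements represented by the empty word and the
  generator, because the relation \<open>s s = 1\<close> also identifies \<open>s\<close> with its inverse.\<close>

lemma singleton_finite_type:
  assumes "s \<in> verts \<Delta>"
  shows "{s} \<in> finite_type_subsets \<Delta>"
proof -
  define R where "R = artin_relations (full_subgraph \<Delta> {s}) \<union> {([(t, True), (t, True)], []) | t. t \<in> {s}}"
  have w: "[(s, e)] \<in> words {s}" "[] \<in> words {s}" for e by (auto simp: words_def)
  have sq: "pres_eq {s} R [(s, True), (s, True)] []"
    by (rule pres_eq.relation) (auto simp: R_def words_def)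
  have inv: "pres_eq {s} R [(s, False)] [(s, True)]"
  proof -
    have "pres_eq {s} R ([(s, False)] @ []) ([(s, False)] @ [(s, True), (s, True)])"
      by (intro pres_eq.append pres_eq.refl w pres_eq.sym[OF sq])
    moreover have "pres_eq {s} R ([(s, False), (s, \<not> False)] @ [(s, True)]) ([] @ [(s, True)])"
      by (intro pres_eq.append pres_eq.refl w pres_eq.cancel) auto
    ultimately show ?thesis using pres_eq.trans by fastforce
  qed
  have "\<exists>v\<in>{[], [(s, True)]}. pres_eq {s} R u v" if "u \<in> words {s}" for u
    using that
  proof (induction u)
    case Nil
    then show ?case using pres_eq.refl[OF w(2)] by auto
  next
    case (Cons a u)
    obtain e where a: "a = (s, e)" and u: "u \<in> words {s}" using Cons.prems by (cases a) (auto simp: words_def)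
    from Cons.IH[OF u] obtain v where v: "v \<in> {[], [(s, True)]}" "pres_eq {s} R u v" by blast
    have "pres_eq {s} R [(s, e)] [(s, True)]" using inv pres_eq.refl w by (cases e) auto
    from pres_eq.append[OF this v(2)] have "pres_eq {s} R (a # u) ((s, True) # v)" by (simp add: a)
    then show ?case using v(1) sq pres_eq.trans by fastforce
  qed
  then have "word_class {s} R ` words {s} \<subseteq> word_class {s} R ` {[], [(s, True)]}"
    using word_class_eq_iff by (metis (no_types, lifting) image_eqI image_subsetI)
  then have "finite (word_class {s} R ` words {s})" by (rule finite_subset) simp
  then show ?thesis using assms
    by (auto simp: finite_type_subsets_def coxeter_group_def carrier_presented_group full_subgraph_def R_def)
qed

text \<open>The bound \<open>l\<close> does not depend on \<open>h\<close>: it is the sum of the bounds for the letters of a word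
  for \<open>g\<close>. For an inverse letter the string that starts at \<open>h s\<^sup>-\<^sup>1\<close> is reversed. The map \<open>pt\<close>
  places group elements in the space, so that the lemma serves the coned-off graph and the Deligne complex.\<close>

lemma string_along_generated_element:
  assumes "group G" and S: "S \<subseteq> carrier G"
    and sym: "\<And>x y r. step x y r \<Longrightarrow> step y x r"
    and gens: "\<And>s. s \<in> S \<Longrightarrow> \<exists>l. \<forall>h\<in>carrier G. \<exists>l'\<le>l. string_length step (pt h) (pt (h \<otimes>\<^bsub>G\<^esub> s)) l'"
    and g: "g \<in> generate G S"
  shows "\<exists>l. \<forall>h\<in>carrier G. \<exists>l'\<le>l. string_length step (pt h) (pt (h \<otimes>\<^bsub>G\<^esub> g)) l'"
  using g
proof (induction rule: generate.induct)
  case one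
  interpret group G by fact
  have "\<exists>l'\<le>0. string_length step (pt h) (pt (h \<otimes>\<^bsub>G\<^esub> \<one>\<^bsub>G\<^esub>)) l'" if "h \<in> carrier G" for h
    using that string_length.nil[of step "pt h"] by auto
  then show ?case by blast
next
  case (incl s)
  then show ?case by (rule gens)
next
  case (inv s)
  interpret group G by fact
  from gens[OF inv] obtain l where l: "\<And>h. h \<in> carrier G \<Longrightarrow> \<exists>l'\<le>l. string_length step (pt h) (pt (h \<otimes>\<^bsub>G\<^esub> s)) l'"
    by blast
  have s: "s \<in> carrier G" using inv S by blast
  have "\<exists>l'\<le>l. string_length step (pt h) (pt (h \<otimes>\<^bsub>G\<^esub> inv\<^bsub>G\<^esub> s)) l'" if h: "h \<in> carrier G" for h
  proof -
    obtain l' where "l' \<le> l" "string_length step (pt (h \<otimes>\<^bsub>G\<^esub> inv\<^bsub>G\<^esub> s)) (pt (h \<otimes>\<^bsub>G\<^esub> inv\<^bsub>G\<^esub> s \<otimes>\<^bsub>G\<^esub> s)) l'"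
      using l[of "h \<otimes>\<^bsub>G\<^esub> inv\<^bsub>G\<^esub> s"] h s by auto
    then show ?thesis using string_length_sym[of step, OF sym] h s by (auto simp: m_assoc)
  qed
  then show ?case by blast
next
  case (eng g1 g2)
  interpret group G by fact
  have g12: "g1 \<in> carrier G" "g2 \<in> carrier G" using eng.hyps generate_in_carrier[OF S] by auto
  obtain l1 where l1: "\<And>h. h \<in> carrier G \<Longrightarrow> \<exists>l'\<le>l1. string_length step (pt h) (pt (h \<otimes>\<^bsub>G\<^esub> g1)) l'"
    using eng.IH(1) by blast
  obtain l2 where l2: "\<And>h. h \<in> carrier G \<Longrightarrow> \<exists>l'\<le>l2. string_length step (pt h) (pt (h \<otimes>\<^bsub>G\<^esub> g2)) l'"
    using eng.IH(2) by blast
  have "\<exists>l'\<le>l1 + l2. string_length step (pt h) (pt (h \<otimes>\<^bsub>G\<^esub> (g1 \<otimes>\<^bsub>G\<^esub> g2))) l'" if h: "h \<in> carrier G" for h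
  proof -
    obtain a where a: "a \<le> l1" "string_length step (pt h) (pt (h \<otimes>\<^bsub>G\<^esub> g1)) a"
      using l1[OF h] by blast
    obtain b where b: "b \<le> l2" "string_length step (pt (h \<otimes>\<^bsub>G\<^esub> g1)) (pt (h \<otimes>\<^bsub>G\<^esub> g1 \<otimes>\<^bsub>G\<^esub> g2)) b"
      using l2[OF m_closed[OF h g12(1)]] by blast
    have "string_length step (pt h) (pt (h \<otimes>\<^bsub>G\<^esub> (g1 \<otimes>\<^bsub>G\<^esub> g2))) (a + b)"
      using string_length_append[OF a(2) b(2)] h g12 by (simp add: m_assoc)
    then show ?thesis using a(1) b(1) by (meson add_mono)
  qed
  then show ?case by blast
qed

section \<open>The coned-off Cayley graph\<close>

definition coned_off_complex :: "('g, 'm) monoid_scheme \<Rightarrow> 'g set \<Rightarrow> 'g set set \<Rightarrow> 'g coned_vertex set set" where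
  "coned_off_complex G S \<H> =
    (\<lambda>v. {v}) ` coned_off_vertices G \<H> \<union> cayley_edges G S \<union> cone_edges G \<H>"

lemma coned_off_points_eq: "coned_off_points G S \<H> = realization (coned_off_complex G S \<H>)"
  by (simp add: coned_off_points_def coned_off_complex_def)

lemma unit_edge_dist_bounds:
  assumes "finite e" "x \<in> geom_simplex e" "y \<in> geom_simplex e"
  shows "unit_edge_dist e x y \<le> 1" "0 \<le> unit_edge_dist e x y"
proof -
  have "(\<Sum>v\<in>e. \<bar>x v - y v\<bar>) \<le> (\<Sum>v\<in>e. x v + y v)"
    using assms by (intro sum_mono) (auto simp: geom_simplex_def abs_le_iff)
  also have "\<dots> = 2" using assms by (simp add: sum.distrib geom_simplex_def)
  finally show "unit_edge_dist e x y \<le> 1" by (simp add: unit_edge_dist_def)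
qed (auto simp: unit_edge_dist_def sum_nonneg)

lemma unit_edge_dist_sym: "unit_edge_dist e x y = unit_edge_dist e y x"
  by (simp add: unit_edge_dist_def abs_minus_commute)

lemma coned_off_step_sym: "coned_off_step G S \<H> x y r \<Longrightarrow> coned_off_step G S \<H> y x r"
  unfolding coned_off_step_def using unit_edge_dist_sym by metis

lemma finite_coned_off_simplex: "\<sigma> \<in> coned_off_complex G S \<H> \<Longrightarrow> finite \<sigma>"
  by (auto simp: coned_off_complex_def cayley_edges_def cone_edges_def)

lemma coned_off_edge_step:
  assumes "e \<in> cayley_edges G S \<union> cone_edges G \<H>" "x \<in> geom_simplex e" "y \<in> geom_simplex e"
  shows "\<exists>r\<le>1. coned_off_step G S \<H> x y r"
proof -
  have "finite e" using assms by (auto simp: cayley_edges_def cone_edges_def)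
  note b = unit_edge_dist_bounds[OF this assms(2,3)]
  show ?thesis
  proof (cases "e \<in> cayley_edges G S")
    case True
    then show ?thesis using b assms(2,3) unfolding coned_off_step_def by blast
  next
    case False
    then have "e \<in> cone_edges G \<H>" using assms(1) by blast
    then have "coned_off_step G S \<H> x y (unit_edge_dist e x y / 2)"
      using assms(2,3) unfolding coned_off_step_def by blast
    moreover have "unit_edge_dist e x y / 2 \<le> 1" using b by simp
    ultimately show ?thesis by blast
  qed
qed

lemma coned_off_simplex_string:
  assumes "\<sigma> \<in> coned_off_complex G S \<H>" "x \<in> geom_simplex \<sigma>" "y \<in> geom_simplex \<sigma>"
  shows "\<exists>l\<le>1. string_length (coned_off_step G S \<H>) x y l"
proof (cases "\<sigma> \<in> cayley_edges G S \<union> cone_edges G \<H>")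
  case True
  from coned_off_edge_step[OF this assms(2,3)] show ?thesis
    using string_length_step[of "coned_off_step G S \<H>"] by blast
next
  case False
  then obtain v where "\<sigma> = {v}" using assms(1) by (auto simp: coned_off_complex_def)
  then have "x = y" using assms(2,3) by (intro ext) (auto simp: geom_simplex_def, metis)
  then show ?thesis using string_length.nil[of "coned_off_step G S \<H>" x] by (intro exI[of _ 0]) simp
qed

lemma coned_off_edge_string:
  assumes "{u, v} \<in> cayley_edges G S \<union> cone_edges G \<H>"
  shows "\<exists>l\<le>1. string_length (coned_off_step G S \<H>) (vertex_point u) (vertex_point v) l"
  by (rule coned_off_simplex_string[of "{u, v}"])
    (use assms in \<open>auto simp: coned_off_complex_def intro!: vertex_point_in_simplex\<close>)

lemma Union_coned_off_complex:
  assumes "group G" "S \<subseteq> carrier G" "\<And>H. H \<in> \<H> \<Longrightarrow> subgroup H G"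
  shows "\<Union>(coned_off_complex G S \<H>) = coned_off_vertices G \<H>"
proof -
  interpret group G by fact
  have "h \<in> carrier G" if "g \<in> carrier G" "H \<in> \<H>" "h \<in> g <#\<^bsub>G\<^esub> H" for g h H
    using l_coset_carrier[OF that(3,1) assms(3)[OF that(2)]] .
  then show ?thesis using assms(2)
    by (auto simp: coned_off_complex_def cayley_edges_def cone_edges_def coned_off_vertices_def)
qed

text \<open>The metric of an edge is half the \<open>l\<^sup>1\<close> distance on Cayley edges and a quarter of it on cone
  edges, hence the constant \<open>1/4\<close>. Connectedness expresses that \<open>S\<close> generates \<open>G\<close>.\<close>

lemma coned_off_simplicial_length_space:
  assumes "group G" and S: "S \<subseteq> carrier G" and gen: "generate G S = carrier G"
    and \<H>: "\<And>H. H \<in> \<H> \<Longrightarrow> subgroup H G"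
  shows "simplicial_length_space (coned_off_complex G S \<H>) (coned_off_step G S \<H>) (1/4) 1"
proof
  interpret group G by fact
  let ?step = "coned_off_step G S \<H>"
  show "finite \<sigma>" if "\<sigma> \<in> coned_off_complex G S \<H>" for \<sigma> using that by (rule finite_coned_off_simplex)
  show "\<exists>\<sigma>\<in>coned_off_complex G S \<H>. x \<in> geom_simplex \<sigma> \<and> y \<in> geom_simplex \<sigma> \<and>
      1/4 * (\<Sum>v\<in>\<sigma>. \<bar>x v - y v\<bar>) \<le> r \<and> r \<le> 1" if step: "?step x y r" for x y r
  proof -
    obtain e where e: "e \<in> cayley_edges G S \<union> cone_edges G \<H>" "x \<in> geom_simplex e" "y \<in> geom_simplex e"
      "r = unit_edge_dist e x y \<or> r = unit_edge_dist e x y / 2"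
      using step unfolding coned_off_step_def by blast
    then have e': "e \<in> coned_off_complex G S \<H>" by (auto simp: coned_off_complex_def)
    note b = unit_edge_dist_bounds[OF finite_coned_off_simplex[OF e'] e(2,3)]
    have "1/4 * (\<Sum>v\<in>e. \<bar>x v - y v\<bar>) = unit_edge_dist e x y / 2"
      by (simp add: unit_edge_dist_def)
    then have "1/4 * (\<Sum>v\<in>e. \<bar>x v - y v\<bar>) \<le> r \<and> r \<le> 1" using e(4) b by linarith
    then show ?thesis using e(2,3) e' by blast
  qed
  show "?step y x r" if "?step x y r" for x y r using that by (rule coned_off_step_sym)
  show "\<exists>l\<le>1. string_length ?step x y l"
    if "\<sigma> \<in> coned_off_complex G S \<H>" "x \<in> geom_simplex \<sigma>" "y \<in> geom_simplex \<sigma>" for \<sigma> x y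
    using that by (rule coned_off_simplex_string)
  have gens: "\<exists>l. \<forall>h\<in>carrier G. \<exists>l'\<le>l. string_length ?step (vertex_point (Elt h)) (vertex_point (Elt (h \<otimes>\<^bsub>G\<^esub> s))) l'"
    if "s \<in> S" for s
  proof -
    have "{Elt h, Elt (h \<otimes>\<^bsub>G\<^esub> s)} \<in> cayley_edges G S \<union> cone_edges G \<H>" if "h \<in> carrier G" for h
      using that \<open>s \<in> S\<close> by (auto simp: cayley_edges_def)
    from coned_off_edge_string[OF this] show ?thesis by blast
  qed
  have elt: "\<exists>l. string_length ?step (vertex_point (Elt \<one>\<^bsub>G\<^esub>)) (vertex_point (Elt g)) l" if "g \<in> carrier G" for g
    using string_along_generated_element[where pt = "\<lambda>h. vertex_point (Elt h)" and step = ?step,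
        OF \<open>group G\<close> S coned_off_step_sym gens, of g]
      that gen l_one[OF that] by (metis one_closed)
  have base: "\<exists>l. string_length ?step (vertex_point (Elt \<one>\<^bsub>G\<^esub>)) (vertex_point v) l"
    if v: "v \<in> coned_off_vertices G \<H>" for v
  proof (cases v)
    case (Elt g)
    then show ?thesis using v elt by (auto simp: coned_off_vertices_def)
  next
    case (Cone C)
    then obtain g H where gH: "g \<in> carrier G" "H \<in> \<H>" "C = g <#\<^bsub>G\<^esub> H" using v by (auto simp: coned_off_vertices_def)
    have "g \<in> g <#\<^bsub>G\<^esub> H" using gH subgroup.one_closed[OF \<H>[OF gH(2)]] by (force simp: l_coset_def)
    then have "{Elt g, Cone C} \<in> cayley_edges G S \<union> cone_edges G \<H>" using gH by (auto simp: cone_edges_def)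
    from coned_off_edge_string[OF this] obtain b where b: "string_length ?step (vertex_point (Elt g)) (vertex_point v) b"
      unfolding Cone by blast
    obtain a where "string_length ?step (vertex_point (Elt \<one>\<^bsub>G\<^esub>)) (vertex_point (Elt g)) a"
      using elt[OF gH(1)] by blast
    from string_length_append[OF this b] show ?thesis by blast
  qed
  show "\<exists>l. string_length ?step (vertex_point u) (vertex_point v) l"
    if "u \<in> \<Union>(coned_off_complex G S \<H>)" "v \<in> \<Union>(coned_off_complex G S \<H>)" for u v
  proof -
    have uv: "u \<in> coned_off_vertices G \<H>" "v \<in> coned_off_vertices G \<H>"
      using that Union_coned_off_complex[OF \<open>group G\<close> S \<H>] by auto
    obtain a b where a: "string_length ?step (vertex_point (Elt \<one>\<^bsub>G\<^esub>)) (vertex_point u) a"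
      and b: "string_length ?step (vertex_point (Elt \<one>\<^bsub>G\<^esub>)) (vertex_point v) b"
      using base[OF uv(1)] base[OF uv(2)] by blast
    have "string_length ?step (vertex_point u) (vertex_point (Elt \<one>\<^bsub>G\<^esub>)) a"
      by (rule string_length_sym[of ?step, OF coned_off_step_sym a])
    from string_length_append[OF this b] show ?thesis by blast
  qed
qed auto

section \<open>The Deligne complex\<close>

lemma push_inj_on:
  assumes "finite \<sigma>" "inj_on f \<sigma>" "x \<in> geom_simplex \<sigma>"
  shows "v \<in> \<sigma> \<Longrightarrow> push f x (f v) = x v" and "w \<notin> f ` \<sigma> \<Longrightarrow> push f x w = 0"
    and "push f x \<in> geom_simplex (f ` \<sigma>)"
proof -
  have supp: "x v = 0" if "v \<notin> \<sigma>" for v using assms(3) that by (auto simp: geom_simplex_def)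
  show 1: "push f x (f v) = x v" if v: "v \<in> \<sigma>" for v
  proof -
    have "{u. x u \<noteq> 0 \<and> f u = f v} = (if x v = 0 then {} else {v})"
      using supp assms(2) v by (auto dest: inj_onD)
    then show ?thesis by (simp add: push_def)
  qed
  show 2: "push f x w = 0" if "w \<notin> f ` \<sigma>" for w
    unfolding push_def using supp that by (intro sum.neutral) auto
  have "0 \<le> push f x w" for w
    unfolding push_def using assms(3) by (intro sum_nonneg) (auto simp: geom_simplex_def)
  moreover have "sum (push f x) (f ` \<sigma>) = 1"
    using assms(2,3) 1 by (simp add: sum.reindex geom_simplex_def)
  ultimately show "push f x \<in> geom_simplex (f ` \<sigma>)" using 2 by (auto simp: geom_simplex_def)
qed

text \<open>Together with the preceding lemma: translation by a group element is a bijection of geometric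
  simplices that only relabels barycentric coordinates.\<close>

lemma push_surj:
  assumes "finite \<sigma>" "inj_on f \<sigma>" "x \<in> geom_simplex (f ` \<sigma>)"
  shows "\<exists>x'\<in>geom_simplex \<sigma>. x = push f x'"
proof -
  define x' where "x' v = (if v \<in> \<sigma> then x (f v) else 0)" for v
  have x': "x' \<in> geom_simplex \<sigma>"
    using assms by (auto simp: geom_simplex_def x'_def sum.reindex)
  have "x w = push f x' w" for w
  proof (cases "w \<in> f ` \<sigma>")
    case True
    then show ?thesis using push_inj_on(1)[OF assms(1,2) x'] by (auto simp: x'_def)
  next
    case False
    then show ?thesis using push_inj_on(2)[OF assms(1,2) x'] assms(3) by (auto simp: geom_simplex_def)
  qed
  then show ?thesis using x' by blast
qed

lemma finite_type_parabolics_subgroup: "H \<in> finite_type_parabolics \<Delta> \<Longrightarrow> subgroup H (artin_group \<Delta>)"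
  by (auto simp: finite_type_parabolics_def finite_type_subsets_def intro: subgroup_std_parabolic)

lemma trivial_finite_type_parabolic: "{\<one>\<^bsub>artin_group \<Delta>\<^esub>} \<in> finite_type_parabolics \<Delta>"
  unfolding finite_type_parabolics_def
  by (rule image_eqI[where x = "{}"]) (simp_all add: std_parabolic_empty empty_finite_type)

lemma deligne_vertices_eq:
  "deligne_vertices \<Delta> = {g <#\<^bsub>artin_group \<Delta>\<^esub> H | g H. g \<in> carrier (artin_group \<Delta>) \<and> H \<in> finite_type_parabolics \<Delta>}"
  by (auto simp: deligne_vertices_def finite_type_parabolics_def)

lemma coset_of_member:
  assumes "C \<in> deligne_vertices \<Delta>" "x \<in> C"
  shows "\<exists>H\<in>finite_type_parabolics \<Delta>. C = x <#\<^bsub>artin_group \<Delta>\<^esub> H" and "x \<in> carrier (artin_group \<Delta>)"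
proof -
  interpret group "artin_group \<Delta>" by (rule group_artin_group)
  obtain g H where gH: "C = g <#\<^bsub>artin_group \<Delta>\<^esub> H" "g \<in> carrier (artin_group \<Delta>)" "H \<in> finite_type_parabolics \<Delta>"
    using assms(1) by (auto simp: deligne_vertices_eq)
  note H = finite_type_parabolics_subgroup[OF gH(3)]
  show "\<exists>H\<in>finite_type_parabolics \<Delta>. C = x <#\<^bsub>artin_group \<Delta>\<^esub> H"
    using l_repr_independence[OF _ gH(2) H] assms(2) gH by blast
  show "x \<in> carrier (artin_group \<Delta>)" using l_coset_carrier[OF _ gH(2) H] assms(2) gH by blast
qed

lemma deligne_vertex_nonempty: "C \<in> deligne_vertices \<Delta> \<Longrightarrow> C \<noteq> {}"
proof -
  assume "C \<in> deligne_vertices \<Delta>"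
  then obtain g H where "C = g <#\<^bsub>artin_group \<Delta>\<^esub> H" "H \<in> finite_type_parabolics \<Delta>"
    by (auto simp: deligne_vertices_eq)
  then show ?thesis
    using subgroup.one_closed[OF finite_type_parabolics_subgroup[of H \<Delta>]] by (auto simp: l_coset_def)
qed

lemma singleton_deligne_vertex:
  assumes "g \<in> carrier (artin_group \<Delta>)"
  shows "{g} \<in> deligne_vertices \<Delta>"
proof -
  interpret group "artin_group \<Delta>" by (rule group_artin_group)
  have "{g} = g <#\<^bsub>artin_group \<Delta>\<^esub> {\<one>\<^bsub>artin_group \<Delta>\<^esub>}" using assms by (simp add: l_coset_def)
  then show ?thesis using assms trivial_finite_type_parabolic unfolding deligne_vertices_eq by blast
qed

lemma translate_deligne_vertex:
  assumes "g \<in> carrier (artin_group \<Delta>)" "C \<in> deligne_vertices \<Delta>"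
  shows "g <#\<^bsub>artin_group \<Delta>\<^esub> C \<in> deligne_vertices \<Delta>"
    and "inv\<^bsub>artin_group \<Delta>\<^esub> g <#\<^bsub>artin_group \<Delta>\<^esub> (g <#\<^bsub>artin_group \<Delta>\<^esub> C) = C"
    and "g <#\<^bsub>artin_group \<Delta>\<^esub> (inv\<^bsub>artin_group \<Delta>\<^esub> g <#\<^bsub>artin_group \<Delta>\<^esub> C) = C"
proof -
  interpret group "artin_group \<Delta>" by (rule group_artin_group)
  obtain h H where hH: "C = h <#\<^bsub>artin_group \<Delta>\<^esub> H" "h \<in> carrier (artin_group \<Delta>)" "H \<in> finite_type_parabolics \<Delta>"
    using assms(2) by (auto simp: deligne_vertices_eq)
  have H: "H \<subseteq> carrier (artin_group \<Delta>)" using subgroup.subset[OF finite_type_parabolics_subgroup[OF hH(3)]] .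
  have C: "C \<subseteq> carrier (artin_group \<Delta>)" using coset_of_member(2)[OF assms(2)] by blast
  show "g <#\<^bsub>artin_group \<Delta>\<^esub> C \<in> deligne_vertices \<Delta>"
    using lcos_m_assoc[OF H assms(1) hH(2)] assms(1) hH unfolding deligne_vertices_eq by auto
  show "inv\<^bsub>artin_group \<Delta>\<^esub> g <#\<^bsub>artin_group \<Delta>\<^esub> (g <#\<^bsub>artin_group \<Delta>\<^esub> C) = C"
    using lcos_m_assoc[OF C, of "inv\<^bsub>artin_group \<Delta>\<^esub> g" g] lcos_mult_one[OF C] assms(1) by simp
  show "g <#\<^bsub>artin_group \<Delta>\<^esub> (inv\<^bsub>artin_group \<Delta>\<^esub> g <#\<^bsub>artin_group \<Delta>\<^esub> C) = C"
    using lcos_m_assoc[OF C, of g "inv\<^bsub>artin_group \<Delta>\<^esub> g"] lcos_mult_one[OF C] assms(1) by simp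
qed

lemma inj_on_translate:
  "g \<in> carrier (artin_group \<Delta>) \<Longrightarrow> \<sigma> \<subseteq> deligne_vertices \<Delta> \<Longrightarrow> inj_on (\<lambda>C. g <#\<^bsub>artin_group \<Delta>\<^esub> C) \<sigma>"
  by (rule inj_on_inverseI[where g = "\<lambda>C. inv\<^bsub>artin_group \<Delta>\<^esub> g <#\<^bsub>artin_group \<Delta>\<^esub> C"])
    (metis translate_deligne_vertex(2) subsetD)

lemma translate_deligne_complex:
  assumes "g \<in> carrier (artin_group \<Delta>)" "\<sigma> \<in> deligne_complex \<Delta>"
  shows "(\<lambda>C. g <#\<^bsub>artin_group \<Delta>\<^esub> C) ` \<sigma> \<in> deligne_complex \<Delta>"
proof -
  have mono: "g <#\<^bsub>artin_group \<Delta>\<^esub> A \<subseteq> g <#\<^bsub>artin_group \<Delta>\<^esub> B" if "A \<subseteq> B" for A B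
    using that by (auto simp: l_coset_def)
  have \<sigma>: "finite \<sigma>" "\<sigma> \<noteq> {}" "\<sigma> \<subseteq> deligne_vertices \<Delta>" "\<And>A B. A \<in> \<sigma> \<Longrightarrow> B \<in> \<sigma> \<Longrightarrow> A \<subseteq> B \<or> B \<subseteq> A"
    using assms(2) by (auto simp: deligne_complex_def subset_chain_def)
  have "(\<lambda>C. g <#\<^bsub>artin_group \<Delta>\<^esub> C) ` \<sigma> \<subseteq> deligne_vertices \<Delta>"
    using \<sigma>(3) translate_deligne_vertex(1)[OF assms(1)] by blast
  moreover have "\<forall>X\<in>(\<lambda>C. g <#\<^bsub>artin_group \<Delta>\<^esub> C) ` \<sigma>. \<forall>Y\<in>(\<lambda>C. g <#\<^bsub>artin_group \<Delta>\<^esub> C) ` \<sigma>. X \<subseteq> Y \<or> Y \<subseteq> X"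
  proof (simp only: ball_simps, intro ballI)
    fix A B assume "A \<in> \<sigma>" "B \<in> \<sigma>"
    from \<sigma>(4)[OF this] show "g <#\<^bsub>artin_group \<Delta>\<^esub> A \<subseteq> g <#\<^bsub>artin_group \<Delta>\<^esub> B \<or> g <#\<^bsub>artin_group \<Delta>\<^esub> B \<subseteq> g <#\<^bsub>artin_group \<Delta>\<^esub> A"
      using mono[of A B] mono[of B A] by blast
  qed
  moreover have "finite ((\<lambda>C. g <#\<^bsub>artin_group \<Delta>\<^esub> C) ` \<sigma>)" "(\<lambda>C. g <#\<^bsub>artin_group \<Delta>\<^esub> C) ` \<sigma> \<noteq> {}"
    using \<sigma>(1,2) by simp_all
  ultimately show ?thesis unfolding deligne_complex_def subset_chain_def by (intro CollectI conjI)
qed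

text \<open>The smallest coset of the chain contains some \<open>g\<close>, which then lies in all of them, so each coset of the chain
  is \<open>g H\<close> for a parabolic subgroup \<open>H\<close>; translating by the inverse of \<open>g\<close> gives a chain of
  parabolic subgroups.\<close>

lemma deligne_simplex_is_translate:
  assumes "\<sigma> \<in> deligne_complex \<Delta>"
  shows "\<exists>g\<in>carrier (artin_group \<Delta>). \<exists>\<tau>\<in>fundamental_domain \<Delta>. \<sigma> = (\<lambda>C. g <#\<^bsub>artin_group \<Delta>\<^esub> C) ` \<tau>"
proof -
  interpret group "artin_group \<Delta>" by (rule group_artin_group)
  have \<sigma>: "finite \<sigma>" "\<sigma> \<noteq> {}" "subset.chain (deligne_vertices \<Delta>) \<sigma>" "\<sigma> \<subseteq> deligne_vertices \<Delta>"
    using assms by (auto simp: deligne_complex_def subset_chain_def)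
  have "\<Inter>\<sigma> \<in> \<sigma>" using \<sigma> by (intro Inter_in_chain)
  then have "\<Inter>\<sigma> \<noteq> {}" using \<sigma>(4) deligne_vertex_nonempty by blast
  then obtain g where g: "\<And>C. C \<in> \<sigma> \<Longrightarrow> g \<in> C" by blast
  have gG: "g \<in> carrier (artin_group \<Delta>)" using \<open>\<Inter>\<sigma> \<in> \<sigma>\<close> g \<sigma>(4) coset_of_member(2) by blast
  then have ig: "inv\<^bsub>artin_group \<Delta>\<^esub> g \<in> carrier (artin_group \<Delta>)" by simp
  define \<tau> where "\<tau> = (\<lambda>C. inv\<^bsub>artin_group \<Delta>\<^esub> g <#\<^bsub>artin_group \<Delta>\<^esub> C) ` \<sigma>"
  have "inv\<^bsub>artin_group \<Delta>\<^esub> g <#\<^bsub>artin_group \<Delta>\<^esub> C \<in> finite_type_parabolics \<Delta>" if C: "C \<in> \<sigma>" for C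
  proof -
    obtain H where H: "H \<in> finite_type_parabolics \<Delta>" "C = g <#\<^bsub>artin_group \<Delta>\<^esub> H"
      using coset_of_member(1)[OF _ g[OF C]] C \<sigma>(4) by blast
    have "H \<subseteq> carrier (artin_group \<Delta>)" using subgroup.subset[OF finite_type_parabolics_subgroup[OF H(1)]] .
    then have "inv\<^bsub>artin_group \<Delta>\<^esub> g <#\<^bsub>artin_group \<Delta>\<^esub> C = H"
      using lcos_m_assoc[of H "inv\<^bsub>artin_group \<Delta>\<^esub> g" g] lcos_mult_one[of H] gG H(2) by simp
    then show ?thesis using H(1) by simp
  qed
  then have "\<tau> \<in> fundamental_domain \<Delta>"
    using translate_deligne_complex[OF ig assms] by (auto simp: fundamental_domain_def \<tau>_def)
  moreover have "\<sigma> = (\<lambda>C. g <#\<^bsub>artin_group \<Delta>\<^esub> C) ` \<tau>"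
    using translate_deligne_vertex(3)[OF gG] \<sigma>(4) by (force simp: \<tau>_def image_image)
  ultimately show ?thesis using gG by blast
qed

lemma finite_fundamental_domain: "finite (fundamental_domain (\<Delta> :: 'v::finite labelled_graph))"
proof -
  have "finite (finite_type_parabolics \<Delta>)" by (simp add: finite_type_parabolics_def)
  moreover have "fundamental_domain \<Delta> \<subseteq> Pow (finite_type_parabolics \<Delta>)" by (auto simp: fundamental_domain_def)
  ultimately show ?thesis by (meson finite_Pow_iff finite_subset)
qed

lemma piecewise_metric_comparable:
  fixes \<Delta> :: "'v::finite labelled_graph"
  assumes "piecewise_euclidean \<Delta> \<rho> \<or> piecewise_hyperbolic \<Delta> \<rho>"
  shows "\<exists>c>0. \<exists>D\<ge>0. \<forall>\<sigma>\<in>fundamental_domain \<Delta>. comparable_to_l1 \<sigma> (\<rho> \<sigma>) c D"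
proof (rule uniformly_comparable_to_l1[OF finite_fundamental_domain])
  fix \<sigma> assume \<sigma>: "\<sigma> \<in> fundamental_domain \<Delta>"
  then have "finite \<sigma>" by (simp add: fundamental_domain_def deligne_complex_def)
  then show "\<exists>c>0. \<exists>D. comparable_to_l1 \<sigma> (\<rho> \<sigma>) c D"
    using assms \<sigma> euclidean_simplex_comparable hyperbolic_simplex_comparable
    unfolding piecewise_euclidean_def piecewise_hyperbolic_def by metis
qed

lemma deligne_edge:
  assumes "C \<in> deligne_vertices \<Delta>" "g \<in> C"
  shows "{{g}, C} \<in> deligne_complex \<Delta>"
  using assms singleton_deligne_vertex[OF coset_of_member(2)[OF assms]]
  by (auto simp: deligne_complex_def subset_chain_def)

lemma Union_deligne_complex: "\<Union>(deligne_complex \<Delta>) = deligne_vertices \<Delta>"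
proof
  show "\<Union>(deligne_complex \<Delta>) \<subseteq> deligne_vertices \<Delta>"
    by (auto simp: deligne_complex_def subset_chain_def)
  show "deligne_vertices \<Delta> \<subseteq> \<Union>(deligne_complex \<Delta>)"
    using deligne_edge deligne_vertex_nonempty by blast
qed

context
  fixes \<Delta> :: "'v::finite labelled_graph"
    and \<rho> :: "'v deligne_vertex set \<Rightarrow> ('v deligne_vertex \<Rightarrow> real) \<Rightarrow> ('v deligne_vertex \<Rightarrow> real) \<Rightarrow> real"
    and c D :: real
  assumes comparable: "\<And>\<sigma>. \<sigma> \<in> fundamental_domain \<Delta> \<Longrightarrow> comparable_to_l1 \<sigma> (\<rho> \<sigma>) c D"
begin

lemma fundamental_domainD:
  "\<sigma> \<in> fundamental_domain \<Delta> \<Longrightarrow> finite \<sigma> \<and> \<sigma> \<in> deligne_complex \<Delta> \<and> \<sigma> \<subseteq> deligne_vertices \<Delta>"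
  by (auto simp: fundamental_domain_def deligne_complex_def subset_chain_def)

lemma comparableD:
  assumes "\<sigma> \<in> fundamental_domain \<Delta>" "x \<in> geom_simplex \<sigma>" "y \<in> geom_simplex \<sigma>"
  shows "\<rho> \<sigma> x y = \<rho> \<sigma> y x" "c * (\<Sum>v\<in>\<sigma>. \<bar>x v - y v\<bar>) \<le> \<rho> \<sigma> x y" "\<rho> \<sigma> x y \<le> D"
  using comparable[OF assms(1)] assms(2,3) unfolding comparable_to_l1_def by blast+

lemma deligne_step_sym:
  assumes "deligne_step \<Delta> \<rho> x y r"
  shows "deligne_step \<Delta> \<rho> y x r"
proof -
  obtain g \<sigma> x' y' where "g \<in> carrier (artin_group \<Delta>)" "\<sigma> \<in> fundamental_domain \<Delta>"
    "x' \<in> geom_simplex \<sigma>" "x = push (\<lambda>C. g <#\<^bsub>artin_group \<Delta>\<^esub> C) x'"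
    "y' \<in> geom_simplex \<sigma>" "y = push (\<lambda>C. g <#\<^bsub>artin_group \<Delta>\<^esub> C) y'" "r = \<rho> \<sigma> x' y'"
    using assms unfolding deligne_step_def by blast
  then show ?thesis using comparableD(1)[of \<sigma> x' y'] unfolding deligne_step_def by blast
qed

text \<open>A translate inherits the comparison with \<open>l\<^sup>1\<close> from the fundamental domain, since relabelling
  coordinates preserves the \<open>l\<^sup>1\<close> distance.\<close>

lemma deligne_step_in_simplex:
  assumes "deligne_step \<Delta> \<rho> x y r"
  shows "\<exists>\<sigma>\<in>deligne_complex \<Delta>. x \<in> geom_simplex \<sigma> \<and> y \<in> geom_simplex \<sigma> \<and>
    c * (\<Sum>v\<in>\<sigma>. \<bar>x v - y v\<bar>) \<le> r \<and> r \<le> D"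
proof -
  obtain g \<sigma> x' y' where g: "g \<in> carrier (artin_group \<Delta>)" and \<sigma>: "\<sigma> \<in> fundamental_domain \<Delta>"
    and x': "x' \<in> geom_simplex \<sigma>" "x = push (\<lambda>C. g <#\<^bsub>artin_group \<Delta>\<^esub> C) x'"
    and y': "y' \<in> geom_simplex \<sigma>" "y = push (\<lambda>C. g <#\<^bsub>artin_group \<Delta>\<^esub> C) y'"
    and r: "r = \<rho> \<sigma> x' y'"
    using assms unfolding deligne_step_def by blast
  define f where "f = (\<lambda>C. g <#\<^bsub>artin_group \<Delta>\<^esub> C)"
  have f: "finite \<sigma>" "inj_on f \<sigma>" using fundamental_domainD[OF \<sigma>] inj_on_translate[OF g] by (auto simp: f_def)
  note px = push_inj_on[OF f x'(1)] and py = push_inj_on[OF f y'(1)]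
  have "(\<Sum>v\<in>f ` \<sigma>. \<bar>x v - y v\<bar>) = (\<Sum>v\<in>\<sigma>. \<bar>x' v - y' v\<bar>)"
    using px(1) py(1) x'(2) y'(2) by (simp add: sum.reindex[OF f(2)] flip: f_def)
  then have "c * (\<Sum>v\<in>f ` \<sigma>. \<bar>x v - y v\<bar>) \<le> r \<and> r \<le> D"
    using comparableD(2,3)[OF \<sigma> x'(1) y'(1)] r by simp
  moreover have "f ` \<sigma> \<in> deligne_complex \<Delta>"
    unfolding f_def using translate_deligne_complex[OF g] fundamental_domainD[OF \<sigma>] by blast
  moreover have "x \<in> geom_simplex (f ` \<sigma>)" "y \<in> geom_simplex (f ` \<sigma>)"
    using px(3) py(3) x'(2) y'(2) by (auto simp: f_def)
  ultimately show ?thesis by blast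
qed

lemma deligne_simplex_step:
  assumes "\<sigma> \<in> deligne_complex \<Delta>" "x \<in> geom_simplex \<sigma>" "y \<in> geom_simplex \<sigma>"
  shows "\<exists>r\<le>D. deligne_step \<Delta> \<rho> x y r"
proof -
  obtain g \<tau> where g: "g \<in> carrier (artin_group \<Delta>)" and \<tau>: "\<tau> \<in> fundamental_domain \<Delta>"
    and \<sigma>: "\<sigma> = (\<lambda>C. g <#\<^bsub>artin_group \<Delta>\<^esub> C) ` \<tau>"
    using deligne_simplex_is_translate[OF assms(1)] by blast
  have f: "finite \<tau>" "inj_on (\<lambda>C. g <#\<^bsub>artin_group \<Delta>\<^esub> C) \<tau>"
    using fundamental_domainD[OF \<tau>] inj_on_translate[OF g] by auto
  obtain x' y' where "x' \<in> geom_simplex \<tau>" "x = push (\<lambda>C. g <#\<^bsub>artin_group \<Delta>\<^esub> C) x'"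
    "y' \<in> geom_simplex \<tau>" "y = push (\<lambda>C. g <#\<^bsub>artin_group \<Delta>\<^esub> C) y'"
    using push_surj[OF f] assms(2,3) unfolding \<sigma> by metis
  then have "deligne_step \<Delta> \<rho> x y (\<rho> \<tau> x' y')" "\<rho> \<tau> x' y' \<le> D"
    using g \<tau> comparableD(3)[OF \<tau>] unfolding deligne_step_def by blast+
  then show ?thesis by blast
qed

lemma deligne_simplex_string:
  assumes "\<sigma> \<in> deligne_complex \<Delta>" "u \<in> \<sigma>" "v \<in> \<sigma>"
  shows "\<exists>l\<le>D. string_length (deligne_step \<Delta> \<rho>) (vertex_point u) (vertex_point v) l"
proof -
  have "finite \<sigma>" using assms(1) by (simp add: deligne_complex_def)
  then have "vertex_point u \<in> geom_simplex \<sigma>" "vertex_point v \<in> geom_simplex \<sigma>"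
    using assms by (auto intro: vertex_point_in_simplex)
  from deligne_simplex_step[OF assms(1) this] show ?thesis
    using string_length_step[of "deligne_step \<Delta> \<rho>"] by blast
qed

text \<open>For a standard generator \<open>t\<close> the cosets \<open>{h}\<close> and \<open>{h t}\<close> are both contained in \<open>h G\<^sub>T\<close> with \<open>T = {t}\<close>,
  a vertex of the complex because \<open>T\<close> is of finite type.\<close>

lemma deligne_string_along_element:
  assumes "g \<in> carrier (artin_group \<Delta>)"
  shows "\<exists>l. \<forall>h\<in>carrier (artin_group \<Delta>). \<exists>l'\<le>l.
    string_length (deligne_step \<Delta> \<rho>) (vertex_point {h}) (vertex_point {h \<otimes>\<^bsub>artin_group \<Delta>\<^esub> g}) l'"
proof (rule string_along_generated_element[OF group_artin_group, where S = "artin_gen \<Delta> ` verts \<Delta>"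
      and step = "deligne_step \<Delta> \<rho>" and pt = "\<lambda>h. vertex_point {h}"])
  interpret group "artin_group \<Delta>" by (rule group_artin_group)
  show "artin_gen \<Delta> ` verts \<Delta> \<subseteq> carrier (artin_group \<Delta>)" by (auto intro: artin_gen_carrier)
  show "g \<in> generate (artin_group \<Delta>) (artin_gen \<Delta> ` verts \<Delta>)" using assms by (simp add: generate_artin_gen)
  show "deligne_step \<Delta> \<rho> y x r" if "deligne_step \<Delta> \<rho> x y r" for x y r using that by (rule deligne_step_sym)
  fix s assume "s \<in> artin_gen \<Delta> ` verts \<Delta>"
  then obtain t where t: "t \<in> verts \<Delta>" "s = artin_gen \<Delta> t" by blast
  have sG: "s \<in> carrier (artin_group \<Delta>)" using artin_gen_carrier[OF t(1)] t(2) by simp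
  define H where "H = std_parabolic \<Delta> {t}"
  have H: "H \<in> finite_type_parabolics \<Delta>"
    using singleton_finite_type[OF t(1)] by (auto simp: H_def finite_type_parabolics_def)
  have sH: "s \<in> H" unfolding H_def std_parabolic_def t by (rule generate.incl) simp
  have "\<exists>l'\<le>D + D. string_length (deligne_step \<Delta> \<rho>) (vertex_point {h}) (vertex_point {h \<otimes>\<^bsub>artin_group \<Delta>\<^esub> s}) l'"
    if h: "h \<in> carrier (artin_group \<Delta>)" for h
  proof -
    define C where "C = h <#\<^bsub>artin_group \<Delta>\<^esub> H"
    have C: "C \<in> deligne_vertices \<Delta>" using h H by (auto simp: deligne_vertices_eq C_def)
    have "h \<in> C" "h \<otimes>\<^bsub>artin_group \<Delta>\<^esub> s \<in> C"
      using subgroup.one_closed[OF finite_type_parabolics_subgroup[OF H]] sH r_one[OF h]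
      unfolding C_def l_coset_def by force+
    note hC = deligne_edge[OF C this(1)] and hsC = deligne_edge[OF C this(2)]
    obtain a where a: "a \<le> D" "string_length (deligne_step \<Delta> \<rho>) (vertex_point {h}) (vertex_point C) a"
      using deligne_simplex_string[OF hC, of "{h}" C] by blast
    obtain b where b: "b \<le> D" "string_length (deligne_step \<Delta> \<rho>) (vertex_point C) (vertex_point {h \<otimes>\<^bsub>artin_group \<Delta>\<^esub> s}) b"
      using deligne_simplex_string[OF hsC, of C "{h \<otimes>\<^bsub>artin_group \<Delta>\<^esub> s}"] by blast
    have "a + b \<le> D + D" using a(1) b(1) by simp
    then show ?thesis using string_length_append[OF a(2) b(2)] by blast
  qed
  then show "\<exists>l. \<forall>h\<in>carrier (artin_group \<Delta>). \<exists>l'\<le>l.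
      string_length (deligne_step \<Delta> \<rho>) (vertex_point {h}) (vertex_point {h \<otimes>\<^bsub>artin_group \<Delta>\<^esub> s}) l'"
    by blast
qed

lemma deligne_simplicial_length_space:
  assumes "0 < c" "0 \<le> D"
  shows "simplicial_length_space (deligne_complex \<Delta>) (deligne_step \<Delta> \<rho>) c D"
proof
  interpret group "artin_group \<Delta>" by (rule group_artin_group)
  let ?step = "deligne_step \<Delta> \<rho>"
  show "finite \<sigma>" if "\<sigma> \<in> deligne_complex \<Delta>" for \<sigma> using that by (simp add: deligne_complex_def)
  show "\<exists>\<sigma>\<in>deligne_complex \<Delta>. x \<in> geom_simplex \<sigma> \<and> y \<in> geom_simplex \<sigma> \<and>
      c * (\<Sum>v\<in>\<sigma>. \<bar>x v - y v\<bar>) \<le> r \<and> r \<le> D" if "?step x y r" for x y r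
    using that by (rule deligne_step_in_simplex)
  show "?step y x r" if "?step x y r" for x y r using that by (rule deligne_step_sym)
  show "\<exists>l\<le>D. string_length ?step x y l"
    if "\<sigma> \<in> deligne_complex \<Delta>" "x \<in> geom_simplex \<sigma>" "y \<in> geom_simplex \<sigma>" for \<sigma> x y
    using deligne_simplex_step[OF that] string_length_step[of ?step] by blast
  have base: "\<exists>l. string_length ?step (vertex_point {\<one>\<^bsub>artin_group \<Delta>\<^esub>}) (vertex_point C) l"
    if C: "C \<in> deligne_vertices \<Delta>" for C
  proof -
    obtain g where g: "g \<in> C" using deligne_vertex_nonempty[OF C] by blast
    have gG: "g \<in> carrier (artin_group \<Delta>)" using coset_of_member(2)[OF C g] .
    obtain a where a: "string_length ?step (vertex_point {\<one>\<^bsub>artin_group \<Delta>\<^esub>}) (vertex_point {g}) a"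
      using deligne_string_along_element[OF gG] l_one[OF gG] by (metis one_closed)
    obtain b where b: "string_length ?step (vertex_point {g}) (vertex_point C) b"
      using deligne_simplex_string[OF deligne_edge[OF C g], of "{g}" C] by blast
    from string_length_append[OF a b] show ?thesis by blast
  qed
  show "\<exists>l. string_length ?step (vertex_point u) (vertex_point v) l"
    if uv: "u \<in> \<Union>(deligne_complex \<Delta>)" "v \<in> \<Union>(deligne_complex \<Delta>)" for u v
  proof -
    obtain a b where a: "string_length ?step (vertex_point {\<one>\<^bsub>artin_group \<Delta>\<^esub>}) (vertex_point u) a"
      and b: "string_length ?step (vertex_point {\<one>\<^bsub>artin_group \<Delta>\<^esub>}) (vertex_point v) b"
      using base uv unfolding Union_deligne_complex by blast
    have "string_length ?step (vertex_point u) (vertex_point {\<one>\<^bsub>artin_group \<Delta>\<^esub>}) a"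
      by (rule string_length_sym[of ?step, OF deligne_step_sym a])
    from string_length_append[OF this b] show ?thesis by blast
  qed
qed (use assms in auto)

end

section \<open>Comparison of the two spaces\<close>

theorem theorem1p1:
  fixes \<Delta> :: "'v::finite labelled_graph"
    and S :: "'v word set set"
    and \<rho> :: "'v deligne_vertex set \<Rightarrow> ('v deligne_vertex \<Rightarrow> real) \<Rightarrow> ('v deligne_vertex \<Rightarrow> real) \<Rightarrow> real"
  assumes "defining_graph \<Delta>"
    and "finite S" and "S \<subseteq> carrier (artin_group \<Delta>)"
    and "generate (artin_group \<Delta>) S = carrier (artin_group \<Delta>)"
    and "piecewise_euclidean \<Delta> \<rho> \<or> piecewise_hyperbolic \<Delta> \<rho>"
  shows "weakly_hyperbolic_rel (artin_group \<Delta>) S (finite_type_parabolics \<Delta>) \<longleftrightarrow>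
    gromov_hyperbolic (realization (deligne_complex \<Delta>)) (deligne_dist \<Delta> \<rho>)"
proof -
  define \<H> where "\<H> = finite_type_parabolics \<Delta>"
  define G where "G = artin_group \<Delta>"
  interpret group G unfolding G_def by (rule group_artin_group)
  have S: "S \<subseteq> carrier G" and gen: "generate G S = carrier G" using assms(3,4) by (auto simp: G_def)
  have \<H>: "subgroup H G" if "H \<in> \<H>" for H
    using that unfolding G_def \<H>_def by (rule finite_type_parabolics_subgroup)
  obtain c D where cD: "0 < c" "0 \<le> D" "\<And>\<sigma>. \<sigma> \<in> fundamental_domain \<Delta> \<Longrightarrow> comparable_to_l1 \<sigma> (\<rho> \<sigma>) c D"
    using piecewise_metric_comparable[OF assms(5)] by blast
  let ?K1 = "coned_off_complex G S \<H>" and ?K2 = "deligne_complex \<Delta>"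
  let ?s1 = "coned_off_step G S \<H>" and ?s2 = "deligne_step \<Delta> \<rho>"
  have space1: "simplicial_length_space ?K1 ?s1 (1/4) 1"
    by (rule coned_off_simplicial_length_space[OF group_axioms S gen \<H>])
  have space2: "simplicial_length_space ?K2 ?s2 c D"
    by (rule deligne_simplicial_length_space[OF cD(3) cD(1,2)])
  interpret S1: simplicial_length_space ?K1 ?s1 "1/4" 1 by (rule space1)
  interpret S2: simplicial_length_space ?K2 ?s2 c D by (rule space2)
  have "coned_off_vertices G \<H> = Elt ` carrier G \<union> Cone ` deligne_vertices \<Delta>"
    unfolding coned_off_vertices_def deligne_vertices_eq G_def \<H>_def by blast
  then have V1: "\<Union>?K1 = Elt ` carrier G \<union> Cone ` deligne_vertices \<Delta>"
    using Union_coned_off_complex[OF group_axioms S \<H>] by simp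
  have V2: "\<Union>?K2 = deligne_vertices \<Delta>" by (rule Union_deligne_complex)
  define \<phi> where "\<phi> v = (case v of Elt g \<Rightarrow> {g} | Cone C \<Rightarrow> C)" for v :: "'v word set coned_vertex"
  have \<phi>: "\<phi> v \<in> \<Union>?K2" if "v \<in> \<Union>?K1" for v
    using that singleton_deligne_vertex[of _ \<Delta>] unfolding V1 V2 by (auto simp: \<phi>_def G_def)
  have Cone: "Cone C \<in> \<Union>?K1" if "C \<in> \<Union>?K2" for C
    using that unfolding V1 V2 by blast
  have Elt_Cone: "S1.distance (vertex_point (Elt h)) (vertex_point (Cone C)) \<le> 1"
    if C: "C \<in> deligne_vertices \<Delta>" "h \<in> C" for h C
  proof -
    obtain H where "H \<in> \<H>" "C = h <#\<^bsub>G\<^esub> H" "h \<in> carrier G"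
      using coset_of_member[OF C] by (auto simp: G_def \<H>_def)
    then have e: "{Elt h, Cone C} \<in> cayley_edges G S \<union> cone_edges G \<H>"
      using C by (auto simp: cone_edges_def)
    then have "{Elt h, Cone C} \<in> ?K1" by (auto simp: coned_off_complex_def)
    then have M: "vertex_point (Elt h) \<in> realization ?K1" "vertex_point (Cone C) \<in> realization ?K1"
      by (auto intro!: S1.vertex_point_in_points)
    from coned_off_edge_string[OF e] obtain l where "l \<le> 1" "string_length ?s1 (vertex_point (Elt h)) (vertex_point (Cone C)) l"
      by blast
    then show ?thesis using S1.distance_le[OF M] by (meson order_trans)
  qed
  have Cone_lip: "S1.distance (vertex_point (Cone B)) (vertex_point (Cone C)) \<le> 2"
    if \<sigma>: "\<sigma> \<in> ?K2" "B \<in> \<sigma>" "C \<in> \<sigma>" for \<sigma> B C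
  proof -
    have BC: "B \<in> deligne_vertices \<Delta>" "C \<in> deligne_vertices \<Delta>" "B \<subseteq> C \<or> C \<subseteq> B"
      using \<sigma> by (auto simp: deligne_complex_def subset_chain_def)
    then obtain h where h: "h \<in> B" "h \<in> C" using deligne_vertex_nonempty by blast
    have "Elt h \<in> \<Union>?K1"
      unfolding V1 using coset_of_member(2)[OF BC(1) h(1)] by (auto simp: G_def)
    then have M: "vertex_point (Elt h) \<in> realization ?K1" by (rule S1.vertex_point_in_points)
    show ?thesis
      using S1.triangle[of "vertex_point (Cone B)" "vertex_point (Elt h)" "vertex_point (Cone C)"]
        Elt_Cone[OF BC(1) h(1)] Elt_Cone[OF BC(2) h(2)] M
        S1.vertex_point_in_points[OF Cone[of B]] S1.vertex_point_in_points[OF Cone[of C]] BC(1,2)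
        S1.commute[of "vertex_point (Cone B)" "vertex_point (Elt h)"]
      unfolding V2 by linarith
  qed
  have simplex2: "S2.distance (vertex_point B) (vertex_point C) \<le> D"
    if \<sigma>: "\<sigma> \<in> ?K2" "B \<in> \<sigma>" "C \<in> \<sigma>" for \<sigma> B C
  proof -
    have M: "vertex_point B \<in> realization ?K2" "vertex_point C \<in> realization ?K2"
      using \<sigma> by (auto intro: S2.vertex_point_in_points)
    from deligne_simplex_string[OF cD(3) \<sigma>] obtain l where "l \<le> D" "string_length ?s2 (vertex_point B) (vertex_point C) l"
      by blast
    then show ?thesis using S2.distance_le[OF M] by (meson order_trans)
  qed
  have "\<exists>l. \<forall>h\<in>carrier G. S2.distance (vertex_point {h}) (vertex_point {h \<otimes>\<^bsub>G\<^esub> s}) \<le> l" if s: "s \<in> S" for s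
  proof -
    have sG: "s \<in> carrier G" using s S by blast
    obtain l where l: "\<And>h. h \<in> carrier G \<Longrightarrow> \<exists>l'\<le>l. string_length ?s2 (vertex_point {h}) (vertex_point {h \<otimes>\<^bsub>G\<^esub> s}) l'"
      using deligne_string_along_element[OF cD(3) sG[unfolded G_def]] unfolding G_def by blast
    have "S2.distance (vertex_point {h}) (vertex_point {h \<otimes>\<^bsub>G\<^esub> s}) \<le> l" if h: "h \<in> carrier G" for h
    proof -
      have "{h} \<in> \<Union>?K2" "{h \<otimes>\<^bsub>G\<^esub> s} \<in> \<Union>?K2"
        unfolding V2 using singleton_deligne_vertex h m_closed[OF h sG] by (auto simp: G_def)
      then have M: "vertex_point {h} \<in> realization ?K2" "vertex_point {h \<otimes>\<^bsub>G\<^esub> s} \<in> realization ?K2"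
        by (auto intro: S2.vertex_point_in_points)
      show ?thesis using l[OF h] S2.distance_le[OF M] by (meson order_trans)
    qed
    then show ?thesis by blast
  qed
  then obtain l where l: "\<And>s h. s \<in> S \<Longrightarrow> h \<in> carrier G \<Longrightarrow>
      S2.distance (vertex_point {h}) (vertex_point {h \<otimes>\<^bsub>G\<^esub> s}) \<le> l s" by metis
  \<comment> \<open>large enough for all the estimates above at once; here the finiteness of \<open>S\<close> enters\<close>
  define L where "L = 2 + D + (\<Sum>s\<in>S. \<bar>l s\<bar>)"
  have L: "0 \<le> L" "2 \<le> L" "D \<le> L" "\<And>s. s \<in> S \<Longrightarrow> l s \<le> L"
  proof -
    have n: "0 \<le> (\<Sum>s\<in>S. \<bar>l s\<bar>)" by (rule sum_nonneg) simp
    then show "0 \<le> L" "2 \<le> L" "D \<le> L" using cD(2) by (auto simp: L_def)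
    show "l s \<le> L" if "s \<in> S" for s
      using member_le_sum[OF that, of "\<lambda>s. \<bar>l s\<bar>"] assms(2) cD(2) by (auto simp: L_def)
  qed
  have \<phi>_lip: "S2.distance (vertex_point (\<phi> u)) (vertex_point (\<phi> v)) \<le> L"
    if \<sigma>: "\<sigma> \<in> ?K1" "u \<in> \<sigma>" "v \<in> \<sigma>" for \<sigma> u v
  proof (cases "u = v")
    case True
    have "vertex_point (\<phi> v) \<in> realization ?K2" using \<phi> \<sigma> by (intro S2.vertex_point_in_points) blast
    then show ?thesis using True L by simp
  next
    case False
    then have "\<sigma> = {u, v}" "\<sigma> \<in> cayley_edges G S \<union> cone_edges G \<H>"
      using \<sigma> by (auto simp: coned_off_complex_def cayley_edges_def cone_edges_def)
    then consider g s where "g \<in> carrier G" "s \<in> S" "{u, v} = {Elt g, Elt (g \<otimes>\<^bsub>G\<^esub> s)}"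
      | g h H where "g \<in> carrier G" "H \<in> \<H>" "h \<in> g <#\<^bsub>G\<^esub> H" "{u, v} = {Elt h, Cone (g <#\<^bsub>G\<^esub> H)}"
      by (auto simp: cayley_edges_def cone_edges_def)
    then show ?thesis
    proof cases
      case 1
      have "S2.distance (vertex_point {g}) (vertex_point {g \<otimes>\<^bsub>G\<^esub> s}) \<le> L"
        using l[OF 1(2,1)] L(4)[OF 1(2)] by linarith
      then show ?thesis
        using 1(3) S2.commute[of "vertex_point {g}" "vertex_point {g \<otimes>\<^bsub>G\<^esub> s}"]
        by (auto simp: doubleton_eq_iff \<phi>_def)
    next
      case 2
      define C where "C = g <#\<^bsub>G\<^esub> H"
      have C: "C \<in> deligne_vertices \<Delta>" using 2 by (auto simp: C_def deligne_vertices_eq G_def \<H>_def)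
      have "S2.distance (vertex_point {h}) (vertex_point C) \<le> L"
        using simplex2[OF deligne_edge[OF C 2(3)[folded C_def]], of "{h}" C] L(3) by simp
      then show ?thesis
        using 2(4) S2.commute[of "vertex_point {h}" "vertex_point C"]
        unfolding C_def[symmetric] by (auto simp: doubleton_eq_iff \<phi>_def)
    qed
  qed
  have Cone_\<phi>: "S1.distance (vertex_point (Cone (\<phi> v))) (vertex_point v) \<le> L" if v: "v \<in> \<Union>?K1" for v
  proof (cases v)
    case (Elt g)
    then have g: "g \<in> carrier (artin_group \<Delta>)" using v unfolding V1 by (auto simp: G_def)
    show ?thesis using Elt_Cone[OF singleton_deligne_vertex[OF g], of g] L
        S1.commute[of "vertex_point (Elt g)" "vertex_point (Cone {g})"] by (simp add: Elt \<phi>_def)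
  next
    case (Cone C)
    then show ?thesis using S1.vertex_point_in_points[OF v] L by (simp add: \<phi>_def)
  qed
  have \<phi>_Cone: "S2.distance (vertex_point (\<phi> (Cone C))) (vertex_point C) \<le> L" if "C \<in> \<Union>?K2" for C
    using S2.vertex_point_in_points[OF that] L by (simp add: \<phi>_def)
  have Cone_lip': "S1.distance (vertex_point (Cone B)) (vertex_point (Cone C)) \<le> L"
    if "\<sigma> \<in> ?K2" "B \<in> \<sigma>" "C \<in> \<sigma>" for \<sigma> B C
    using Cone_lip[OF that] L by linarith
  have "gromov_hyperbolic (realization ?K1) S1.distance \<longleftrightarrow> gromov_hyperbolic (realization ?K2) S2.distance"
  proof
    assume hyp: "gromov_hyperbolic (realization ?K1) S1.distance"
    show "gromov_hyperbolic (realization ?K2) S2.distance"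
      by (rule gromov_hyperbolic_if_vertex_map[OF space2 space1, where \<phi> = Cone and \<psi> = \<phi> and L = L])
        (fact Cone \<phi> L(1) Cone_lip' \<phi>_lip \<phi>_Cone hyp)+
  next
    assume hyp: "gromov_hyperbolic (realization ?K2) S2.distance"
    show "gromov_hyperbolic (realization ?K1) S1.distance"
      by (rule gromov_hyperbolic_if_vertex_map[OF space1 space2, where \<phi> = \<phi> and \<psi> = Cone and L = L])
        (fact \<phi> Cone L(1) \<phi>_lip Cone_lip' Cone_\<phi> hyp)+
  qed
  then show ?thesis
    by (simp add: weakly_hyperbolic_rel_def deligne_dist_def coned_off_points_eq G_def \<H>_def)
qed

end
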